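(* On $\mathcal C_>=\mathbb R^5$ with coordinates $(x,y,z,a,b)$, consider the CR structure $$\Big(\mathcal C_>,\ [\mathrm dz-a\,\mathrm dx-b\,\mathrm dy],\ \big[\big((1+a^2)\mathrm db-ab\,\mathrm da\big)\mathrm dx-\big((1+b^2)\mathrm da-ab\,\mathrm db\big)\mathrm dy\big]\Big).$$ Its Lie algebra of infinitesimal symmetries is the 15-dimensional Lie algebra $\mathfrak{su}(2,2)$, and it is spanned by the following 15 vector fields on $\mathcal C_>$: $$\begin{aligned} X_1&=-z(x\partial_x+y\partial_y)+\tfrac12(x^2+y^2-z^2)\partial_z+\big((1+a^2)x+aby\big)\partial_a+\big((1+b^2)y+abx\big)\partial_b,\\ X_2&=\tfrac12(y^2+z^2-x^2)\partial_x-x(y\partial_y+z\partial_z)-\big((1+a^2)z-by\big)\partial_a-a(bz+y)\partial_b,\\ X_3&=y(x\partial_x+z\partial_z)+\tfrac12(y^2-x^2-z^2)\partial_y+b(az+x)\partial_a+\big((1+b^2)z-ax\big)\partial_b,\\ X_4&=\tfrac12\tfrac{x^2+y^2+z^2}{\sqrt{a^2+b^2+1}}(\partial_z-a\partial_x-b\partial_y)+\sqrt{a^2+b^2+1}\,\big((az+x)\partial_a+(bz+y)\partial_b\big),\\ X_5&=-z\partial_x+x\partial_z+(a^2+1)\partial_a+ab\partial_b,\\ X_6&=-z\partial_y+y\partial_z+ab\partial_a+(b^2+1)\partial_b,\\ X_7&=y\partial_x-x\partial_y+b\partial_a-a\partial_b,\\ X_8&=\tfrac{x}{\sqrt{a^2+b^2+1}}(\partial_z-a\partial_x-b\partial_y)+\sqrt{a^2+b^2+1}\,\partial_a,\\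 X_9&=\tfrac{z}{\sqrt{a^2+b^2+1}}(\partial_z-a\partial_x-b\partial_y)+\sqrt{a^2+b^2+1}\,(a\partial_a+b\partial_b),\\ X_{10}&=\tfrac{y}{\sqrt{a^2+b^2+1}}(\partial_z-a\partial_x-b\partial_y)+\sqrt{a^2+b^2+1}\,\partial_b,\\ X_{11}&=\tfrac{1}{\sqrt{a^2+b^2+1}}(\partial_z-a\partial_x-b\partial_y),\\ X_{12}&=x\partial_x+y\partial_y+z\partial_z,\quad X_{13}=\partial_x,\quad X_{14}=\partial_y,\quad X_{15}=\partial_z. \end{aligned}$$
   Context: Let $\omega^0=\mathrm dz-a\,\mathrm dx-b\,\mathrm dy$ (a contact form), $\mathcal D=\ker\omega^0$, and let $g=\big((1+a^2)\mathrm db-ab\,\mathrm da\big)\mathrm dx-\big((1+b^2)\mathrm da-ab\,\mathrm db\big)\mathrm dy$ (symmetric products of 1-forms). Restricted to $\mathcal D$, $g$ has split signature, and with $\Omega=(\mathrm d\omega^0)|_{\mathcal D}$ the endomorphism $K^i{}_j=g^{ik}\Omega_{kj}$ of $\mathcal D$ satisfies, after suitable rescaling of $g$ and $\Omega$, $K^2=-\mathrm{Id}$; $(\mathcal D,K)$ is the hypersurface type CR structure referred to. The brackets $[\cdot]$ denote classes up to multiplication by nonvanishing functions (and, for $g$, only its restriction to $\mathcal D$ matters). An infinitesimal symmetry is a vector field $X$ on $\mathcal C_>$ such that $\mathcal L_X\omega^0=p\,\omega^0$ and $\mathcal L_Xg=q\,g+\mu\,\omega^0$ for some functions $p,q$ and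 some 1-form $\mu$ on $\mathcal C_>$, the last term being a symmetric product. (The space $\mathcal C_>$ parametrizes positions $(x,y,z)$ of a "flying saucer" with unit normal $\vec n=(-a,-b,1)/\sqrt{1+a^2+b^2}$; the structure comes from its landing mode man\oe uvres.) *)

theory Defs
  imports "HOL-Analysis.Analysis" "HOL-Library.Function_Algebras"
begin

section \<open>Vector fields as a real vector space\<close>

instantiation "fun" :: (type, real_vector) real_vector
begin

definition "scaleR_fun r f = (\<lambda>x. r *\<^sub>R f x)"

instance
  by standard (auto simp: scaleR_fun_def plus_fun_def scaleR_add_right scaleR_add_left)

end


section \<open>Smooth tensor fields on a Euclidean space\<close>

text \<open>Vector fields, 1-forms and covariant 2-tensors on \<open>'a\<close> are given in the global
  trivialisation of the tangent bundle by \<open>'a\<close>: a 1-form \<open>\<omega>\<close> maps a point \<open>p\<close> and a tangent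
  vector \<open>v\<close> to \<open>\<omega> p v\<close>.\<close>

type_synonym 'a vector_field = "'a \<Rightarrow> 'a"
type_synonym 'a one_form = "'a \<Rightarrow> 'a \<Rightarrow> real"
type_synonym 'a two_tensor = "'a \<Rightarrow> 'a \<Rightarrow> 'a \<Rightarrow> real"

primrec continuously_differentiable ::
  "nat \<Rightarrow> ('a::euclidean_space \<Rightarrow> 'b::real_normed_vector) \<Rightarrow> bool" where
  "continuously_differentiable 0 f \<longleftrightarrow> continuous_on UNIV f"
| "continuously_differentiable (Suc k) f \<longleftrightarrow>
     f differentiable_on UNIV \<and>
     (\<forall>v. continuously_differentiable k (\<lambda>p. frechet_derivative f (at p) v))"

definition smooth :: "('a::euclidean_space \<Rightarrow> 'b::real_normed_vector) \<Rightarrow> bool" where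
  "smooth f \<longleftrightarrow> (\<forall>k. continuously_differentiable k f)"

definition smooth_one_form :: "'a::euclidean_space one_form \<Rightarrow> bool" where
  "smooth_one_form \<mu> \<longleftrightarrow> (\<forall>p. linear (\<mu> p)) \<and> (\<forall>v. smooth (\<lambda>p. \<mu> p v))"

definition lie_bracket ::
  "'a::euclidean_space vector_field \<Rightarrow> 'a vector_field \<Rightarrow> 'a vector_field" where
  "lie_bracket X Y p = frechet_derivative Y (at p) (X p) - frechet_derivative X (at p) (Y p)"

text \<open>The Lie derivatives below are the coordinate formulas
  $(\mathcal L_X\omega)_i = X^k\partial_k\omega_i + \omega_k\partial_iX^k$ and
  $(\mathcal L_Xg)_{ij} = X^k\partial_kg_{ij} + g_{kj}\partial_iX^k + g_{ik}\partial_jX^k$,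
  contracted with constant vectors.\<close>

definition lie_derivative_form ::
  "'a::euclidean_space vector_field \<Rightarrow> 'a one_form \<Rightarrow> 'a one_form" where
  "lie_derivative_form X \<omega> p v =
     frechet_derivative (\<lambda>q. \<omega> q v) (at p) (X p) + \<omega> p (frechet_derivative X (at p) v)"

definition lie_derivative_tensor ::
  "'a::euclidean_space vector_field \<Rightarrow> 'a two_tensor \<Rightarrow> 'a two_tensor" where
  "lie_derivative_tensor X g p u v =
     frechet_derivative (\<lambda>q. g q u v) (at p) (X p)
     + g p (frechet_derivative X (at p) u) v + g p u (frechet_derivative X (at p) v)"

definition sym_prod :: "('a \<Rightarrow> real) \<Rightarrow> ('a \<Rightarrow> real) \<Rightarrow> 'a \<Rightarrow> 'a \<Rightarrow> real" where
  "sym_prod \<alpha> \<beta> u v = (\<alpha> u * \<beta> v + \<alpha> v * \<beta> u) / 2"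

definition infinitesimal_symmetries ::
  "'a::euclidean_space one_form \<Rightarrow> 'a two_tensor \<Rightarrow> 'a vector_field set" where
  "infinitesimal_symmetries \<omega> g = {X. smooth X \<and>
     (\<exists>f. smooth f \<and> (\<forall>p v. lie_derivative_form X \<omega> p v = f p * \<omega> p v)) \<and>
     (\<exists>h \<mu>. smooth h \<and> smooth_one_form \<mu> \<and>
        (\<forall>p u v. lie_derivative_tensor X g p u v = h p * g p u v + sym_prod (\<mu> p) (\<omega> p) u v))}"


section \<open>Real Lie algebras\<close>

definition real_lie_algebra ::
  "'a::real_vector set \<Rightarrow> ('a \<Rightarrow> 'a \<Rightarrow> 'a) \<Rightarrow> bool" where
  "real_lie_algebra L br \<longleftrightarrow>
     subspace L \<and>
     (\<forall>x\<in>L. \<forall>y\<in>L. br x y \<in> L) \<and>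
     (\<forall>x\<in>L. \<forall>y\<in>L. \<forall>z\<in>L. \<forall>r s.
        br (r *\<^sub>R x + s *\<^sub>R y) z = r *\<^sub>R br x z + s *\<^sub>R br y z \<and>
        br z (r *\<^sub>R x + s *\<^sub>R y) = r *\<^sub>R br z x + s *\<^sub>R br z y) \<and>
     (\<forall>x\<in>L. br x x = 0) \<and>
     (\<forall>x\<in>L. \<forall>y\<in>L. \<forall>z\<in>L. br x (br y z) + br y (br z x) + br z (br x y) = 0)"

definition isomorphic_lie_algebras ::
  "'a::real_vector set \<Rightarrow> ('a \<Rightarrow> 'a \<Rightarrow> 'a) \<Rightarrow> 'b::real_vector set \<Rightarrow> ('b \<Rightarrow> 'b \<Rightarrow> 'b) \<Rightarrow> bool" where
  "isomorphic_lie_algebras L br M br' \<longleftrightarrow>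
     real_lie_algebra L br \<and> real_lie_algebra M br' \<and>
     (\<exists>\<phi>. bij_betw \<phi> L M \<and>
        (\<forall>x\<in>L. \<forall>y\<in>L. \<forall>r s. \<phi> (r *\<^sub>R x + s *\<^sub>R y) = r *\<^sub>R \<phi> x + s *\<^sub>R \<phi> y) \<and>
        (\<forall>x\<in>L. \<forall>y\<in>L. \<phi> (br x y) = br' (\<phi> x) (\<phi> y)))"

definition conj_transpose :: "complex^'n^'m \<Rightarrow> complex^'m^'n" where
  "conj_transpose A = (\<chi> i j. cnj (A $ j $ i))"

definition commutator :: "complex^'n^'n \<Rightarrow> complex^'n^'n \<Rightarrow> complex^'n^'n" where
  "commutator A B = A ** B - B ** A"

definition I22 :: "complex^4^4" where
  "I22 = (\<chi> i j. if i = j then (if i = 1 \<or> i = 2 then 1 else - 1) else 0)"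

definition su22 :: "(complex^4^4) set" where
  "su22 = {A. conj_transpose A ** I22 + I22 ** A = 0 \<and> trace A = 0}"


section \<open>The flying saucer structure\<close>

text \<open>A point of the configuration space is \<open>p = (x, y, z, a, b)\<close>, that is
  \<open>x = p $ 1\<close>, \<dots>, \<open>b = p $ 5\<close>.\<close>

definition dx :: "real^5 \<Rightarrow> real" where "dx v = v $ 1"
definition dy :: "real^5 \<Rightarrow> real" where "dy v = v $ 2"
definition dz :: "real^5 \<Rightarrow> real" where "dz v = v $ 3"
definition da :: "real^5 \<Rightarrow> real" where "da v = v $ 4"
definition db :: "real^5 \<Rightarrow> real" where "db v = v $ 5"

definition ddx :: "real^5" where "ddx = axis 1 1"
definition ddy :: "real^5" where "ddy = axis 2 1"
definition ddz :: "real^5" where "ddz = axis 3 1"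
definition dda :: "real^5" where "dda = axis 4 1"
definition ddb :: "real^5" where "ddb = axis 5 1"

definition omega0 :: "(real^5) one_form" where
  "omega0 p v = (let a = p $ 4; b = p $ 5 in dz v - a * dx v - b * dy v)"

definition g0 :: "(real^5) two_tensor" where
  "g0 p u v = (let a = p $ 4; b = p $ 5 in
     sym_prod (\<lambda>w. (1 + a\<^sup>2) * db w - a * b * da w) dx u v
     - sym_prod (\<lambda>w. (1 + b\<^sup>2) * da w - a * b * db w) dy u v)"

definition in_coords ::
  "(real \<Rightarrow> real \<Rightarrow> real \<Rightarrow> real \<Rightarrow> real \<Rightarrow> real^5) \<Rightarrow> (real^5) vector_field" where
  "in_coords F p = F (p $ 1) (p $ 2) (p $ 3) (p $ 4) (p $ 5)"

definition X1 :: "(real^5) vector_field" where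
  "X1 = in_coords (\<lambda>x y z a b.
     - z *\<^sub>R (x *\<^sub>R ddx + y *\<^sub>R ddy) + ((x\<^sup>2 + y\<^sup>2 - z\<^sup>2) / 2) *\<^sub>R ddz
     + ((1 + a\<^sup>2) * x + a * b * y) *\<^sub>R dda + ((1 + b\<^sup>2) * y + a * b * x) *\<^sub>R ddb)"

definition X2 :: "(real^5) vector_field" where
  "X2 = in_coords (\<lambda>x y z a b.
     ((y\<^sup>2 + z\<^sup>2 - x\<^sup>2) / 2) *\<^sub>R ddx - x *\<^sub>R (y *\<^sub>R ddy + z *\<^sub>R ddz)
     - ((1 + a\<^sup>2) * z - b * y) *\<^sub>R dda - (a * (b * z + y)) *\<^sub>R ddb)"

definition X3 :: "(real^5) vector_field" where
  "X3 = in_coords (\<lambda>x y z a b.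
     y *\<^sub>R (x *\<^sub>R ddx + z *\<^sub>R ddz) + ((y\<^sup>2 - x\<^sup>2 - z\<^sup>2) / 2) *\<^sub>R ddy
     + (b * (a * z + x)) *\<^sub>R dda + ((1 + b\<^sup>2) * z - a * x) *\<^sub>R ddb)"

definition X4 :: "(real^5) vector_field" where
  "X4 = in_coords (\<lambda>x y z a b.
     (1 / 2 * ((x\<^sup>2 + y\<^sup>2 + z\<^sup>2) / sqrt (a\<^sup>2 + b\<^sup>2 + 1))) *\<^sub>R (ddz - a *\<^sub>R ddx - b *\<^sub>R ddy)
     + sqrt (a\<^sup>2 + b\<^sup>2 + 1) *\<^sub>R ((a * z + x) *\<^sub>R dda + (b * z + y) *\<^sub>R ddb))"

definition X5 :: "(real^5) vector_field" where
  "X5 = in_coords (\<lambda>x y z a b.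
     - z *\<^sub>R ddx + x *\<^sub>R ddz + (a\<^sup>2 + 1) *\<^sub>R dda + (a * b) *\<^sub>R ddb)"

definition X6 :: "(real^5) vector_field" where
  "X6 = in_coords (\<lambda>x y z a b.
     - z *\<^sub>R ddy + y *\<^sub>R ddz + (a * b) *\<^sub>R dda + (b\<^sup>2 + 1) *\<^sub>R ddb)"

definition X7 :: "(real^5) vector_field" where
  "X7 = in_coords (\<lambda>x y z a b. y *\<^sub>R ddx - x *\<^sub>R ddy + b *\<^sub>R dda - a *\<^sub>R ddb)"

definition X8 :: "(real^5) vector_field" where
  "X8 = in_coords (\<lambda>x y z a b.
     (x / sqrt (a\<^sup>2 + b\<^sup>2 + 1)) *\<^sub>R (ddz - a *\<^sub>R ddx - b *\<^sub>R ddy)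
     + sqrt (a\<^sup>2 + b\<^sup>2 + 1) *\<^sub>R dda)"

definition X9 :: "(real^5) vector_field" where
  "X9 = in_coords (\<lambda>x y z a b.
     (z / sqrt (a\<^sup>2 + b\<^sup>2 + 1)) *\<^sub>R (ddz - a *\<^sub>R ddx - b *\<^sub>R ddy)
     + sqrt (a\<^sup>2 + b\<^sup>2 + 1) *\<^sub>R (a *\<^sub>R dda + b *\<^sub>R ddb))"

definition X10 :: "(real^5) vector_field" where
  "X10 = in_coords (\<lambda>x y z a b.
     (y / sqrt (a\<^sup>2 + b\<^sup>2 + 1)) *\<^sub>R (ddz - a *\<^sub>R ddx - b *\<^sub>R ddy)
     + sqrt (a\<^sup>2 + b\<^sup>2 + 1) *\<^sub>R ddb)"

definition X11 :: "(real^5) vector_field" where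
  "X11 = in_coords (\<lambda>x y z a b.
     (1 / sqrt (a\<^sup>2 + b\<^sup>2 + 1)) *\<^sub>R (ddz - a *\<^sub>R ddx - b *\<^sub>R ddy))"

definition X12 :: "(real^5) vector_field" where
  "X12 = in_coords (\<lambda>x y z a b. x *\<^sub>R ddx + y *\<^sub>R ddy + z *\<^sub>R ddz)"

definition X13 :: "(real^5) vector_field" where
  "X13 = in_coords (\<lambda>x y z a b. ddx)"

definition X14 :: "(real^5) vector_field" where
  "X14 = in_coords (\<lambda>x y z a b. ddy)"

definition X15 :: "(real^5) vector_field" where
  "X15 = in_coords (\<lambda>x y z a b. ddz)"

end

theory Submission
  imports Defs
begin

text \<open>
  A vector field preserves the contact structure iff it is the contact field of a function
  \<open>F = \<omega>\<^sup>0(X)\<close>. The components of \<open>L\<^sub>X g = q g\<close> along \<open>\<partial>\<^sub>a\<close>, \<open>\<partial>\<^sub>b\<close> say that the Hessian of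
  \<open>F\<close> in \<open>(a, b)\<close> is a multiple of that of \<open>r = sqrt (a\<^sup>2 + b\<^sup>2 + 1)\<close>, whence
  \<open>F = A + a B + b C + r E\<close> with \<open>A\<close>, \<open>B\<close>, \<open>C\<close>, \<open>E\<close> depending on \<open>x\<close>, \<open>y\<close>, \<open>z\<close> only. The
  remaining components say that \<open>(- B, - C, A)\<close> is a conformal Killing field of Euclidean 3-space
  and that the Hessian of \<open>E\<close> is a multiple of the identity, which leaves a 10-dimensional and a
  5-dimensional space of quadratic polynomials.

  The configuration space embeds as an open part of the null quadric of a Hermitian form of signature
  (2,2) in complex projective 3-space, and each symmetry is induced by a linear vector field of
  \<open>su22\<close>. As the embedding is an immersion, a symmetry is determined by its matrix; closure under
  brackets and the Jacobi identity are therefore inherited from \<open>su22\<close>, and no bracket of two of the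
  fifteen fields has to be computed.
\<close>

section \<open>Smooth maps\<close>

text \<open>A point is a contact element of 3-space: a base point with the covector (-a, -b, 1),
  whose Euclidean length is r. A contact Hamiltonian F extends to a function homogeneous of degree
  one in this covector. Its part A + a B + b C is linear there and lifts the vector field (-B, -C,
  A) of 3-space, while r E displaces elements along their unit normal, \<open>X11\<close> being the
  case E = 1. The linear parts make up the conformal algebra so(4,1); with the second kind they form
  the algebra so(4,2) of Lie sphere geometry, which is isomorphic to su(2,2). Two obstacles shape
  the comparison with matrices. The square root r keeps the fields from being polynomial;
  stereographic coordinates of the normal remove it. And a matrix acts only on a projective class,
  so its linear field must be read in an affine chart, at the price of a quadratic correction; what
  this correction adds to iterated derivatives is symmetric in the two matrices and cancels in
  brackets.\<close>

lemma continuously_differentiable_Suc_imp: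
  "continuously_differentiable (Suc k) f \<Longrightarrow> continuously_differentiable k f"
proof (induction k arbitrary: f)
  case 0
  then show ?case by (simp add: differentiable_imp_continuous_on)
next
  case (Suc k)
  then show ?case by (metis continuously_differentiable.simps(2))
qed

lemma continuously_differentiable_imp_has_derivative:
  assumes "continuously_differentiable (Suc k) f"
  shows "(f has_derivative frechet_derivative f (at p)) (at p)"
  using assms frechet_derivative_works by (auto simp: differentiable_on_def)

lemma continuously_differentiable_SucI:
  assumes "\<And>p. (f has_derivative f' p) (at p)"
    and "\<And>v. continuously_differentiable k (\<lambda>p. f' p v)"
  shows "continuously_differentiable (Suc k) f"
proof -
  have "frechet_derivative f (at p) = f' p" for p
    using frechet_derivative_at[OF assms(1)] by simp
  moreover have "f differentiable_on UNIV"
    using assms(1) by (auto simp: differentiable_on_def differentiable_def)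
  ultimately show ?thesis using assms(2) by simp
qed

lemma continuously_differentiable_const: "continuously_differentiable k (\<lambda>p. c)"
  by (induction k arbitrary: c) (simp_all add: frechet_derivative_const)

lemma continuously_differentiable_add:
  "continuously_differentiable k f \<Longrightarrow> continuously_differentiable k g \<Longrightarrow>
    continuously_differentiable k (\<lambda>p. f p + g p)"
proof (induction k arbitrary: f g)
  case 0
  then show ?case by (simp add: continuous_on_add)
next
  case (Suc k)
  show ?case
    by (rule continuously_differentiable_SucI[OF has_derivative_add[OF
        Suc.prems[THEN continuously_differentiable_imp_has_derivative]]])
      (use Suc in simp)
qed

lemma continuously_differentiable_linear:
  assumes "bounded_linear h"
  shows "continuously_differentiable k f \<Longrightarrow> continuously_differentiable k (\<lambda>p. h (f p))"
proof (induction k arbitrary: f)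
  case 0
  then show ?case by (simp add: assms bounded_linear.continuous_on)
next
  case (Suc k)
  show ?case
    by (rule continuously_differentiable_SucI[OF bounded_linear.has_derivative[OF assms
        Suc.prems[THEN continuously_differentiable_imp_has_derivative]]])
      (use Suc in simp)
qed

lemma continuously_differentiable_bilinear:
  assumes "bounded_bilinear h"
  shows "continuously_differentiable k f \<Longrightarrow> continuously_differentiable k g \<Longrightarrow>
    continuously_differentiable k (\<lambda>p. h (f p) (g p))"
proof (induction k arbitrary: f g)
  case 0
  then show ?case by (simp add: assms bounded_bilinear.continuous_on)
next
  case (Suc k)
  have "continuously_differentiable k (\<lambda>p. frechet_derivative f (at p) v)"
    "continuously_differentiable k (\<lambda>p. frechet_derivative g (at p) v)" for v
    using Suc.prems by simp_all
  then have "continuously_differentiable k (\<lambda>p. h (f p) (frechet_derivative g (at p) v)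
      + h (frechet_derivative f (at p) v) (g p))" for v
    using Suc.prems[THEN continuously_differentiable_Suc_imp]
    by (intro continuously_differentiable_add Suc.IH)
  then show ?case
    by (rule continuously_differentiable_SucI[OF bounded_bilinear.FDERIV[OF assms
        Suc.prems[THEN continuously_differentiable_imp_has_derivative]]])
qed

text \<open>The derivative of \<open>1/f\<close> contains \<open>1/f\<close> again, so the step
  needs the induction hypothesis for the same \<open>f\<close> one order lower, not for its
  derivative. The square root is treated alike.\<close>

lemma continuously_differentiable_inverse:
  fixes f :: "'a::euclidean_space \<Rightarrow> 'b::real_normed_field"
  assumes "\<And>p. f p \<noteq> 0"
  shows "continuously_differentiable k f \<Longrightarrow> continuously_differentiable k (\<lambda>p. inverse (f p))"
proof (induction k)
  case 0
  then show ?case by (simp add: assms continuous_on_inverse)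
next
  case (Suc k)
  have "continuously_differentiable k (\<lambda>p. inverse (f p))"
    using Suc continuously_differentiable_Suc_imp by blast
  then have "continuously_differentiable k
      (\<lambda>p. (- 1) * (inverse (f p) * frechet_derivative f (at p) v * inverse (f p)))" for v
    using Suc.prems
    by (intro continuously_differentiable_bilinear[OF bounded_bilinear_mult]
        continuously_differentiable_const) auto
  then show ?case
    by (intro continuously_differentiable_SucI[OF Deriv.has_derivative_inverse[OF assms
        Suc.prems[THEN continuously_differentiable_imp_has_derivative]]]) simp
qed

lemma continuously_differentiable_sqrt:
  fixes f :: "'a::euclidean_space \<Rightarrow> real"
  assumes "\<And>p. f p > 0"
  shows "continuously_differentiable k f \<Longrightarrow> continuously_differentiable k (\<lambda>p. sqrt (f p))"
proof (induction k)
  case 0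
  then show ?case by (simp add: continuous_on_real_sqrt)
next
  case (Suc k)
  have "continuously_differentiable k (\<lambda>p. sqrt (f p))"
    using Suc continuously_differentiable_Suc_imp by blast
  then have "continuously_differentiable k
      (\<lambda>p. frechet_derivative f (at p) v * ((1 / 2) * inverse (sqrt (f p))))" for v
    using Suc.prems
    by (intro continuously_differentiable_bilinear[OF bounded_bilinear_mult]
        continuously_differentiable_inverse continuously_differentiable_const)
      (auto simp: assms less_imp_neq[symmetric])
  then show ?case
    by (intro continuously_differentiable_SucI[OF has_derivative_real_sqrt[OF assms
        Suc.prems[THEN continuously_differentiable_imp_has_derivative]]])
      (simp add: field_simps)
qed

lemma continuously_differentiable_ident: "continuously_differentiable k (\<lambda>p. p)"
  by (cases k) (auto simp: continuously_differentiable_const differentiable_on_def)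

named_theorems smooth_intros

lemma smooth_const [smooth_intros]: "smooth (\<lambda>p. c)"
  by (simp add: smooth_def continuously_differentiable_const)

lemma smooth_ident: "smooth (\<lambda>p. p)"
  by (simp add: smooth_def continuously_differentiable_ident)

lemma smooth_add [smooth_intros]: "smooth f \<Longrightarrow> smooth g \<Longrightarrow> smooth (\<lambda>p. f p + g p)"
  by (simp add: smooth_def continuously_differentiable_add)

lemma smooth_linear: "bounded_linear h \<Longrightarrow> smooth f \<Longrightarrow> smooth (\<lambda>p. h (f p))"
  by (simp add: smooth_def continuously_differentiable_linear)

lemma smooth_minus [smooth_intros]: "smooth f \<Longrightarrow> smooth (\<lambda>p. - f p)"
  by (rule smooth_linear[OF bounded_linear_minus[OF bounded_linear_ident]])

lemma smooth_diff [smooth_intros]: "smooth f \<Longrightarrow> smooth g \<Longrightarrow> smooth (\<lambda>p. f p - g p)"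
  using smooth_add[of f "\<lambda>p. - g p"] smooth_minus[of g] by simp

lemma smooth_nth [smooth_intros]:
  fixes f :: "'a::euclidean_space \<Rightarrow> ('b::real_normed_vector)^'n"
  shows "smooth f \<Longrightarrow> smooth (\<lambda>p. f p $ i)"
  by (rule smooth_linear[OF bounded_linear_vec_nth])

lemma smooth_coordinate [smooth_intros]: "smooth (\<lambda>p::real^'n. p $ i)"
  by (rule smooth_nth[OF smooth_ident])

lemma smooth_mult [smooth_intros]:
  fixes f :: "'a::euclidean_space \<Rightarrow> 'b::real_normed_algebra"
  shows "smooth f \<Longrightarrow> smooth g \<Longrightarrow> smooth (\<lambda>p. f p * g p)"
  by (simp add: smooth_def continuously_differentiable_bilinear[OF bounded_bilinear_mult])

lemma smooth_scaleR [smooth_intros]: "smooth f \<Longrightarrow> smooth g \<Longrightarrow> smooth (\<lambda>p. f p *\<^sub>R g p)"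
  by (simp add: smooth_def continuously_differentiable_bilinear[OF bounded_bilinear_scaleR])

lemma smooth_power [smooth_intros]:
  fixes f :: "'a::euclidean_space \<Rightarrow> 'b::real_normed_algebra_1"
  shows "smooth f \<Longrightarrow> smooth (\<lambda>p. f p ^ n)"
  by (induction n) (auto intro: smooth_intros)

lemma smooth_inverse [smooth_intros]:
  fixes f :: "'a::euclidean_space \<Rightarrow> 'b::real_normed_field"
  shows "smooth f \<Longrightarrow> (\<And>p. f p \<noteq> 0) \<Longrightarrow> smooth (\<lambda>p. inverse (f p))"
  by (simp add: smooth_def continuously_differentiable_inverse)

lemma smooth_divide [smooth_intros]:
  fixes f :: "'a::euclidean_space \<Rightarrow> 'b::real_normed_field"
  shows "smooth f \<Longrightarrow> smooth g \<Longrightarrow> (\<And>p. g p \<noteq> 0) \<Longrightarrow> smooth (\<lambda>p. f p / g p)"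
  by (simp add: divide_inverse smooth_mult smooth_inverse)

lemma smooth_sqrt [smooth_intros]: "smooth f \<Longrightarrow> (\<And>p. f p > 0) \<Longrightarrow> smooth (\<lambda>p. sqrt (f p))"
  by (simp add: smooth_def continuously_differentiable_sqrt)

lemma smooth_of_real [smooth_intros]:
  fixes f :: "'a::euclidean_space \<Rightarrow> real"
  shows "smooth f \<Longrightarrow> smooth (\<lambda>p. of_real (f p) :: 'b::real_normed_algebra_1)"
  by (rule smooth_linear[OF bounded_linear_of_real])

lemma smooth_sum [smooth_intros]:
  "(\<And>i. i \<in> I \<Longrightarrow> smooth (f i)) \<Longrightarrow> smooth (\<lambda>p. \<Sum>i\<in>I. f i p)"
  by (induction I rule: infinite_finite_induct) (auto intro: smooth_intros)

lemma smooth_vec_lambda [smooth_intros]: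
  fixes f :: "'n::finite \<Rightarrow> 'a::euclidean_space \<Rightarrow> 'b::euclidean_space"
  assumes "\<And>i. smooth (f i)"
  shows "smooth (\<lambda>p. \<chi> i. f i p)"
proof -
  have "linear (axis i :: 'b \<Rightarrow> 'b^'n)" for i
    by (rule linearI) (simp_all add: vec_eq_iff axis_def)
  then have "bounded_linear (axis i :: 'b \<Rightarrow> 'b^'n)" for i
    by (simp add: linear_conv_bounded_linear)
  then have "smooth (\<lambda>p. axis i (f i p) :: 'b^'n)" for i
    using assms by (rule smooth_linear)
  then have "smooth (\<lambda>p. \<Sum>i\<in>UNIV. axis i (f i p))"
    by (rule smooth_sum)
  moreover have "(\<chi> i. f i p) = (\<Sum>i\<in>UNIV. axis i (f i p))" for p
    by (simp add: vec_eq_iff axis_def sum.delta cong: if_cong)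
  ultimately show ?thesis by simp
qed

section \<open>Directional derivatives\<close>

text \<open>The point comes last, so that \<open>dir_deriv v f\<close> is again a map and
  derivatives can be iterated.\<close>

definition dir_deriv ::
  "'a::euclidean_space \<Rightarrow> ('a \<Rightarrow> 'b::real_normed_vector) \<Rightarrow> 'a \<Rightarrow> 'b" where
  "dir_deriv v f p = frechet_derivative f (at p) v"

lemma smooth_has_derivative:
  "smooth f \<Longrightarrow> (f has_derivative (\<lambda>v. dir_deriv v f p)) (at p)"
  unfolding dir_deriv_def smooth_def
  using continuously_differentiable_imp_has_derivative by blast

lemma dir_deriv_eqI: "(f has_derivative f') (at p) \<Longrightarrow> dir_deriv v f p = f' v"
  unfolding dir_deriv_def using frechet_derivative_at by metis

lemma smooth_dir_deriv [smooth_intros]: "smooth f \<Longrightarrow> smooth (dir_deriv v f)"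
  unfolding dir_deriv_def[abs_def] smooth_def
  using continuously_differentiable.simps(2)[of _ f] by metis

lemma dir_deriv_add: "smooth f \<Longrightarrow> smooth g \<Longrightarrow>
    dir_deriv v (\<lambda>p. f p + g p) p = dir_deriv v f p + dir_deriv v g p"
  using dir_deriv_eqI[OF has_derivative_add[OF smooth_has_derivative smooth_has_derivative]] .

lemma dir_deriv_diff: "smooth f \<Longrightarrow> smooth g \<Longrightarrow>
    dir_deriv v (\<lambda>p. f p - g p) p = dir_deriv v f p - dir_deriv v g p"
  using dir_deriv_eqI[OF has_derivative_diff[OF smooth_has_derivative smooth_has_derivative]] .

lemma dir_deriv_minus: "smooth f \<Longrightarrow> dir_deriv v (\<lambda>p. - f p) p = - dir_deriv v f p"
  using dir_deriv_eqI[OF has_derivative_minus[OF smooth_has_derivative]] .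

lemma dir_deriv_const: "dir_deriv v (\<lambda>p. c) p = 0"
  by (simp add: dir_deriv_def)

lemma dir_deriv_mult:
  fixes f :: "'a::euclidean_space \<Rightarrow> 'b::real_normed_algebra"
  shows "smooth f \<Longrightarrow> smooth g \<Longrightarrow>
    dir_deriv v (\<lambda>p. f p * g p) p = f p * dir_deriv v g p + dir_deriv v f p * g p"
  using dir_deriv_eqI[OF has_derivative_mult[OF smooth_has_derivative smooth_has_derivative]] .

lemma dir_deriv_scaleR: "smooth f \<Longrightarrow> smooth g \<Longrightarrow>
    dir_deriv v (\<lambda>p. f p *\<^sub>R g p) p = f p *\<^sub>R dir_deriv v g p + dir_deriv v f p *\<^sub>R g p"
  using dir_deriv_eqI[OF has_derivative_scaleR[OF smooth_has_derivative smooth_has_derivative]] .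

lemma dir_deriv_linear:
  "bounded_linear h \<Longrightarrow> smooth f \<Longrightarrow> dir_deriv v (\<lambda>p. h (f p)) p = h (dir_deriv v f p)"
  using dir_deriv_eqI[OF bounded_linear.has_derivative[OF _ smooth_has_derivative]] .

lemma dir_deriv_nth:
  fixes f :: "'a::euclidean_space \<Rightarrow> ('b::real_normed_vector)^'n"
  shows "smooth f \<Longrightarrow> dir_deriv v (\<lambda>p. f p $ i) p = dir_deriv v f p $ i"
  by (rule dir_deriv_linear[OF bounded_linear_vec_nth])

lemma dir_deriv_coordinate: "dir_deriv v (\<lambda>p::real^'n. p $ i) p = v $ i"
  by (rule dir_deriv_eqI) (auto intro!: derivative_eq_intros
      bounded_linear_imp_has_derivative bounded_linear_vec_nth)

lemma linear_dir_deriv: "smooth f \<Longrightarrow> linear (\<lambda>v. dir_deriv v f p)"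
  using smooth_has_derivative has_derivative_linear by blast

section \<open>Derivatives along lines and symmetry of second derivatives\<close>

lemma DERIV_along_line:
  fixes k :: "'a::euclidean_space \<Rightarrow> real"
  assumes "smooth k"
  shows "((\<lambda>s. k (q + s *\<^sub>R w)) has_real_derivative dir_deriv w k (q + s *\<^sub>R w)) (at s)"
proof -
  have "((\<lambda>s. k (q + s *\<^sub>R w)) has_derivative
      (\<lambda>r. dir_deriv (r *\<^sub>R w) k (q + s *\<^sub>R w))) (at s)"
    by (rule has_derivative_compose[OF _ smooth_has_derivative[OF assms]])
      (auto intro!: derivative_eq_intros)
  moreover have "(\<lambda>r. dir_deriv (r *\<^sub>R w) k (q + s *\<^sub>R w)) = (*) (dir_deriv w k (q + s *\<^sub>R w))"
    using linear_scale[OF linear_dir_deriv[OF assms]] by (simp add: fun_eq_iff)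
  ultimately show ?thesis
    by (simp add: has_field_derivative_def)
qed

text \<open>The mean value theorem is applied twice, along \<open>u\<close> to a difference in
  direction \<open>v\<close> and then along \<open>v\<close>. The second difference on the left is
  symmetric in \<open>u\<close> and \<open>v\<close>, which together with continuity yields
  commuting derivatives.\<close>

lemma mixed_difference_eq:
  fixes f :: "'a::euclidean_space \<Rightarrow> real"
  assumes "smooth f" "h > 0"
  shows "\<exists>s t. 0 < s \<and> s < h \<and> 0 < t \<and> t < h \<and>
    f (p + h *\<^sub>R u + h *\<^sub>R v) - f (p + h *\<^sub>R u) - f (p + h *\<^sub>R v) + f p
      = h * (h * dir_deriv v (dir_deriv u f) (p + s *\<^sub>R u + t *\<^sub>R v))"
proof -
  define k where "k s = f (p + h *\<^sub>R v + s *\<^sub>R u) - f (p + s *\<^sub>R u)" for s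
  have "\<exists>s. 0 < s \<and> s < h \<and> k h - k 0
      = (h - 0) * (dir_deriv u f (p + h *\<^sub>R v + s *\<^sub>R u) - dir_deriv u f (p + s *\<^sub>R u))"
    unfolding k_def by (rule MVT2[OF assms(2)]) (intro DERIV_diff DERIV_along_line assms(1))
  then obtain s where s: "0 < s" "s < h" and ks: "k h - k 0
      = h * (dir_deriv u f (p + s *\<^sub>R u + h *\<^sub>R v) - dir_deriv u f (p + s *\<^sub>R u + 0 *\<^sub>R v))"
    by (auto simp: add_ac)
  have "\<exists>t. 0 < t \<and> t < h \<and>
      dir_deriv u f (p + s *\<^sub>R u + h *\<^sub>R v) - dir_deriv u f (p + s *\<^sub>R u + 0 *\<^sub>R v)
      = (h - 0) * dir_deriv v (dir_deriv u f) (p + s *\<^sub>R u + t *\<^sub>R v)"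
    by (rule MVT2[OF assms(2)]) (intro DERIV_along_line smooth_dir_deriv assms(1))
  then obtain t where "0 < t" "t < h"
    "k h - k 0 = h * (h * dir_deriv v (dir_deriv u f) (p + s *\<^sub>R u + t *\<^sub>R v))"
    using ks by auto
  moreover have "k h - k 0
      = f (p + h *\<^sub>R u + h *\<^sub>R v) - f (p + h *\<^sub>R u) - f (p + h *\<^sub>R v) + f p"
    by (simp add: k_def add_ac)
  ultimately show ?thesis using s by metis
qed

lemma dir_deriv_commute_real:
  fixes f :: "'a::euclidean_space \<Rightarrow> real"
  assumes f: "smooth f"
  shows "dir_deriv u (dir_deriv v f) p = dir_deriv v (dir_deriv u f) p"
proof (rule ccontr)
  let ?A = "dir_deriv v (dir_deriv u f)" and ?B = "dir_deriv u (dir_deriv v f)"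
  assume "?B p \<noteq> ?A p"
  \<comment> \<open>Half the gap: both second derivatives stay within \<open>e\<close> of their
    values at \<open>p\<close>, yet take a common value at two nearby points.\<close>
  define e where "e = \<bar>?A p - ?B p\<bar> / 2"
  have e: "e > 0" using \<open>?B p \<noteq> ?A p\<close> by (simp add: e_def)
  have c: "isCont ?A p" "isCont ?B p"
    by (auto intro!: has_derivative_continuous smooth_has_derivative smooth_dir_deriv f)
  obtain d1 where d1: "d1 > 0" "\<And>q. dist q p < d1 \<Longrightarrow> \<bar>?A q - ?A p\<bar> < e"
    using c(1) e unfolding continuous_at_eps_delta dist_real_def by blast
  obtain d2 where d2: "d2 > 0" "\<And>q. dist q p < d2 \<Longrightarrow> \<bar>?B q - ?B p\<bar> < e"
    using c(2) e unfolding continuous_at_eps_delta dist_real_def by blast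
  \<comment> \<open>Keeps the whole parallelogram spanned by \<open>h *\<^sub>R u\<close> and
    \<open>h *\<^sub>R v\<close> within both radii; the summand 1 prevents division by zero.\<close>
  define h where "h = min d1 d2 / (norm u + norm v + 1)"
  have h: "h > 0" using d1 d2 by (auto simp: h_def add_nonneg_pos)
  have near: "dist (p + s *\<^sub>R u + t *\<^sub>R v) p < min d1 d2"
    if "0 < s" "s < h" "0 < t" "t < h" for s t
  proof -
    have "dist (p + s *\<^sub>R u + t *\<^sub>R v) p \<le> s * norm u + t * norm v"
      using norm_triangle_ineq[of "s *\<^sub>R u" "t *\<^sub>R v"] that by (simp add: dist_norm add.assoc)
    also have "\<dots> \<le> h * norm u + h * norm v"
      using that by (intro add_mono mult_right_mono) auto
    also have "\<dots> < h * (norm u + norm v + 1)" using h by (simp add: algebra_simps)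
    also have "\<dots> = min d1 d2"
      unfolding h_def using add_nonneg_pos[of "norm u + norm v" 1] by simp
    finally show ?thesis .
  qed
  obtain s t where st: "0 < s" "s < h" "0 < t" "t < h"
    "f (p + h *\<^sub>R u + h *\<^sub>R v) - f (p + h *\<^sub>R u) - f (p + h *\<^sub>R v) + f p
      = h * (h * ?A (p + s *\<^sub>R u + t *\<^sub>R v))"
    using mixed_difference_eq[OF f h] by metis
  obtain s' t' where st': "0 < s'" "s' < h" "0 < t'" "t' < h"
    "f (p + h *\<^sub>R v + h *\<^sub>R u) - f (p + h *\<^sub>R v) - f (p + h *\<^sub>R u) + f p
      = h * (h * ?B (p + s' *\<^sub>R v + t' *\<^sub>R u))"
    using mixed_difference_eq[OF f h] by metis
  have "f (p + h *\<^sub>R v + h *\<^sub>R u) = f (p + h *\<^sub>R u + h *\<^sub>R v)"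
    by (simp add: add_ac)
  then have "h * (h * ?A (p + s *\<^sub>R u + t *\<^sub>R v)) = h * (h * ?B (p + s' *\<^sub>R v + t' *\<^sub>R u))"
    using st(5) st'(5) by linarith
  then have "?A (p + s *\<^sub>R u + t *\<^sub>R v) = ?B (p + t' *\<^sub>R u + s' *\<^sub>R v)"
    using h by (simp add: add_ac)
  then show False
    using d1(2)[of "p + s *\<^sub>R u + t *\<^sub>R v"] d2(2)[of "p + t' *\<^sub>R u + s' *\<^sub>R v"]
      near[OF st(1-4)] near[OF st'(3,4,1,2)] unfolding e_def by (auto simp: abs_if split: if_splits)
qed

lemma dir_deriv_commute:
  fixes f :: "'a::euclidean_space \<Rightarrow> 'b::euclidean_space"
  assumes f: "smooth f"
  shows "dir_deriv u (dir_deriv v f) p = dir_deriv v (dir_deriv u f) p"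
proof (rule euclidean_eqI)
  fix b :: 'b
  have L: "bounded_linear (\<lambda>x::'b. x \<bullet> b)" by (rule bounded_linear_inner_left)
  have "dir_deriv v (dir_deriv u f) p \<bullet> b = dir_deriv v (dir_deriv u (\<lambda>p. f p \<bullet> b)) p" for u v
    using dir_deriv_linear[OF L smooth_dir_deriv[OF f], of v u p]
      ext[of "dir_deriv u (\<lambda>p. f p \<bullet> b)", OF dir_deriv_linear[OF L f, of u]]
    by simp
  then show "dir_deriv u (dir_deriv v f) p \<bullet> b = dir_deriv v (dir_deriv u f) p \<bullet> b"
    using dir_deriv_commute_real[OF smooth_linear[OF L f], of u v p] by simp
qed

lemma eq_const_if_dir_deriv_zero:
  assumes "smooth f" "\<And>v p. dir_deriv v f p = 0"
  shows "f p = f q"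
  using has_derivative_zero_constant[OF convex_UNIV, of f] smooth_has_derivative[OF assms(1)] assms(2)
  by auto

section \<open>Contact fields and the symmetry equations\<close>

lemma exhaust_5:
  fixes x :: 5
  shows "x = 1 \<or> x = 2 \<or> x = 3 \<or> x = 4 \<or> x = 5"
proof (induct x)
  case (of_int z)
  then have "z = 0 \<or> z = 1 \<or> z = 2 \<or> z = 3 \<or> z = 4" by simp arith
  then show ?case by auto
qed

lemma UNIV_5: "(UNIV :: 5 set) = {1, 2, 3, 4, 5}"
  using exhaust_5 by auto

lemma forall_5: "(\<forall>i::5. P i) \<longleftrightarrow> P 1 \<and> P 2 \<and> P 3 \<and> P 4 \<and> P 5"
proof -
  have "(\<forall>i. P i) \<longleftrightarrow> (\<forall>i\<in>UNIV. P i)" by simp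
  then show ?thesis unfolding UNIV_5 by simp
qed

lemma sum_5: "sum f (UNIV :: 5 set) = f 1 + f 2 + f 3 + f 4 + f 5"
  unfolding UNIV_5 by (simp add: ac_simps)

abbreviation pd :: "'n::finite \<Rightarrow> (real^'n \<Rightarrow> 'b::real_normed_vector) \<Rightarrow> real^'n \<Rightarrow> 'b" where
  "pd i \<equiv> dir_deriv (axis i 1)"

lemma nth_axis: "axis i x $ j = (if i = j then x else 0)"
  by (simp add: axis_def)

lemma dir_deriv_eq_sum:
  fixes f :: "real^'n \<Rightarrow> 'b::real_normed_vector"
  assumes "smooth f"
  shows "dir_deriv v f p = (\<Sum>i\<in>UNIV. v $ i *\<^sub>R pd i f p)"
proof -
  have "v = (\<Sum>i\<in>UNIV. v $ i *\<^sub>R axis i 1)"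
    by (simp add: vec_eq_iff axis_def if_distrib[of "(*) _"] sum.delta cong: if_cong)
  then have "dir_deriv v f p = dir_deriv (\<Sum>i\<in>UNIV. v $ i *\<^sub>R axis i 1) f p" by simp
  also have "\<dots> = (\<Sum>i\<in>UNIV. v $ i *\<^sub>R pd i f p)"
    by (simp add: linear_sum[OF linear_dir_deriv[OF assms]] linear_scale[OF linear_dir_deriv[OF assms]])
  finally show ?thesis .
qed

lemma eq_const_if_pd_zero:
  fixes f :: "real^'n \<Rightarrow> 'b::real_normed_vector"
  assumes "smooth f" "\<And>i p. pd i f p = 0"
  shows "f p = f q"
  by (rule eq_const_if_dir_deriv_zero[OF assms(1)]) (subst dir_deriv_eq_sum[OF assms(1)], simp add: assms(2))

lemma pd_coordinate: "pd i (\<lambda>p. p $ j) = (\<lambda>p::real^'n. if i = j then 1 else 0)"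
  by (auto simp: dir_deriv_coordinate axis_def)

lemma lie_derivative_form_eq:
  "lie_derivative_form X \<omega> p v = dir_deriv (X p) (\<lambda>q. \<omega> q v) p + \<omega> p (dir_deriv v X p)"
  by (simp add: lie_derivative_form_def dir_deriv_def)

lemma lie_derivative_tensor_eq:
  "lie_derivative_tensor X g p u v =
     dir_deriv (X p) (\<lambda>q. g q u v) p + g p (dir_deriv u X p) v + g p u (dir_deriv v X p)"
  by (simp add: lie_derivative_tensor_def dir_deriv_def)

lemma omega0_eq: "omega0 p v = v $ 3 - p $ 4 * v $ 1 - p $ 5 * v $ 2"
  by (simp add: omega0_def dx_def dy_def dz_def Let_def)

lemma g0_eq: "g0 p u v =
    (((1 + (p $ 4)\<^sup>2) * u $ 5 - p $ 4 * p $ 5 * u $ 4) * v $ 1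
     + ((1 + (p $ 4)\<^sup>2) * v $ 5 - p $ 4 * p $ 5 * v $ 4) * u $ 1
     - ((1 + (p $ 5)\<^sup>2) * u $ 4 - p $ 4 * p $ 5 * u $ 5) * v $ 2
     - ((1 + (p $ 5)\<^sup>2) * v $ 4 - p $ 4 * p $ 5 * v $ 5) * u $ 2) / 2"
  by (simp add: g0_def sym_prod_def dx_def dy_def da_def db_def Let_def field_simps)

text \<open>The contact Hamiltonian field of \<open>F\<close>: the contact field on which
  \<open>omega0\<close> takes the value \<open>F\<close>. The case \<open>F = 1\<close> is the Reeb
  field \<open>ddz\<close>.\<close>

definition contact_field :: "(real^5 \<Rightarrow> real) \<Rightarrow> (real^5) vector_field" where
  "contact_field F p = vector [- pd 4 F p, - pd 5 F p, F p - p $ 4 * pd 4 F p - p $ 5 * pd 5 F p,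
     pd 1 F p + p $ 4 * pd 3 F p, pd 2 F p + p $ 5 * pd 3 F p]"

lemma vector_5:
  "(vector [x1,x2,x3,x4,x5] :: 'a::zero^5) $ 1 = x1"
  "(vector [x1,x2,x3,x4,x5] :: 'a::zero^5) $ 2 = x2"
  "(vector [x1,x2,x3,x4,x5] :: 'a::zero^5) $ 3 = x3"
  "(vector [x1,x2,x3,x4,x5] :: 'a::zero^5) $ 4 = x4"
  "(vector [x1,x2,x3,x4,x5] :: 'a::zero^5) $ 5 = x5"
  unfolding vector_def by simp_all

lemma smooth_vec_iff:
  fixes f :: "'a::euclidean_space \<Rightarrow> ('b::euclidean_space)^'n"
  shows "smooth f \<longleftrightarrow> (\<forall>i. smooth (\<lambda>p. f p $ i))"
  using smooth_vec_lambda[of "\<lambda>i p. f p $ i"] smooth_nth[of f] by auto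

lemma smooth_contact_field: "smooth F \<Longrightarrow> smooth (contact_field F)"
  by (simp add: smooth_vec_iff forall_5 contact_field_def vector_5 smooth_intros)

text \<open>Cartan's formula: the first summand is the differential of \<open>omega0(X)\<close>, the
  rest is the contraction of \<open>X\<close> with the exterior derivative of
  \<open>omega0\<close>.\<close>

lemma lie_derivative_omega0:
  assumes X: "smooth X"
  shows "lie_derivative_form X omega0 p v = dir_deriv v (\<lambda>q. omega0 q (X q)) p
    + v $ 4 * X p $ 1 + v $ 5 * X p $ 2 - v $ 1 * X p $ 4 - v $ 2 * X p $ 5"
  using X by (simp add: lie_derivative_form_eq omega0_eq dir_deriv_diff dir_deriv_mult dir_deriv_const
      dir_deriv_coordinate dir_deriv_nth smooth_intros)

text \<open>In Cartan's formula the directions \<open>ddz\<close>, \<open>dda\<close>,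
  \<open>ddb\<close>, \<open>ddx\<close>, \<open>ddy\<close> give in turn \<open>f = pd 3 F\<close>
  and the components 1, 2, 4, 5 of \<open>X\<close>; the third component follows from
  \<open>F = omega0(X)\<close>.\<close>

lemma lie_derivative_omega0_iff:
  assumes X: "smooth X"
  shows "(\<exists>f. smooth f \<and> (\<forall>p v. lie_derivative_form X omega0 p v = f p * omega0 p v)) \<longleftrightarrow>
    (\<exists>F. smooth F \<and> X = contact_field F)"
proof safe
  fix f assume f: "\<forall>p v. lie_derivative_form X omega0 p v = f p * omega0 p v"
  define F where "F p = omega0 p (X p)" for p
  have F: "smooth F" using X by (auto simp: F_def[abs_def] omega0_eq intro!: smooth_intros)
  have L: "dir_deriv v F p + v $ 4 * X p $ 1 + v $ 5 * X p $ 2 - v $ 1 * X p $ 4 - v $ 2 * X p $ 5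
      = f p * omega0 p v" for p v
    using f lie_derivative_omega0[OF X] by (simp add: F_def[abs_def])
  have "X p $ i = contact_field F p $ i" for p i
  proof -
    have "X p $ 1 = - pd 4 F p" "X p $ 2 = - pd 5 F p" "pd 3 F p = f p"
      "X p $ 4 = pd 1 F p + p $ 4 * f p" "X p $ 5 = pd 2 F p + p $ 5 * f p"
      using L[of "axis 4 1" p] L[of "axis 5 1" p] L[of "axis 3 1" p] L[of "axis 1 1" p]
        L[of "axis 2 1" p] by (simp_all add: omega0_eq nth_axis algebra_simps)
    moreover have "F p = X p $ 3 - p $ 4 * X p $ 1 - p $ 5 * X p $ 2"
      by (simp add: F_def omega0_eq)
    ultimately show ?thesis
      using exhaust_5[of i] by (auto simp: contact_field_def vector_5)
  qed
  then have "X = contact_field F" by (simp add: fun_eq_iff vec_eq_iff)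
  with F show "\<exists>F. smooth F \<and> X = contact_field F" by blast
next
  fix F :: "real^5 \<Rightarrow> real"
  assume F: "smooth F"
  have "omega0 q (contact_field F q) = F q" for q
    by (simp add: omega0_eq contact_field_def vector_5)
  then have "lie_derivative_form (contact_field F) omega0 p v = pd 3 F p * omega0 p v" for p v
    by (simp add: lie_derivative_omega0[OF smooth_contact_field[OF F]] dir_deriv_eq_sum[OF F, of v] sum_5
        omega0_eq contact_field_def vector_5 algebra_simps)
  with F show "\<exists>f. smooth f \<and>
      (\<forall>p v. lie_derivative_form (contact_field F) omega0 p v = f p * omega0 p v)"
    by (blast intro: smooth_dir_deriv)
qed

lemma lie_derivative_g0:
  assumes X: "smooth X"
  shows "lie_derivative_tensor X g0 p u v =
    ((2 * p $ 4 * X p $ 4 * u $ 5 - (p $ 4 * X p $ 5 + p $ 5 * X p $ 4) * u $ 4) * v $ 1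
     + (2 * p $ 4 * X p $ 4 * v $ 5 - (p $ 4 * X p $ 5 + p $ 5 * X p $ 4) * v $ 4) * u $ 1
     - (2 * p $ 5 * X p $ 5 * u $ 4 - (p $ 4 * X p $ 5 + p $ 5 * X p $ 4) * u $ 5) * v $ 2
     - (2 * p $ 5 * X p $ 5 * v $ 4 - (p $ 4 * X p $ 5 + p $ 5 * X p $ 4) * v $ 5) * u $ 2) / 2
    + g0 p (dir_deriv u X p) v + g0 p u (dir_deriv v X p)"
proof -
  have [simp]: "dir_deriv w (\<lambda>q. c * h q) p = c * dir_deriv w h p"
    "dir_deriv w (\<lambda>q. h q * c) p = dir_deriv w h p * c"
    "dir_deriv w (\<lambda>q. h q / c) p = dir_deriv w h p / c"
    if "smooth h" for c :: real and w and h :: "real^5 \<Rightarrow> real"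
    using that dir_deriv_mult[OF that smooth_const] dir_deriv_mult[OF smooth_const that]
    by (simp_all add: dir_deriv_const divide_inverse)
  show ?thesis
    unfolding lie_derivative_tensor_eq
    by (subst (1) g0_eq[abs_def]) (simp add: power2_eq_square dir_deriv_add dir_deriv_diff dir_deriv_mult
      dir_deriv_const dir_deriv_coordinate smooth_intros algebra_simps)
qed

lemma g0_bilinear:
  "g0 p (u + u') v = g0 p u v + g0 p u' v" "g0 p (c *\<^sub>R u) v = c * g0 p u v"
  "g0 p u (v + v') = g0 p u v + g0 p u v'" "g0 p u (c *\<^sub>R v) = c * g0 p u v"
  by (simp_all add: g0_eq field_simps)

lemma g0_commute: "g0 p u v = g0 p v u"
  by (simp add: g0_eq algebra_simps)

lemma lie_derivative_g0_bilinear: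
  assumes X: "smooth X"
  shows "lie_derivative_tensor X g0 p (u + u') v
      = lie_derivative_tensor X g0 p u v + lie_derivative_tensor X g0 p u' v"
    and "lie_derivative_tensor X g0 p (c *\<^sub>R u) v = c * lie_derivative_tensor X g0 p u v"
  by (simp_all add: lie_derivative_g0[OF X] linear_add[OF linear_dir_deriv[OF X]]
      linear_scale[OF linear_dir_deriv[OF X]] g0_bilinear field_simps)

lemma lie_derivative_g0_commute:
  "smooth X \<Longrightarrow> lie_derivative_tensor X g0 p u v = lie_derivative_tensor X g0 p v u"
  by (simp add: lie_derivative_g0 g0_commute[of p u] g0_commute[of p v] algebra_simps)

lemma lie_derivative_g0_z:
  assumes "smooth X"
  shows "lie_derivative_tensor X g0 p (axis 3 1) v = g0 p (pd 3 X p) v"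
  unfolding lie_derivative_g0[OF assms] by (simp add: g0_eq nth_axis)

text \<open>Indices 1 and 2 are corrected by a multiple of \<open>ddz\<close> so as to lie in the
  kernel of \<open>omega0\<close>; index 3 stays \<open>ddz\<close>, which is transverse to that
  kernel.\<close>

definition horizontal_frame :: "real^5 \<Rightarrow> 5 \<Rightarrow> real^5" where
  "horizontal_frame p i = axis i 1
    + (if i = 1 then p $ 4 else if i = 2 then p $ 5 else 0) *\<^sub>R axis 3 1"

text \<open>\<open>ddz\<close> spans a complement of the contact distribution and lies in the kernel
  of \<open>g0\<close>. So the unknown form \<open>\<mu>\<close> can be recovered from
  \<open>X\<close>, and the condition becomes an equation on horizontal vectors only.\<close>

lemma lie_derivative_g0_iff:
  assumes X: "smooth X"
  shows "(\<exists>h \<mu>. smooth h \<and> smooth_one_form \<mu> \<and> (\<forall>p u v.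
      lie_derivative_tensor X g0 p u v = h p * g0 p u v + sym_prod (\<mu> p) (omega0 p) u v)) \<longleftrightarrow>
    (\<exists>h. smooth h \<and> (\<forall>p u v. omega0 p u = 0 \<longrightarrow> omega0 p v = 0 \<longrightarrow>
      lie_derivative_tensor X g0 p u v = h p * g0 p u v))"
proof safe
  fix h \<mu>
  assume "smooth h" and *: "\<forall>p u v. lie_derivative_tensor X g0 p u v
    = h p * g0 p u v + sym_prod (\<mu> p) (omega0 p) u v"
  then show "\<exists>h. smooth h \<and> (\<forall>p u v. omega0 p u = 0 \<longrightarrow> omega0 p v = 0 \<longrightarrow>
      lie_derivative_tensor X g0 p u v = h p * g0 p u v)"
    by (intro exI[of _ h]) (simp add: sym_prod_def)
next
  fix h :: "real^5 \<Rightarrow> real"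
  assume h: "smooth h" and H: "\<forall>p u v. omega0 p u = 0 \<longrightarrow> omega0 p v = 0 \<longrightarrow>
      lie_derivative_tensor X g0 p u v = h p * g0 p u v"
  \<comment> \<open>\<open>L\<^sub>X g (\<partial>\<^sub>z, v) = g (\<partial>\<^sub>z X, v)\<close> because \<open>g (\<partial>\<^sub>z, v) = 0\<close>, which dictates \<open>\<mu>\<close>.\<close>
  define \<mu> where "\<mu> p v = 2 * g0 p (pd 3 X p) v" for p v
  have "linear (\<mu> p)" for p
    by (rule linearI) (simp_all add: \<mu>_def g0_bilinear algebra_simps)
  moreover have "smooth (\<lambda>p. \<mu> p v)" for v
    by (simp add: \<mu>_def g0_eq smooth_intros X)
  ultimately have \<mu>: "smooth_one_form \<mu>" by (simp add: smooth_one_form_def)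
  have "lie_derivative_tensor X g0 p u v = h p * g0 p u v + sym_prod (\<mu> p) (omega0 p) u v" for p u v
  proof -
    let ?L = "lie_derivative_tensor X g0 p" and ?z = "axis 3 1 :: real^5"
    define u' v' where "u' = u - omega0 p u *\<^sub>R ?z" and "v' = v - omega0 p v *\<^sub>R ?z"
    have u': "omega0 p u' = 0" "u = u' + omega0 p u *\<^sub>R ?z"
      and v': "omega0 p v' = 0" "v = v' + omega0 p v *\<^sub>R ?z"
      by (simp_all add: u'_def v'_def omega0_eq nth_axis)
    have z: "?L ?z w = \<mu> p w / 2" "?L w ?z = \<mu> p w / 2" "g0 p ?z w = 0" "\<mu> p ?z = 0" for w
      by (simp_all add: \<mu>_def lie_derivative_g0_z[OF X] lie_derivative_g0_commute[OF X, of p w]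
          g0_eq nth_axis)
    have \<mu>': "\<mu> p (w + c *\<^sub>R ?z) = \<mu> p w" for w c
      by (simp add: \<mu>_def g0_bilinear) (simp add: g0_eq nth_axis)
    have g: "g0 p (x + c *\<^sub>R ?z) (y + d *\<^sub>R ?z) = g0 p x y" for x y c d
      by (simp add: g0_eq nth_axis)
    have "?L u v = ?L (u' + omega0 p u *\<^sub>R ?z) (v' + omega0 p v *\<^sub>R ?z)"
      using u'(2) v'(2) by simp
    also have "\<dots> = ?L u' (v' + omega0 p v *\<^sub>R ?z)
        + omega0 p u * (\<mu> p (v' + omega0 p v *\<^sub>R ?z) / 2)"
      by (simp only: lie_derivative_g0_bilinear[OF X] z)
    also have "?L u' (v' + omega0 p v *\<^sub>R ?z) = ?L u' v' + omega0 p v * (\<mu> p u' / 2)"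
      by (simp only: lie_derivative_g0_commute[OF X, of p u'] lie_derivative_g0_bilinear[OF X] z)
    also have "?L u' v' = h p * g0 p u' v'" using H u'(1) v'(1) by simp
    also have "g0 p u' v' = g0 p u v" using g[of u' _ v'] u'(2) v'(2) by metis
    also have "\<mu> p u' = \<mu> p u" using \<mu>'[of u'] u'(2) by metis
    also have "\<mu> p (v' + omega0 p v *\<^sub>R ?z) = \<mu> p v" using v'(2) by simp
    finally show ?thesis by (simp add: sym_prod_def field_simps)
  qed
  with h \<mu> show "\<exists>h \<mu>. smooth h \<and> smooth_one_form \<mu> \<and> (\<forall>p u v.
      lie_derivative_tensor X g0 p u v = h p * g0 p u v + sym_prod (\<mu> p) (omega0 p) u v)"
    by blast
qed

text \<open>The equation \<open>L\<^sub>X g = h g\<close> evaluated on pairs from the frame \<open>\<partial>\<^sub>x + a \<partial>\<^sub>z\<close>, \<open>\<partial>\<^sub>y + b \<partial>\<^sub>z\<close>,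
  \<open>\<partial>\<^sub>a\<close>, \<open>\<partial>\<^sub>b\<close> (indices 1, 2, 4, 5) of the contact distribution: \<open>x4\<close>, \<open>x5\<close> are components of \<open>X\<close>,
  and \<open>T i j\<close> is the derivative of the \<open>j\<close>-th component of \<open>X\<close> along the \<open>i\<close>-th frame vector.\<close>

definition cr_system ::
  "real \<Rightarrow> real \<Rightarrow> real \<Rightarrow> real \<Rightarrow> real \<Rightarrow> (5 \<Rightarrow> 5 \<Rightarrow> real) \<Rightarrow> bool" where
  "cr_system a b h x4 x5 T \<longleftrightarrow>
     a * b * T 4 1 + (1 + b\<^sup>2) * T 4 2 = 0 \<and>
     (1 + a\<^sup>2) * T 5 1 + a * b * T 5 2 = 0 \<and>
     (1 + a\<^sup>2) * T 4 1 + a * b * T 4 2 - a * b * T 5 1 - (1 + b\<^sup>2) * T 5 2 = 0 \<and>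
     (1 + a\<^sup>2) * T 4 5 - a * b * T 4 4 - a * b * T 1 1 - (1 + b\<^sup>2) * T 1 2 - b * x4 - a * x5
       = - (a * b) * h \<and>
     (1 + a\<^sup>2) * T 5 5 - a * b * T 5 4 + (1 + a\<^sup>2) * T 1 1 + a * b * T 1 2 + 2 * a * x4
       = (1 + a\<^sup>2) * h \<and>
     a * b * T 4 5 - (1 + b\<^sup>2) * T 4 4 - a * b * T 2 1 - (1 + b\<^sup>2) * T 2 2 - 2 * b * x5
       = - (1 + b\<^sup>2) * h \<and>
     a * b * T 5 5 - (1 + b\<^sup>2) * T 5 4 + (1 + a\<^sup>2) * T 2 1 + a * b * T 2 2 + b * x4 + a * x5
       = a * b * h \<and>
     (1 + a\<^sup>2) * T 1 5 - a * b * T 1 4 = 0 \<and>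
     a * b * T 2 5 - (1 + b\<^sup>2) * T 2 4 = 0 \<and>
     (1 + a\<^sup>2) * T 2 5 - a * b * T 2 4 + a * b * T 1 5 - (1 + b\<^sup>2) * T 1 4 = 0"

lemma horizontal_frame_nth:
  "horizontal_frame p i $ j = (if i = j then 1 else 0)
    + (if j = 3 then (if i = 1 then p $ 4 else if i = 2 then p $ 5 else 0) else 0)"
  by (simp add: horizontal_frame_def nth_axis)

lemma horizontal_eq_sum:
  assumes "omega0 p u = 0"
  shows "u = u $ 1 *\<^sub>R horizontal_frame p 1 + (u $ 2 *\<^sub>R horizontal_frame p 2
    + (u $ 4 *\<^sub>R horizontal_frame p 4 + u $ 5 *\<^sub>R horizontal_frame p 5))"
  using assms unfolding vec_eq_iff forall_5
  by (simp add: horizontal_frame_nth omega0_eq algebra_simps)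

text \<open>Both sides are symmetric and bilinear in \<open>u\<close> and \<open>v\<close>, so the
  ten unordered pairs of the four frame vectors decide the equation.\<close>

lemma horizontal_lie_derivative_iff:
  assumes X: "smooth X"
  shows "(\<forall>u v. omega0 p u = 0 \<longrightarrow> omega0 p v = 0 \<longrightarrow>
      lie_derivative_tensor X g0 p u v = h * g0 p u v) \<longleftrightarrow>
    cr_system (p $ 4) (p $ 5) h (X p $ 4) (X p $ 5)
      (\<lambda>i j. dir_deriv (horizontal_frame p i) X p $ j)" (is "?L \<longleftrightarrow> ?R")
proof -
  let ?e = "horizontal_frame p" and ?N = "lie_derivative_tensor X g0 p"
  \<comment> \<open>One pair for each unordered pair, in the order of the conjuncts of
    \<open>cr_system\<close>.\<close>
  define I :: "(5 \<times> 5) set" where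
    "I = {(4,4), (5,5), (4,5), (1,4), (1,5), (2,4), (2,5), (1,1), (2,2), (1,2)}"
  define T where "T i j = dir_deriv (?e i) X p $ j" for i j
  define a b where "a = p $ 4" and "b = p $ 5"
  \<comment> \<open>The factor \<open>c\<close> absorbs the 1/2 of symmetric products and the choice
    of sign in each conjunct.\<close>
  have iff: "x = y \<longleftrightarrow> l = r" if "c * (x - y) = l - r" "c \<noteq> 0" for c x y l r :: real
    using that by auto
  note calc = lie_derivative_g0[OF X] g0_eq horizontal_frame_nth power2_eq_square algebra_simps
    add_divide_distrib diff_divide_distrib T_def[symmetric] a_def[symmetric] b_def[symmetric]
  have "?N (?e 4) (?e 4) = h * g0 p (?e 4) (?e 4) \<longleftrightarrow>
      a * b * T 4 1 + (1 + b\<^sup>2) * T 4 2 = 0"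
    "?N (?e 5) (?e 5) = h * g0 p (?e 5) (?e 5) \<longleftrightarrow>
      (1 + a\<^sup>2) * T 5 1 + a * b * T 5 2 = 0"
    "?N (?e 4) (?e 5) = h * g0 p (?e 4) (?e 5) \<longleftrightarrow>
      (1 + a\<^sup>2) * T 4 1 + a * b * T 4 2 - a * b * T 5 1 - (1 + b\<^sup>2) * T 5 2 = 0"
    "?N (?e 1) (?e 4) = h * g0 p (?e 1) (?e 4) \<longleftrightarrow>
      (1 + a\<^sup>2) * T 4 5 - a * b * T 4 4 - a * b * T 1 1 - (1 + b\<^sup>2) * T 1 2
        - b * X p $ 4 - a * X p $ 5 = - (a * b) * h"
    "?N (?e 1) (?e 5) = h * g0 p (?e 1) (?e 5) \<longleftrightarrow>
      (1 + a\<^sup>2) * T 5 5 - a * b * T 5 4 + (1 + a\<^sup>2) * T 1 1 + a * b * T 1 2 + 2 * a * X p $ 4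
        = (1 + a\<^sup>2) * h"
    "?N (?e 2) (?e 4) = h * g0 p (?e 2) (?e 4) \<longleftrightarrow>
      a * b * T 4 5 - (1 + b\<^sup>2) * T 4 4 - a * b * T 2 1 - (1 + b\<^sup>2) * T 2 2 - 2 * b * X p $ 5
        = - (1 + b\<^sup>2) * h"
    "?N (?e 2) (?e 5) = h * g0 p (?e 2) (?e 5) \<longleftrightarrow>
      a * b * T 5 5 - (1 + b\<^sup>2) * T 5 4 + (1 + a\<^sup>2) * T 2 1 + a * b * T 2 2
        + b * X p $ 4 + a * X p $ 5 = a * b * h"
    "?N (?e 1) (?e 1) = h * g0 p (?e 1) (?e 1) \<longleftrightarrow> (1 + a\<^sup>2) * T 1 5 - a * b * T 1 4 = 0"
    "?N (?e 2) (?e 2) = h * g0 p (?e 2) (?e 2) \<longleftrightarrow> a * b * T 2 5 - (1 + b\<^sup>2) * T 2 4 = 0"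
    "?N (?e 1) (?e 2) = h * g0 p (?e 1) (?e 2) \<longleftrightarrow>
      (1 + a\<^sup>2) * T 2 5 - a * b * T 2 4 + a * b * T 1 5 - (1 + b\<^sup>2) * T 1 4 = 0"
    apply (rule iff[where c = "-1"], simp add: calc, simp)
    apply (rule iff[where c = "1"], simp add: calc, simp)
    apply (rule iff[where c = "2"], simp add: calc, simp)
    apply (rule iff[where c = "2"], simp add: calc, simp)
    apply (rule iff[where c = "2"], simp add: calc, simp)
    apply (rule iff[where c = "2"], simp add: calc, simp)
    apply (rule iff[where c = "2"], simp add: calc, simp)
    apply (rule iff[where c = "1"], simp add: calc, simp)
    apply (rule iff[where c = "1"], simp add: calc, simp)
    apply (rule iff[where c = "2"], simp add: calc, simp)
    done
  then have R: "(\<forall>(i, j)\<in>I. ?N (?e i) (?e j) = h * g0 p (?e i) (?e j)) \<longleftrightarrow> ?R"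
    unfolding I_def cr_system_def ball_simps T_def[symmetric] a_def[symmetric] b_def[symmetric]
    by (simp only: ball_simps split_conv ball_empty simp_thms)
  show ?thesis unfolding R[symmetric]
  proof
    assume ?L
    moreover have "omega0 p (?e i) = 0" if "i \<noteq> 3" for i
      using that exhaust_5[of i] by (auto simp: omega0_eq horizontal_frame_nth)
    ultimately show "\<forall>(i, j)\<in>I. ?N (?e i) (?e j) = h * g0 p (?e i) (?e j)"
      by (auto simp: I_def)
  next
    assume *: "\<forall>(i, j)\<in>I. ?N (?e i) (?e j) = h * g0 p (?e i) (?e j)"
    have N: "?N (?e i) (?e j) = h * g0 p (?e i) (?e j)" if "(i, j) \<in> I \<or> (j, i) \<in> I" for i j
      using that * lie_derivative_g0_commute[OF X, of p "?e i"] g0_commute[of p "?e i"] by auto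
    show ?L
    proof safe
      fix u v assume u: "omega0 p u = 0" and v: "omega0 p v = 0"
      have 1: "?N (?e i) v = h * g0 p (?e i) v" if "i \<noteq> 3" for i
        using that exhaust_5[of i]
        by (subst (1 2) horizontal_eq_sum[OF v],
            simp only: lie_derivative_g0_commute[OF X, of p "?e i"] lie_derivative_g0_bilinear[OF X]
              g0_bilinear)
          (auto simp: N I_def algebra_simps g0_commute)
      show "?N u v = h * g0 p u v"
        by (subst (1 2) horizontal_eq_sum[OF u])
          (simp add: lie_derivative_g0_bilinear[OF X] g0_bilinear 1 algebra_simps)
    qed
  qed
qed

lemma infinitesimal_symmetries_iff:
  "X \<in> infinitesimal_symmetries omega0 g0 \<longleftrightarrow>
    (\<exists>F. smooth F \<and> X = contact_field F \<and> (\<exists>h. smooth h \<and>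
      (\<forall>p. cr_system (p $ 4) (p $ 5) (h p) (X p $ 4) (X p $ 5)
        (\<lambda>i j. dir_deriv (horizontal_frame p i) X p $ j))))"
proof (cases "smooth X")
  case True
  show ?thesis
    unfolding infinitesimal_symmetries_def mem_Collect_eq lie_derivative_omega0_iff[OF True]
      lie_derivative_g0_iff[OF True] horizontal_lie_derivative_iff[OF True, symmetric]
    using True by blast
next
  case False
  then show ?thesis using smooth_contact_field by (auto simp: infinitesimal_symmetries_def)
qed

section \<open>Solution of the symmetry equations\<close>

lemma dir_deriv_power2:
  fixes f :: "'a::euclidean_space \<Rightarrow> real"
  shows "smooth f \<Longrightarrow> dir_deriv v (\<lambda>p. (f p)\<^sup>2) p = 2 * f p * dir_deriv v f p"
  using dir_deriv_mult[of f f v p] by (simp add: power2_eq_square)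

lemma dir_deriv_fun_rules:
  fixes f g :: "'a::euclidean_space \<Rightarrow> real"
  shows "smooth f \<Longrightarrow> smooth g \<Longrightarrow>
      dir_deriv v (\<lambda>p. f p + g p) = (\<lambda>p. dir_deriv v f p + dir_deriv v g p)"
    and "smooth f \<Longrightarrow> smooth g \<Longrightarrow>
      dir_deriv v (\<lambda>p. f p - g p) = (\<lambda>p. dir_deriv v f p - dir_deriv v g p)"
    and "smooth f \<Longrightarrow> dir_deriv v (\<lambda>p. - f p) = (\<lambda>p. - dir_deriv v f p)"
    and "smooth f \<Longrightarrow> smooth g \<Longrightarrow>
      dir_deriv v (\<lambda>p. f p * g p) = (\<lambda>p. f p * dir_deriv v g p + dir_deriv v f p * g p)"
    and "smooth f \<Longrightarrow> dir_deriv v (\<lambda>p. (f p)\<^sup>2) = (\<lambda>p. 2 * f p * dir_deriv v f p)"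
    and "dir_deriv v (\<lambda>p::'a. c::real) = (\<lambda>p. 0)"
  by (auto simp: dir_deriv_add dir_deriv_diff dir_deriv_minus dir_deriv_mult dir_deriv_power2
      dir_deriv_const)

section \<open>Calculus of the length of the normal covector\<close>

definition normal_length :: "real^5 \<Rightarrow> real" where "normal_length p = sqrt ((p $ 4)\<^sup>2 + (p $ 5)\<^sup>2 + 1)"

definition inv_normal_length :: "real^5 \<Rightarrow> real" where "inv_normal_length p = inverse (normal_length p)"

lemma normal_length_arg_pos: "(p $ 4)\<^sup>2 + (p $ 5)\<^sup>2 + (1::real) > 0" for p :: "real^5"
  by (intro add_nonneg_pos) auto

lemma normal_length_pos: "normal_length p > 0" and normal_length_power2: "(normal_length p)\<^sup>2 = (p $ 4)\<^sup>2 + (p $ 5)\<^sup>2 + 1"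
  using normal_length_arg_pos[of p] by (simp_all add: normal_length_def)

lemma normal_length_inv_normal_length: "normal_length p * inv_normal_length p = 1" and inv_normal_length_pos: "inv_normal_length p > 0"
  using normal_length_pos[of p] by (simp_all add: inv_normal_length_def)

lemma inv_normal_length_neq_0 [simp]: "inv_normal_length p \<noteq> 0"
  using inv_normal_length_pos[of p] by simp

lemma inv_normal_length_power2: "(inv_normal_length p)\<^sup>2 * ((p $ 4)\<^sup>2 + (p $ 5)\<^sup>2 + 1) = 1"
  using normal_length_inv_normal_length[of p] unfolding normal_length_power2[symmetric] by (metis mult.commute power_mult_distrib power_one)

lemma smooth_normal_length [smooth_intros]: "smooth normal_length"
  unfolding normal_length_def[abs_def] using normal_length_arg_pos by (simp add: smooth_intros)

lemma smooth_inv_normal_length [smooth_intros]: "smooth inv_normal_length"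
  unfolding inv_normal_length_def[abs_def] using normal_length_pos by (simp add: smooth_intros less_imp_neq[symmetric])

text \<open>Obtained from the polynomial identity for the square of the length; the derivative of
  the inverse below comes likewise from a product equal to 1.\<close>

lemma pd_normal_length: "pd i normal_length = (\<lambda>p. (if i = 4 then p $ 4 else if i = 5 then p $ 5 else 0) * inv_normal_length p)"
proof
  fix p
  have "dir_deriv (axis i 1) (\<lambda>q. (normal_length q)\<^sup>2) p
      = dir_deriv (axis i 1) (\<lambda>q. (q $ 4)\<^sup>2 + (q $ 5)\<^sup>2 + 1) p"
    by (simp add: normal_length_power2)
  then have "2 * (normal_length p * pd i normal_length p) = 2 * (if i = 4 then p $ 4 else if i = 5 then p $ 5 else 0)"
    by (auto simp: dir_deriv_fun_rules smooth_intros pd_coordinate)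
  then have "normal_length p * pd i normal_length p = (if i = 4 then p $ 4 else if i = 5 then p $ 5 else 0)" by simp
  then have "inv_normal_length p * (normal_length p * pd i normal_length p)
      = (if i = 4 then p $ 4 else if i = 5 then p $ 5 else 0) * inv_normal_length p" by simp
  moreover have "inv_normal_length p * (normal_length p * pd i normal_length p) = pd i normal_length p"
    using normal_length_inv_normal_length[of p] by (simp add: mult.assoc[symmetric] mult.commute[of "inv_normal_length p"])
  ultimately show "pd i normal_length p = (if i = 4 then p $ 4 else if i = 5 then p $ 5 else 0) * inv_normal_length p"
    by simp
qed

lemma pd_inv_normal_length: "pd i inv_normal_length = (\<lambda>p. - (if i = 4 then p $ 4 else if i = 5 then p $ 5 else 0) * inv_normal_length p ^ 3)"
proof
  fix p
  have "dir_deriv (axis i 1) (\<lambda>q. normal_length q * inv_normal_length q) p = 0" by (simp add: normal_length_inv_normal_length dir_deriv_const)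
  then have *: "normal_length p * pd i inv_normal_length p
      = - (if i = 4 then p $ 4 else if i = 5 then p $ 5 else 0) * (inv_normal_length p)\<^sup>2"
    by (simp add: dir_deriv_fun_rules smooth_intros pd_normal_length power2_eq_square)
  have "pd i inv_normal_length p = inv_normal_length p * (normal_length p * pd i inv_normal_length p)"
    using normal_length_inv_normal_length[of p] by (simp add: mult.assoc[symmetric] mult.commute[of "inv_normal_length p"])
  then show "pd i inv_normal_length p = - (if i = 4 then p $ 4 else if i = 5 then p $ 5 else 0) * inv_normal_length p ^ 3"
    unfolding * by (simp add: power2_eq_square power3_eq_cube)
qed

section \<open>Contact potentials and the derivatives of their fields along the frame\<close>

lemma frame_deriv_nth:
  assumes "smooth X"
  shows "dir_deriv (horizontal_frame p i) X p $ j = pd i (\<lambda>q. X q $ j) p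
    + (if i = 1 then p $ 4 else if i = 2 then p $ 5 else 0) * pd 3 (\<lambda>q. X q $ j) p"
  by (simp add: horizontal_frame_def linear_add[OF linear_dir_deriv[OF assms]]
      linear_scale[OF linear_dir_deriv[OF assms]] dir_deriv_nth[OF assms])

lemma contact_field_nth:
  "contact_field F p $ 1 = - pd 4 F p" "contact_field F p $ 2 = - pd 5 F p"
  "contact_field F p $ 3 = F p - p $ 4 * pd 4 F p - p $ 5 * pd 5 F p"
  "contact_field F p $ 4 = pd 1 F p + p $ 4 * pd 3 F p"
  "contact_field F p $ 5 = pd 2 F p + p $ 5 * pd 3 F p"
  by (simp_all add: contact_field_def vector_5)

text \<open>Functions of x, y, z alone, kept as functions on \<open>real^5\<close> so that one
  calculus of partial derivatives serves both these and the potential.\<close>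

definition base_function :: "(real^5 \<Rightarrow> real) \<Rightarrow> bool" where
  "base_function f \<longleftrightarrow> smooth f \<and> pd 4 f = (\<lambda>p. 0) \<and> pd 5 f = (\<lambda>p. 0)"

definition contact_potential where
  "contact_potential A B C E p = A p + p $ 4 * B p + p $ 5 * C p + E p * normal_length p"

lemma base_functionD:
  assumes "base_function f"
  shows "smooth f" "pd 4 f = (\<lambda>p. 0)" "pd 5 f = (\<lambda>p. 0)"
    "pd 4 (pd i f) = (\<lambda>p. 0)" "pd 5 (pd i f) = (\<lambda>p. 0)"
proof -
  show *: "smooth f" "pd 4 f = (\<lambda>p. 0)" "pd 5 f = (\<lambda>p. 0)"
    using assms by (auto simp: base_function_def)
  show "pd 4 (pd i f) = (\<lambda>p. 0)" "pd 5 (pd i f) = (\<lambda>p. 0)"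
    using dir_deriv_commute[OF *(1), of _ "axis i 1"] * by (auto simp: dir_deriv_const)
qed

text \<open>The three equations have rank two in the second slope derivatives; their solutions are
  the multiples of (1 + b^2, - a b, 1 + a^2), which is r^3 times the Hessian of r. Once the factor
  \<open>E\<close> is independent of the slopes, F - r E has zero slope Hessian and hence is affine
  in a and b.\<close>

lemma potential_of_vertical_equations:
  assumes F: "smooth F"
    and v1: "\<And>p. p $ 4 * p $ 5 * pd 4 (pd 4 F) p + (1 + (p $ 5)\<^sup>2) * pd 5 (pd 4 F) p = 0"
    and v2: "\<And>p. (1 + (p $ 4)\<^sup>2) * pd 5 (pd 4 F) p + p $ 4 * p $ 5 * pd 5 (pd 5 F) p = 0"
    and v3: "\<And>p. (1 + (p $ 4)\<^sup>2) * pd 4 (pd 4 F) p = (1 + (p $ 5)\<^sup>2) * pd 5 (pd 5 F) p"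
  obtains A B C E where "base_function A" "base_function B" "base_function C" "base_function E"
    "F = contact_potential A B C E"
proof -
  \<comment> \<open>\<open>E\<close> is the factor between the Hessians of \<open>F\<close> and \<open>normal_length\<close>; it does not depend on
    the slopes because third derivatives commute.\<close>
  define E where "E p = normal_length p * ((1 + (p $ 4)\<^sup>2) * pd 4 (pd 4 F) p + p $ 4 * p $ 5 * pd 5 (pd 4 F) p)"
    for p
  have E: "smooth E" unfolding E_def[abs_def] by (simp add: smooth_intros F)
  \<comment> \<open>Trades \<open>E\<close> for slope derivatives of \<open>F\<close>, after which
    the root enters only through its inverse square, a rational function of the slopes.\<close>
  have r: "E p * inv_normal_length p ^ 3 * x = ((1 + (p $ 4)\<^sup>2) * pd 4 (pd 4 F) p + p $ 4 * p $ 5 * pd 5 (pd 4 F) p)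
      * x * (inv_normal_length p)\<^sup>2" for p x
    using normal_length_inv_normal_length[of p] unfolding E_def power3_eq_cube power2_eq_square by algebra
  have F44: "pd 4 (pd 4 F) p = E p * inv_normal_length p ^ 3 * (1 + (p $ 5)\<^sup>2)" for p
    using inv_normal_length_power2[of p] v1[of p] v2[of p] v3[of p] unfolding r power2_eq_square by algebra
  have F54: "pd 5 (pd 4 F) p = - (E p * inv_normal_length p ^ 3 * (p $ 4 * p $ 5))" for p
    using inv_normal_length_power2[of p] v1[of p] v2[of p] v3[of p] unfolding r power2_eq_square by algebra
  have F55: "pd 5 (pd 5 F) p = E p * inv_normal_length p ^ 3 * (1 + (p $ 4)\<^sup>2)" for p
    using inv_normal_length_power2[of p] v1[of p] v2[of p] v3[of p] unfolding r power2_eq_square by algebra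
  note hess = F44[THEN ext] F54[THEN ext] F55[THEN ext]
  have F45: "pd 4 (pd 5 F) = pd 5 (pd 4 F)"
    using dir_deriv_commute[OF F] by (simp add: fun_eq_iff)
  have ss3: "pd i (\<lambda>p. inv_normal_length p ^ 3)
      = (\<lambda>p. - 3 * (if i = 4 then p $ 4 else if i = 5 then p $ 5 else 0) * inv_normal_length p ^ 5)" for i
    by (simp add: power3_eq_cube dir_deriv_fun_rules smooth_intros pd_inv_normal_length fun_eq_iff power_numeral_reduce)
  have "pd 5 (pd 4 (pd 4 F)) p = pd 4 (pd 5 (pd 4 F)) p"
    "pd 4 (pd 5 (pd 5 F)) p = pd 5 (pd 5 (pd 4 F)) p" for p
    using dir_deriv_commute[of "pd 4 F" "axis 5 1" "axis 4 1"]
      dir_deriv_commute[of "pd 5 F" "axis 4 1" "axis 5 1"] F F45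
    by (simp_all add: smooth_intros)
  then have e: "3 * (E p * (p $ 5 * inv_normal_length p ^ 3))
      + (pd 5 E p * inv_normal_length p ^ 3 - E p * (3 * p $ 5 * inv_normal_length p ^ 5)) * (1 + (p $ 5)\<^sup>2)
      = - ((pd 4 E p * inv_normal_length p ^ 3 - E p * (3 * p $ 4 * inv_normal_length p ^ 5)) * (p $ 4 * p $ 5))"
    "3 * (E p * (p $ 4 * inv_normal_length p ^ 3))
      + (pd 4 E p * inv_normal_length p ^ 3 - E p * (3 * p $ 4 * inv_normal_length p ^ 5)) * (1 + (p $ 4)\<^sup>2)
      = - ((pd 5 E p * inv_normal_length p ^ 3 - E p * (3 * p $ 5 * inv_normal_length p ^ 5)) * (p $ 4 * p $ 5))" for p
    unfolding hess by (simp_all add: dir_deriv_fun_rules smooth_intros E ss3 pd_coordinate)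
  have "inv_normal_length p ^ 3 * (pd 5 E p * (1 + (p $ 5)\<^sup>2) + pd 4 E p * (p $ 4 * p $ 5)) = 0" for p
    using e(1)[of p] inv_normal_length_power2[of p] by algebra
  moreover have "inv_normal_length p ^ 3 * (pd 4 E p * (1 + (p $ 4)\<^sup>2) + pd 5 E p * (p $ 4 * p $ 5)) = 0" for p
    using e(2)[of p] inv_normal_length_power2[of p] by algebra
  ultimately have E': "pd 5 E p * (1 + (p $ 5)\<^sup>2) + pd 4 E p * (p $ 4 * p $ 5) = 0"
    "pd 4 E p * (1 + (p $ 4)\<^sup>2) + pd 5 E p * (p $ 4 * p $ 5) = 0" for p
    by simp_all
  \<comment> \<open>The determinant (1 + a^2) (1 + b^2) - a^2 b^2 of this linear system is r^2,
    whose inverse is supplied by \<open>inv_normal_length_power2\<close>.\<close>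
  have "pd 4 E p = 0" "pd 5 E p = 0" for p
  proof -
    show "pd 4 E p = 0" using E'[of p] inv_normal_length_power2[of p] by algebra
    show "pd 5 E p = 0" using E'[of p] inv_normal_length_power2[of p] by algebra
  qed
  then have E45: "pd 4 E = (\<lambda>p. 0)" "pd 5 E = (\<lambda>p. 0)" by auto
  \<comment> \<open>\<open>B\<close> and \<open>C\<close> are the slope derivatives of F - r E, and
    \<open>A\<close> is its remaining slope-free term.\<close>
  define B where "B p = pd 4 F p - E p * (p $ 4 * inv_normal_length p)" for p
  define C where "C p = pd 5 F p - E p * (p $ 5 * inv_normal_length p)" for p
  define A where "A p = F p - p $ 4 * B p - p $ 5 * C p - E p * normal_length p" for p
  note calc = dir_deriv_fun_rules smooth_intros F E E45 pd_inv_normal_length pd_normal_length pd_coordinate F45 hess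
  have s3: "inv_normal_length p ^ 3 * (1 + (p $ 5)\<^sup>2) = inv_normal_length p - p $ 4 * (p $ 4 * inv_normal_length p ^ 3)"
    "inv_normal_length p ^ 3 * (1 + (p $ 4)\<^sup>2) = inv_normal_length p - p $ 5 * (p $ 5 * inv_normal_length p ^ 3)" for p
    using inv_normal_length_power2[of p] by algebra+
  have B: "base_function B"
    unfolding base_function_def B_def[abs_def] fun_eq_iff
    by (simp add: calc s3)
  have C: "base_function C"
    unfolding base_function_def C_def[abs_def] fun_eq_iff
    by (simp add: calc s3)
  have A: "base_function A"
    unfolding base_function_def A_def[abs_def] fun_eq_iff
    by (simp add: calc base_functionD[OF B] base_functionD[OF C]) (simp add: B_def C_def)
  show thesis
    by (rule that[OF A B C, of E])
      (simp_all add: base_function_def E E45 A_def contact_potential_def fun_eq_iff)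
qed

lemma normal_length_eq: "normal_length p = inv_normal_length p * (1 + (p $ 4)\<^sup>2 + (p $ 5)\<^sup>2)"
  using inv_normal_length_power2[of p] normal_length_inv_normal_length[of p] by algebra

lemma base_function_pd:
  assumes "base_function f"
  shows "base_function (pd i f)"
  unfolding base_function_def
  using base_functionD(1,4,5)[OF assms] by (simp add: smooth_dir_deriv)

lemma smooth_contact_potential [smooth_intros]:
  "base_function A \<Longrightarrow> base_function B \<Longrightarrow> base_function C \<Longrightarrow> base_function E \<Longrightarrow>
    smooth (contact_potential A B C E)"
  unfolding contact_potential_def[abs_def] by (simp add: smooth_intros base_functionD)

lemma pd_contact_potential:
  assumes "base_function A" "base_function B" "base_function C" "base_function E"
  shows "i \<noteq> 4 \<Longrightarrow> i \<noteq> 5 \<Longrightarrow> pd i (contact_potential A B C E)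
      = contact_potential (pd i A) (pd i B) (pd i C) (pd i E)"
    and "pd 4 (contact_potential A B C E) = (\<lambda>p. B p + E p * (p $ 4 * inv_normal_length p))"
    and "pd 5 (contact_potential A B C E) = (\<lambda>p. C p + E p * (p $ 5 * inv_normal_length p))"
  using assms unfolding contact_potential_def[abs_def]
  by (simp_all add: dir_deriv_fun_rules smooth_intros base_functionD pd_coordinate pd_normal_length fun_eq_iff)

text \<open>Serves both directions: it turns \<open>cr_system\<close> into equations for
  \<open>A\<close>, \<open>B\<close>, \<open>C\<close>, \<open>E\<close>, and it evaluates the
  explicit fields. Derivatives in x, y, z act on the coefficients only, so \<open>P\<close> and
  \<open>Q\<close> are again contact potentials.\<close>

lemma frame_table:
  fixes p :: "real^5" and A B C E :: "real^5 \<Rightarrow> real"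
  assumes base: "base_function A" "base_function B" "base_function C" "base_function E"
  defines "a \<equiv> p $ 4" and "b \<equiv> p $ 5" and "s \<equiv> inv_normal_length p" and "r \<equiv> normal_length p"
  defines "P i \<equiv> contact_potential (pd i A) (pd i B) (pd i C) (pd i E) p"
  defines "Q i j \<equiv> contact_potential (pd i (pd j A)) (pd i (pd j B)) (pd i (pd j C)) (pd i (pd j E)) p"
  defines "X \<equiv> contact_field (contact_potential A B C E)"
  defines "T i j \<equiv> dir_deriv (horizontal_frame p i) X p $ j"
  shows "X p $ 1 = - B p - E p * a * s" "X p $ 2 = - C p - E p * b * s"
    "X p $ 3 = A p + E p * s"
    "X p $ 4 = P 1 + a * P 3" "X p $ 5 = P 2 + b * P 3"
    "T 1 1 = - (pd 1 B p + a * pd 3 B p) - a * s * (pd 1 E p + a * pd 3 E p)"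
    "T 1 2 = - (pd 1 C p + a * pd 3 C p) - b * s * (pd 1 E p + a * pd 3 E p)"
    "T 2 1 = - (pd 2 B p + b * pd 3 B p) - a * s * (pd 2 E p + b * pd 3 E p)"
    "T 2 2 = - (pd 2 C p + b * pd 3 C p) - b * s * (pd 2 E p + b * pd 3 E p)"
    "T 4 1 = - (E p * s ^ 3 * (1 + b\<^sup>2))" "T 4 2 = E p * s ^ 3 * (a * b)"
    "T 5 1 = E p * s ^ 3 * (a * b)" "T 5 2 = - (E p * s ^ 3 * (1 + a\<^sup>2))"
    "T 4 4 = pd 1 B p + a * s * pd 1 E p + P 3 + a * (pd 3 B p + a * s * pd 3 E p)"
    "T 4 5 = pd 2 B p + a * s * pd 2 E p + b * (pd 3 B p + a * s * pd 3 E p)"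
    "T 5 4 = pd 1 C p + b * s * pd 1 E p + a * (pd 3 C p + b * s * pd 3 E p)"
    "T 5 5 = pd 2 C p + b * s * pd 2 E p + P 3 + b * (pd 3 C p + b * s * pd 3 E p)"
    "T 1 4 = Q 1 1 + a * Q 1 3 + a * (Q 3 1 + a * Q 3 3)"
    "T 1 5 = Q 1 2 + b * Q 1 3 + a * (Q 3 2 + b * Q 3 3)"
    "T 2 4 = Q 2 1 + a * Q 2 3 + b * (Q 3 1 + a * Q 3 3)"
    "T 2 5 = Q 2 2 + b * Q 2 3 + b * (Q 3 2 + b * Q 3 3)"
proof -
  have F: "smooth (contact_potential A B C E)" using base by (simp add: smooth_intros)
  note T = T_def X_def frame_deriv_nth[OF smooth_contact_field[OF F]] contact_field_nth
  have sb: "smooth (contact_potential (pd i A) (pd i B) (pd i C) (pd i E))" for i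
    using base by (simp add: smooth_intros base_function_pd)
  note calc = pd_contact_potential[OF base] dir_deriv_fun_rules smooth_intros
    base_functionD[OF base(1)] base_functionD[OF base(2)] base_functionD[OF base(3)]
    base_functionD[OF base(4)] sb pd_contact_potential[OF base[THEN base_function_pd]]
    pd_coordinate pd_inv_normal_length
  \<comment> \<open>The derivative of a s in a is s - a^2 s^3, a diagonal entry of the Hessian of r;
    this is the form in which the table states it.\<close>
  have s3: "s ^ 3 * (1 + b\<^sup>2) = s - a * (a * s ^ 3)" "s ^ 3 * (1 + a\<^sup>2) = s - b * (b * s ^ 3)"
    using inv_normal_length_power2[of p] unfolding s_def a_def b_def by algebra+
  show "X p $ 1 = - B p - E p * a * s" "X p $ 2 = - C p - E p * b * s"
    "X p $ 4 = P 1 + a * P 3" "X p $ 5 = P 2 + b * P 3"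
    by (simp_all add: X_def contact_field_nth calc P_def a_def b_def s_def)
  show "X p $ 3 = A p + E p * s"
    by (simp add: X_def contact_field_nth calc s_def contact_potential_def normal_length_eq
        power2_eq_square algebra_simps)
  show "T 1 1 = - (pd 1 B p + a * pd 3 B p) - a * s * (pd 1 E p + a * pd 3 E p)"
    "T 1 2 = - (pd 1 C p + a * pd 3 C p) - b * s * (pd 1 E p + a * pd 3 E p)"
    "T 2 1 = - (pd 2 B p + b * pd 3 B p) - a * s * (pd 2 E p + b * pd 3 E p)"
    "T 2 2 = - (pd 2 C p + b * pd 3 C p) - b * s * (pd 2 E p + b * pd 3 E p)"
    by (simp_all add: T calc a_def b_def s_def) (simp_all add: algebra_simps)
  show "T 4 1 = - (E p * s ^ 3 * (1 + b\<^sup>2))" "T 4 2 = E p * s ^ 3 * (a * b)"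
    "T 5 1 = E p * s ^ 3 * (a * b)" "T 5 2 = - (E p * s ^ 3 * (1 + a\<^sup>2))"
    by (simp_all add: T calc mult.assoc s3) (simp_all add: a_def b_def s_def algebra_simps)
  show "T 4 4 = pd 1 B p + a * s * pd 1 E p + P 3 + a * (pd 3 B p + a * s * pd 3 E p)"
    "T 4 5 = pd 2 B p + a * s * pd 2 E p + b * (pd 3 B p + a * s * pd 3 E p)"
    "T 5 4 = pd 1 C p + b * s * pd 1 E p + a * (pd 3 C p + b * s * pd 3 E p)"
    "T 5 5 = pd 2 C p + b * s * pd 2 E p + P 3 + b * (pd 3 C p + b * s * pd 3 E p)"
    by (simp_all add: T calc a_def b_def s_def P_def algebra_simps)
  show "T 1 4 = Q 1 1 + a * Q 1 3 + a * (Q 3 1 + a * Q 3 3)"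
    "T 1 5 = Q 1 2 + b * Q 1 3 + a * (Q 3 2 + b * Q 3 3)"
    "T 2 4 = Q 2 1 + a * Q 2 3 + b * (Q 3 1 + a * Q 3 3)"
    "T 2 5 = Q 2 2 + b * Q 2 3 + b * (Q 3 2 + b * Q 3 3)"
    by (simp_all add: T calc a_def b_def Q_def algebra_simps)
qed

section \<open>Overdetermined systems in x, y, z\<close>

lemma base_function_eq:
  assumes "base_function f" "p $ 1 = q $ 1" "p $ 2 = q $ 2" "p $ 3 = q $ 3"
  shows "f p = f q"
proof -
  have f: "smooth f" using assms by (simp add: base_functionD)
  have "\<forall>t. ((\<lambda>t. f (q + t *\<^sub>R (p - q))) has_real_derivative 0) (at t)"
  proof
    fix t
    have "dir_deriv (p - q) f x = 0" for x
      using assms by (simp add: dir_deriv_eq_sum[OF f, of "p - q"] sum_5 base_functionD)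
    then show "((\<lambda>t. f (q + t *\<^sub>R (p - q))) has_real_derivative 0) (at t)"
      using DERIV_along_line[OF f, of q "p - q" t] by simp
  qed
  from DERIV_isconst_all[OF this, of 1 0] show ?thesis by simp
qed

text \<open>Along the ray through \<open>p\<close> the second derivative of \<open>f\<close> is the
  constant \<open>e\<close>; integrating twice from the origin gives Taylor's formula without
  remainder.\<close>

lemma quadratic_of_constant_hessian:
  fixes f :: "real^'n \<Rightarrow> real"
  assumes f: "smooth f" and hess: "\<And>i j p. pd i (pd j f) p = c i j"
  shows "f p = f 0 + (\<Sum>i\<in>UNIV. p $ i * pd i f 0) + (\<Sum>i\<in>UNIV. \<Sum>j\<in>UNIV. p $ i * p $ j * c i j) / 2"
proof -
  define d where "d = dir_deriv p f 0"
  define e where "e = (\<Sum>i\<in>UNIV. \<Sum>j\<in>UNIV. p $ i * p $ j * c i j)"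
  have "dir_deriv p (dir_deriv p f) q = e" for q
  proof -
    have *: "pd i (dir_deriv p f) q = (\<Sum>j\<in>UNIV. p $ j * c i j)" for i
    proof -
      have "pd i (dir_deriv p f) q = dir_deriv p (pd i f) q" by (rule dir_deriv_commute[OF f])
      also have "\<dots> = (\<Sum>j\<in>UNIV. p $ j * pd j (pd i f) q)"
        by (simp add: dir_deriv_eq_sum[OF smooth_dir_deriv[OF f], of p])
      also have "\<dots> = (\<Sum>j\<in>UNIV. p $ j * c i j)"
        using dir_deriv_commute[OF f, of "axis i 1"] hess by metis
      finally show ?thesis .
    qed
    have "dir_deriv p (dir_deriv p f) q = (\<Sum>i\<in>UNIV. p $ i * pd i (dir_deriv p f) q)"
      by (simp add: dir_deriv_eq_sum[OF smooth_dir_deriv[OF f], of p])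
    then show ?thesis by (simp add: * e_def sum_distrib_left mult.assoc)
  qed
  then have D2: "((\<lambda>t. dir_deriv p f (t *\<^sub>R p)) has_real_derivative e) (at t)" for t
    using DERIV_along_line[OF smooth_dir_deriv[OF f, of p], of 0 p] by simp
  have "\<forall>t. ((\<lambda>t. dir_deriv p f (t *\<^sub>R p) - e * t) has_real_derivative 0) (at t)"
    by (auto intro!: derivative_eq_intros D2)
  from DERIV_isconst_all[OF this, of _ 0]
  have D1: "dir_deriv p f (t *\<^sub>R p) = d + e * t" for t
    by (metis (no_types, lifting) d_def diff_eq_eq diff_zero mult_zero_right scaleR_zero_left)
  have "((\<lambda>t. f (t *\<^sub>R p)) has_real_derivative d + e * t) (at t)" for t
    using DERIV_along_line[OF f, of 0 p t] by (simp add: D1)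
  then have "\<forall>t. ((\<lambda>t. f (t *\<^sub>R p) - (d * t + e * t\<^sup>2 / 2)) has_real_derivative 0) (at t)"
    by (auto intro!: derivative_eq_intros)
  from DERIV_isconst_all[OF this, of 1 0] have "f p = f 0 + d + e / 2" by simp
  then show ?thesis by (simp add: d_def e_def dir_deriv_eq_sum[OF f, of p])
qed

text \<open>\<open>(- B, - C, A)\<close> is a conformal Killing field of Euclidean 3-space, with factor \<open>pd 3 A\<close>.\<close>

definition conformal_potential ::
  "(real^5 \<Rightarrow> real) \<Rightarrow> (real^5 \<Rightarrow> real) \<Rightarrow> (real^5 \<Rightarrow> real) \<Rightarrow> bool" where
  "conformal_potential A B C \<longleftrightarrow>
    pd 1 B = (\<lambda>p. - pd 3 A p) \<and> pd 2 C = (\<lambda>p. - pd 3 A p) \<and>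
    pd 1 A = pd 3 B \<and> pd 2 A = pd 3 C \<and> pd 2 B = (\<lambda>p. - pd 1 C p)"

text \<open>As rewrite rules these order indices increasingly from the outside in, so that equal
  iterated derivatives become identical atoms for \<open>linarith\<close>.\<close>

lemma pd_sort:
  fixes f :: "real^5 \<Rightarrow> real"
  assumes "smooth f"
  shows "pd 2 (pd 1 f) = pd 1 (pd 2 f)" "pd 3 (pd 1 f) = pd 1 (pd 3 f)"
    "pd 3 (pd 2 f) = pd 2 (pd 3 f)"
  using dir_deriv_commute[OF assms] by blast+

text \<open>Differentiating the five first-order equations in three directions gives 15 linear
  equations for 18 second derivatives; they express all of these by the gradient of the conformal
  factor \<open>pd 3 A\<close>.\<close>

lemma conformal_potential_hessian:
  assumes base: "base_function A" "base_function B" "base_function C"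
    and conf: "conformal_potential A B C"
  shows "pd 1 (pd 1 A) = (\<lambda>p. - pd 3 (pd 3 A) p)" "pd 1 (pd 2 A) = (\<lambda>p. 0)"
      "pd 2 (pd 2 A) = (\<lambda>p. - pd 3 (pd 3 A) p)"
    and "pd 1 (pd 1 B) = (\<lambda>p. - pd 1 (pd 3 A) p)" "pd 1 (pd 2 B) = (\<lambda>p. - pd 2 (pd 3 A) p)"
      "pd 1 (pd 3 B) = (\<lambda>p. - pd 3 (pd 3 A) p)" "pd 2 (pd 2 B) = pd 1 (pd 3 A)"
      "pd 2 (pd 3 B) = (\<lambda>p. 0)" "pd 3 (pd 3 B) = pd 1 (pd 3 A)"
    and "pd 1 (pd 1 C) = pd 2 (pd 3 A)" "pd 1 (pd 2 C) = (\<lambda>p. - pd 1 (pd 3 A) p)"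
      "pd 1 (pd 3 C) = (\<lambda>p. 0)" "pd 2 (pd 2 C) = (\<lambda>p. - pd 2 (pd 3 A) p)"
      "pd 2 (pd 3 C) = (\<lambda>p. - pd 3 (pd 3 A) p)" "pd 3 (pd 3 C) = pd 2 (pd 3 A)"
proof -
  note smooth = base[THEN base_functionD(1)] smooth_dir_deriv
  have D: "pd k (pd 1 B) p = - pd k (pd 3 A) p" "pd k (pd 2 C) p = - pd k (pd 3 A) p"
    "pd k (pd 1 A) p = pd k (pd 3 B) p" "pd k (pd 2 A) p = pd k (pd 3 C) p"
    "pd k (pd 2 B) p = - pd k (pd 1 C) p" for k p
    using conf by (simp_all add: conformal_potential_def dir_deriv_fun_rules smooth)
  note E = D[of 1] D[of 2] D[of 3]
  note E = E[unfolded pd_sort[OF smooth(1)] pd_sort[OF smooth(2)] pd_sort[OF smooth(3)]]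
  have "pd 1 (pd 1 A) p = - pd 3 (pd 3 A) p" "pd 1 (pd 2 A) p = 0"
      "pd 2 (pd 2 A) p = - pd 3 (pd 3 A) p"
    and "pd 1 (pd 1 B) p = - pd 1 (pd 3 A) p" "pd 1 (pd 2 B) p = - pd 2 (pd 3 A) p"
      "pd 1 (pd 3 B) p = - pd 3 (pd 3 A) p" "pd 2 (pd 2 B) p = pd 1 (pd 3 A) p"
      "pd 2 (pd 3 B) p = 0" "pd 3 (pd 3 B) p = pd 1 (pd 3 A) p"
    and "pd 1 (pd 1 C) p = pd 2 (pd 3 A) p" "pd 1 (pd 2 C) p = - pd 1 (pd 3 A) p"
      "pd 1 (pd 3 C) p = 0" "pd 2 (pd 2 C) p = - pd 2 (pd 3 A) p"
      "pd 2 (pd 3 C) p = - pd 3 (pd 3 A) p" "pd 3 (pd 3 C) p = pd 2 (pd 3 A) p" for p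
    using E[of p] by linarith+
  then show "pd 1 (pd 1 A) = (\<lambda>p. - pd 3 (pd 3 A) p)" "pd 1 (pd 2 A) = (\<lambda>p. 0)"
      "pd 2 (pd 2 A) = (\<lambda>p. - pd 3 (pd 3 A) p)"
    and "pd 1 (pd 1 B) = (\<lambda>p. - pd 1 (pd 3 A) p)" "pd 1 (pd 2 B) = (\<lambda>p. - pd 2 (pd 3 A) p)"
      "pd 1 (pd 3 B) = (\<lambda>p. - pd 3 (pd 3 A) p)" "pd 2 (pd 2 B) = pd 1 (pd 3 A)"
      "pd 2 (pd 3 B) = (\<lambda>p. 0)" "pd 3 (pd 3 B) = pd 1 (pd 3 A)"
    and "pd 1 (pd 1 C) = pd 2 (pd 3 A)" "pd 1 (pd 2 C) = (\<lambda>p. - pd 1 (pd 3 A) p)"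
      "pd 1 (pd 3 C) = (\<lambda>p. 0)" "pd 2 (pd 2 C) = (\<lambda>p. - pd 2 (pd 3 A) p)"
      "pd 2 (pd 3 C) = (\<lambda>p. - pd 3 (pd 3 A) p)" "pd 3 (pd 3 C) = pd 2 (pd 3 A)"
    by (simp_all add: fun_eq_iff)
qed

text \<open>The infinitesimal form of Liouville's rigidity theorem in dimension three: one further
  derivative, and commutation of third derivatives, annihilate the Hessian of the conformal
  factor.\<close>

lemma conformal_factor_affine:
  assumes base: "base_function A" "base_function B" "base_function C"
    and conf: "conformal_potential A B C"
  shows "pd i (pd j (pd 3 A)) p = 0"
proof -
  note smooth = base[THEN base_functionD(1)] smooth_dir_deriv
  note H = conformal_potential_hessian[OF assms]
  have D: "pd k (pd 1 (pd 1 A)) p = - pd k (pd 3 (pd 3 A)) p" "pd k (pd 1 (pd 2 A)) p = 0"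
    "pd k (pd 2 (pd 2 A)) p = - pd k (pd 3 (pd 3 A)) p"
    "pd k (pd 1 (pd 1 B)) p = - pd k (pd 1 (pd 3 A)) p"
    "pd k (pd 1 (pd 2 B)) p = - pd k (pd 2 (pd 3 A)) p"
    "pd k (pd 2 (pd 2 B)) p = pd k (pd 1 (pd 3 A)) p"
    "pd k (pd 2 (pd 3 B)) p = 0" "pd k (pd 1 (pd 3 C)) p = 0"
    "pd k (pd 1 (pd 1 C)) p = pd k (pd 2 (pd 3 A)) p" for k
    unfolding H by (simp_all add: dir_deriv_fun_rules smooth)
  have S: "smooth A" "smooth B" "smooth C" "smooth (pd k A)" "smooth (pd k B)" "smooth (pd k C)" for k
    by (auto simp: smooth)
  note E = D[of 1] D[of 2] D[of 3]
  note E = E[unfolded pd_sort[OF S(1)] pd_sort[OF S(2)] pd_sort[OF S(3)]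
      pd_sort[OF S(4)] pd_sort[OF S(5)] pd_sort[OF S(6)]]
  have "pd 1 (pd 1 (pd 3 A)) p = 0" "pd 2 (pd 2 (pd 3 A)) p = 0" "pd 3 (pd 3 (pd 3 A)) p = 0"
    "pd 1 (pd 2 (pd 3 A)) p = 0" "pd 1 (pd 3 (pd 3 A)) p = 0" "pd 2 (pd 3 (pd 3 A)) p = 0"
    using E by linarith+
  moreover have "base_function (pd 3 A)" by (rule base_function_pd[OF base(1)])
  ultimately show ?thesis
    using exhaust_5[of i] exhaust_5[of j] base_functionD[of "pd 3 A"] pd_sort[of "pd 3 A"]
    by (auto simp: dir_deriv_const)
qed

definition with_slopes :: "real^5 \<Rightarrow> real \<Rightarrow> real \<Rightarrow> real^5" where
  "with_slopes p a b = (\<chi> i. if i = 4 then a else if i = 5 then b else p $ i)"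

lemma with_slopes_nth: "with_slopes p a b $ 4 = a" "with_slopes p a b $ 5 = b"
  by (simp_all add: with_slopes_def)

lemma base_function_with_slopes: "base_function f \<Longrightarrow> f (with_slopes p a b) = f p"
  by (rule base_function_eq) (simp_all add: with_slopes_def)

text \<open>The pairs of a lifted base vector with a slope vector; these equations are of first
  order in \<open>A\<close>, \<open>B\<close>, \<open>C\<close>, \<open>E\<close>.\<close>

lemma cr_systemD_mixed:
  assumes "cr_system a b h x4 x5 T"
  shows "(1 + a\<^sup>2) * T 4 5 - a * b * T 4 4 - a * b * T 1 1 - (1 + b\<^sup>2) * T 1 2 - b * x4 - a * x5
      = - (a * b) * h"
    and "(1 + a\<^sup>2) * T 5 5 - a * b * T 5 4 + (1 + a\<^sup>2) * T 1 1 + a * b * T 1 2 + 2 * a * x4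
      = (1 + a\<^sup>2) * h"
    and "a * b * T 4 5 - (1 + b\<^sup>2) * T 4 4 - a * b * T 2 1 - (1 + b\<^sup>2) * T 2 2 - 2 * b * x5
      = - (1 + b\<^sup>2) * h"
    and "a * b * T 5 5 - (1 + b\<^sup>2) * T 5 4 + (1 + a\<^sup>2) * T 2 1 + a * b * T 2 2 + b * x4 + a * x5
      = a * b * h"
  using assms by (simp_all add: cr_system_def)

text \<open>The unknown \<open>h\<close> is eliminated between the second and third mixed equation.
  The slopes 1 and -1 separate the parts even and odd in a, that is, the diagonal condition on
  \<open>pd 1 B\<close> and the relation between \<open>pd 1 A\<close> and \<open>pd 3 B\<close>.
  First derivatives of \<open>E\<close> remain unconstrained, being absorbed in
  \<open>h\<close>.\<close>

lemma first_order_relations: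
  assumes base: "base_function A" "base_function B" "base_function C" "base_function E"
  defines "X \<equiv> contact_field (contact_potential A B C E)"
  assumes cr: "\<And>p. \<exists>h. cr_system (p $ 4) (p $ 5) h (X p $ 4) (X p $ 5)
    (\<lambda>i j. dir_deriv (horizontal_frame p i) X p $ j)"
  shows "conformal_potential A B C"
proof -
  note ws = base[THEN base_function_with_slopes] base[THEN base_function_pd, THEN base_function_with_slopes]
  have "pd 1 B p = - pd 3 A p \<and> pd 2 C p = - pd 3 A p \<and> pd 1 A p = pd 3 B p
    \<and> pd 2 A p = pd 3 C p \<and> pd 2 B p = - pd 1 C p" for p
  proof -
    note calc = X_def frame_table[OF base] contact_potential_def with_slopes_nth ws normal_length_eq
    \<comment> \<open>The potentials do not depend on the slopes, so three choices of slopes suffice.\<close>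
    obtain h0 where "cr_system 0 0 h0 (X (with_slopes p 0 0) $ 4) (X (with_slopes p 0 0) $ 5)
        (\<lambda>i j. dir_deriv (horizontal_frame (with_slopes p 0 0) i) X (with_slopes p 0 0) $ j)"
      using cr[of "with_slopes p 0 0"] by (auto simp: with_slopes_nth)
    note M0 = cr_systemD_mixed[OF this, unfolded calc, simplified]
    obtain h1 where "cr_system 1 0 h1 (X (with_slopes p 1 0) $ 4) (X (with_slopes p 1 0) $ 5)
        (\<lambda>i j. dir_deriv (horizontal_frame (with_slopes p 1 0) i) X (with_slopes p 1 0) $ j)"
      using cr[of "with_slopes p 1 0"] by (auto simp: with_slopes_nth)
    note M1 = cr_systemD_mixed[OF this, unfolded calc, simplified]
    obtain h2 where "cr_system (- 1) 0 h2 (X (with_slopes p (- 1) 0) $ 4) (X (with_slopes p (- 1) 0) $ 5)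
        (\<lambda>i j. dir_deriv (horizontal_frame (with_slopes p (- 1) 0) i) X (with_slopes p (- 1) 0) $ j)"
      using cr[of "with_slopes p (- 1) 0"] by (auto simp: with_slopes_nth)
    note M2 = cr_systemD_mixed[OF this, unfolded calc, simplified]
    have 0: "pd 2 C p = pd 1 B p" using M0(2,3) by (simp add: algebra_simps)
    have 1: "pd 2 B p = - pd 1 C p" using M0(1) by (simp add: algebra_simps)
    have 2: "pd 2 A p = pd 3 C p" using M1(1) 1 by (simp add: algebra_simps)
    have 3: "pd 1 A p + pd 1 B p + pd 3 A p = pd 3 B p"
      using M1(2,3) 0 by (simp add: algebra_simps)
    have 4: "pd 3 B p + pd 1 B p + pd 3 A p = pd 1 A p"
      using M2(2,3) 0 by (simp add: algebra_simps)
    from 0 1 2 3 4 show ?thesis by simp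
  qed
  then show ?thesis by (auto simp: conformal_potential_def)
qed

text \<open>The last three conjuncts of \<open>cr_system\<close>, on pairs of lifted base vectors,
  are of second order. By \<open>conformal_potential_hessian\<close> the terms of \<open>A\<close>,
  \<open>B\<close>, \<open>C\<close> cancel there, and what is left is the trace-free part of the
  Hessian of \<open>E\<close>.\<close>

lemma second_order_relations:
  assumes base: "base_function A" "base_function B" "base_function C" "base_function E"
    and conf: "conformal_potential A B C"
  defines "X \<equiv> contact_field (contact_potential A B C E)"
  assumes cr: "\<And>p. \<exists>h. cr_system (p $ 4) (p $ 5) h (X p $ 4) (X p $ 5)
    (\<lambda>i j. dir_deriv (horizontal_frame p i) X p $ j)"
  shows "pd 1 (pd 2 E) = (\<lambda>p. 0)" "pd 1 (pd 3 E) = (\<lambda>p. 0)" "pd 2 (pd 3 E) = (\<lambda>p. 0)"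
    "pd 1 (pd 1 E) = pd 3 (pd 3 E)" "pd 2 (pd 2 E) = pd 3 (pd 3 E)"
proof -
  note ws = base[THEN base_function_with_slopes] base[THEN base_function_pd, THEN base_function_with_slopes]
    base[THEN base_function_pd, THEN base_function_pd, THEN base_function_with_slopes]
  note calc = X_def cr_system_def frame_table[OF base] contact_potential_def with_slopes_nth ws normal_length_eq
    pd_sort[OF base_functionD(1)[OF base(1)]] pd_sort[OF base_functionD(1)[OF base(2)]]
    pd_sort[OF base_functionD(1)[OF base(3)]] pd_sort[OF base_functionD(1)[OF base(4)]]
    conformal_potential_hessian[OF base(1-3) conf]
  have "pd 1 (pd 2 E) p = 0 \<and> pd 1 (pd 3 E) p = 0 \<and> pd 2 (pd 3 E) p = 0
    \<and> pd 1 (pd 1 E) p = pd 3 (pd 3 E) p \<and> pd 2 (pd 2 E) p = pd 3 (pd 3 E) p" for p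
  proof -
    have 0: "pd 1 (pd 2 E) p = 0" "pd 1 (pd 1 E) p = pd 2 (pd 2 E) p"
      using cr[of "with_slopes p 0 0"] by (auto simp: calc)
    have 1: "pd 1 (pd 3 E) p = 0"
      using cr[of "with_slopes p 0 1"] 0 by (auto simp: calc)
    have 2: "pd 2 (pd 3 E) p = 0"
      using cr[of "with_slopes p 1 0"] 0 by (auto simp: calc)
    \<comment> \<open>Since \<open>normal_length_eq\<close> has expressed r by its inverse s, the
      relation appears multiplied by the nonzero s.\<close>
    have "inv_normal_length (with_slopes p 1 0) * (2 * pd 2 (pd 2 E) p) = inv_normal_length (with_slopes p 1 0) * (2 * pd 3 (pd 3 E) p)"
      using cr[of "with_slopes p 1 0"] 0 1 2 by (auto simp: calc algebra_simps)
    with 0 1 2 show ?thesis by simp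
  qed
  then show "pd 1 (pd 2 E) = (\<lambda>p. 0)" "pd 1 (pd 3 E) = (\<lambda>p. 0)" "pd 2 (pd 3 E) = (\<lambda>p. 0)"
    "pd 1 (pd 1 E) = pd 3 (pd 3 E)" "pd 2 (pd 2 E) = pd 3 (pd 3 E)"
    by (auto simp: fun_eq_iff)
qed

text \<open>If a Hessian is a multiple of the identity, each derivative of the multiple can be
  rewritten as a third derivative that contains a mixed one, so it vanishes.\<close>

lemma second_order_affine:
  assumes base: "base_function E"
    and rel: "pd 1 (pd 2 E) = (\<lambda>p. 0)" "pd 1 (pd 3 E) = (\<lambda>p. 0)" "pd 2 (pd 3 E) = (\<lambda>p. 0)"
    "pd 1 (pd 1 E) = pd 3 (pd 3 E)" "pd 2 (pd 2 E) = pd 3 (pd 3 E)"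
  shows "pd i (pd 3 (pd 3 E)) p = 0"
proof -
  note smooth = base_functionD(1)[OF base] smooth_dir_deriv
  have "pd 1 (pd 3 (pd 3 E)) = pd 3 (pd 3 (pd 1 E))" "pd 2 (pd 3 (pd 3 E)) = pd 3 (pd 3 (pd 2 E))"
    "pd 3 (pd 1 (pd 1 E)) = pd 1 (pd 3 (pd 1 E))"
    by (simp_all add: pd_sort smooth)
  then have "pd 1 (pd 3 (pd 3 E)) p = 0" "pd 2 (pd 3 (pd 3 E)) p = 0" "pd 3 (pd 3 (pd 3 E)) p = 0"
    using rel by (simp_all add: pd_sort smooth dir_deriv_const)
  then show ?thesis
    using exhaust_5[of i] base_functionD(2,3)[OF base_function_pd[OF base_function_pd[OF base]]] by auto
qed

text \<open>Converse of the two preceding derivations. The value \<open>h\<close> is forced by the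
  conjunct with right side (1 + a^2) h; the other conjuncts then hold identically.\<close>

lemma cr_system_of_relations:
  fixes p :: "real^5"
  assumes base: "base_function A" "base_function B" "base_function C" "base_function E"
    and conf: "conformal_potential A B C"
    and rel: "pd 1 (pd 2 E) = (\<lambda>p. 0)" "pd 1 (pd 3 E) = (\<lambda>p. 0)" "pd 2 (pd 3 E) = (\<lambda>p. 0)"
    "pd 1 (pd 1 E) = pd 3 (pd 3 E)" "pd 2 (pd 2 E) = pd 3 (pd 3 E)"
  defines "X \<equiv> contact_field (contact_potential A B C E)"
  defines "h \<equiv> pd 3 A p + 2 * (p $ 4 * pd 3 B p + p $ 5 * pd 3 C p)
    + (2 * normal_length p - inv_normal_length p) * pd 3 E p + inv_normal_length p * (p $ 4 * pd 1 E p + p $ 5 * pd 2 E p)"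
  shows "cr_system (p $ 4) (p $ 5) h (X p $ 4) (X p $ 5)
    (\<lambda>i j. dir_deriv (horizontal_frame p i) X p $ j)"
proof -
  have first: "pd 1 B p = - pd 3 A p" "pd 2 C p = - pd 3 A p"
    "pd 1 A p = pd 3 B p" "pd 2 A p = pd 3 C p" "pd 2 B p = - pd 1 C p"
    using conf by (auto simp: conformal_potential_def)
  show ?thesis
    unfolding cr_system_def X_def frame_table[OF base] contact_potential_def normal_length_eq h_def
      pd_sort[OF base_functionD(1)[OF base(1)]] pd_sort[OF base_functionD(1)[OF base(2)]]
      pd_sort[OF base_functionD(1)[OF base(3)]] pd_sort[OF base_functionD(1)[OF base(4)]]
      conformal_potential_hessian[OF base(1-3) conf] rel first
    by (intro conjI; simp add: algebra_simps power2_eq_square)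
qed

text \<open>The potentials of \<open>c $ 1 *\<^sub>R X1 + \<dots> + c $ 15 *\<^sub>R X15\<close>.\<close>

definition potA :: "real^15 \<Rightarrow> real^5 \<Rightarrow> real" where
  "potA c p = c $ 1 * ((p $ 1)\<^sup>2 + (p $ 2)\<^sup>2 - (p $ 3)\<^sup>2) / 2 - c $ 2 * (p $ 1 * p $ 3)
    + c $ 3 * (p $ 2 * p $ 3) + c $ 5 * p $ 1 + c $ 6 * p $ 2 + c $ 12 * p $ 3 + c $ 15"

definition potB :: "real^15 \<Rightarrow> real^5 \<Rightarrow> real" where
  "potB c p = c $ 1 * (p $ 1 * p $ 3) - c $ 2 * ((p $ 2)\<^sup>2 + (p $ 3)\<^sup>2 - (p $ 1)\<^sup>2) / 2
    - c $ 3 * (p $ 1 * p $ 2) + c $ 5 * p $ 3 - c $ 7 * p $ 2 - c $ 12 * p $ 1 - c $ 13"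

definition potC :: "real^15 \<Rightarrow> real^5 \<Rightarrow> real" where
  "potC c p = c $ 1 * (p $ 2 * p $ 3) + c $ 2 * (p $ 1 * p $ 2)
    - c $ 3 * ((p $ 2)\<^sup>2 - (p $ 1)\<^sup>2 - (p $ 3)\<^sup>2) / 2 + c $ 6 * p $ 3 + c $ 7 * p $ 1
    - c $ 12 * p $ 2 - c $ 14"

definition potE :: "real^15 \<Rightarrow> real^5 \<Rightarrow> real" where
  "potE c p = c $ 4 * ((p $ 1)\<^sup>2 + (p $ 2)\<^sup>2 + (p $ 3)\<^sup>2) / 2 + c $ 8 * p $ 1 + c $ 9 * p $ 3
    + c $ 10 * p $ 2 + c $ 11"

lemmas pot_defs = potA_def potB_def potC_def potE_def

section \<open>The fifteen-parameter family of solutions\<close>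

lemma dir_deriv_divide_const:
  fixes f :: "'a::euclidean_space \<Rightarrow> real"
  shows "smooth f \<Longrightarrow> dir_deriv v (\<lambda>p. f p / k) = (\<lambda>p. dir_deriv v f p / k)"
  using dir_deriv_fun_rules(4)[of f "\<lambda>p. inverse k" v]
  by (simp add: smooth_const dir_deriv_const divide_inverse)

lemmas pd_calc = dir_deriv_fun_rules dir_deriv_divide_const smooth_intros pd_coordinate

lemma pd_pot:
  "pd i (potA c) = (\<lambda>p. if i = 1 then c $ 1 * p $ 1 - c $ 2 * p $ 3 + c $ 5
    else if i = 2 then c $ 1 * p $ 2 + c $ 3 * p $ 3 + c $ 6
    else if i = 3 then c $ 3 * p $ 2 - c $ 1 * p $ 3 - c $ 2 * p $ 1 + c $ 12 else 0)"
  "pd i (potB c) = (\<lambda>p. if i = 1 then c $ 1 * p $ 3 + c $ 2 * p $ 1 - c $ 3 * p $ 2 - c $ 12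
    else if i = 2 then - c $ 2 * p $ 2 - c $ 3 * p $ 1 - c $ 7
    else if i = 3 then c $ 1 * p $ 1 - c $ 2 * p $ 3 + c $ 5 else 0)"
  "pd i (potC c) = (\<lambda>p. if i = 1 then c $ 2 * p $ 2 + c $ 3 * p $ 1 + c $ 7
    else if i = 2 then c $ 1 * p $ 3 + c $ 2 * p $ 1 - c $ 3 * p $ 2 - c $ 12
    else if i = 3 then c $ 1 * p $ 2 + c $ 3 * p $ 3 + c $ 6 else 0)"
  "pd i (potE c) = (\<lambda>p. if i = 1 then c $ 4 * p $ 1 + c $ 8
    else if i = 2 then c $ 4 * p $ 2 + c $ 10
    else if i = 3 then c $ 4 * p $ 3 + c $ 9 else 0)"
  by (auto simp: pot_defs[abs_def] pd_calc)

lemma base_function_pot: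
  "base_function (potA c)" "base_function (potB c)" "base_function (potC c)" "base_function (potE c)"
  by (auto simp: base_function_def pd_pot) (auto simp: pot_defs[abs_def] smooth_intros)

text \<open>Given through its potential rather than as a combination of \<open>X1\<close> to
  \<open>X15\<close>, so that these fields need not be differentiated to show that they are
  symmetries.\<close>

definition symmetry_field :: "real^15 \<Rightarrow> (real^5) vector_field" where
  "symmetry_field c = contact_field (contact_potential (potA c) (potB c) (potC c) (potE c))"

lemma symmetry_field_eq_sum:
  "symmetry_field c = c $ 1 *\<^sub>R X1 + c $ 2 *\<^sub>R X2 + c $ 3 *\<^sub>R X3 + c $ 4 *\<^sub>R X4 + c $ 5 *\<^sub>R X5
    + c $ 6 *\<^sub>R X6 + c $ 7 *\<^sub>R X7 + c $ 8 *\<^sub>R X8 + c $ 9 *\<^sub>R X9 + c $ 10 *\<^sub>R X10 + c $ 11 *\<^sub>R X11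
    + c $ 12 *\<^sub>R X12 + c $ 13 *\<^sub>R X13 + c $ 14 *\<^sub>R X14 + c $ 15 *\<^sub>R X15"
proof
  fix p :: "real^5"
  note X = X1_def X2_def X3_def X4_def X5_def X6_def X7_def X8_def X9_def X10_def X11_def X12_def
    X13_def X14_def X15_def
  have s: "t / normal_length p = t * inv_normal_length p" for t by (simp add: inv_normal_length_def divide_inverse)
  show "symmetry_field c p = (c $ 1 *\<^sub>R X1 + c $ 2 *\<^sub>R X2 + c $ 3 *\<^sub>R X3 + c $ 4 *\<^sub>R X4
    + c $ 5 *\<^sub>R X5 + c $ 6 *\<^sub>R X6 + c $ 7 *\<^sub>R X7 + c $ 8 *\<^sub>R X8 + c $ 9 *\<^sub>R X9 + c $ 10 *\<^sub>R X10
    + c $ 11 *\<^sub>R X11 + c $ 12 *\<^sub>R X12 + c $ 13 *\<^sub>R X13 + c $ 14 *\<^sub>R X14 + c $ 15 *\<^sub>R X15) p"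
    unfolding vec_eq_iff forall_5 symmetry_field_def frame_table(1-5)[OF base_function_pot]
      plus_fun_apply scaleR_fun_def X in_coords_def normal_length_def[symmetric] s
      ddx_def ddy_def ddz_def dda_def ddb_def contact_potential_def pd_pot
    by (intro conjI; simp add: nth_axis pot_defs; simp add: field_simps power2_eq_square)
qed

lemma potential_equations_pot:
  "conformal_potential (potA c) (potB c) (potC c)"
  "pd 1 (pd 2 (potE c)) = (\<lambda>p. 0)" "pd 1 (pd 3 (potE c)) = (\<lambda>p. 0)"
  "pd 2 (pd 3 (potE c)) = (\<lambda>p. 0)"
  "pd 1 (pd 1 (potE c)) = pd 3 (pd 3 (potE c))" "pd 2 (pd 2 (potE c)) = pd 3 (pd 3 (potE c))"
  by (simp_all add: conformal_potential_def pd_pot pd_calc fun_eq_iff)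

lemma symmetry_field_mem: "symmetry_field c \<in> infinitesimal_symmetries omega0 g0"
proof -
  let ?h = "\<lambda>p. pd 3 (potA c) p + 2 * (p $ 4 * pd 3 (potB c) p + p $ 5 * pd 3 (potC c) p)
    + (2 * normal_length p - inv_normal_length p) * pd 3 (potE c) p + inv_normal_length p * (p $ 4 * pd 1 (potE c) p + p $ 5 * pd 2 (potE c) p)"
  have "smooth ?h"
    by (simp add: smooth_intros base_functionD(1)[OF base_function_pot(1)]
      base_functionD(1)[OF base_function_pot(2)] base_functionD(1)[OF base_function_pot(3)]
      base_functionD(1)[OF base_function_pot(4)])
  then show ?thesis
    unfolding infinitesimal_symmetries_iff symmetry_field_def
    using cr_system_of_relations[OF base_function_pot potential_equations_pot]
      smooth_contact_potential[OF base_function_pot] by blast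
qed

lemma vector_15:
  fixes x1 x2 x3 x4 x5 x6 x7 x8 x9 x10 x11 x12 x13 x14 x15 :: "'a::zero"
  defines "v \<equiv> (vector [x1,x2,x3,x4,x5,x6,x7,x8,x9,x10,x11,x12,x13,x14,x15] :: 'a^15)"
  shows "v $ 1 = x1" "v $ 2 = x2" "v $ 3 = x3" "v $ 4 = x4" "v $ 5 = x5" "v $ 6 = x6" "v $ 7 = x7"
    "v $ 8 = x8" "v $ 9 = x9" "v $ 10 = x10" "v $ 11 = x11" "v $ 12 = x12" "v $ 13 = x13"
    "v $ 14 = x14" "v $ 15 = x15"
  unfolding v_def vector_def by simp_all

lemma base_function_quadratic:
  assumes f: "base_function f"
    and hess: "\<And>i j p. i \<in> {1, 2, 3} \<Longrightarrow> j \<in> {1, 2, 3} \<Longrightarrow> pd i (pd j f) p = c i j"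
  shows "f p = f 0 + p $ 1 * pd 1 f 0 + p $ 2 * pd 2 f 0 + p $ 3 * pd 3 f 0
    + ((p $ 1)\<^sup>2 * c 1 1 + (p $ 2)\<^sup>2 * c 2 2 + (p $ 3)\<^sup>2 * c 3 3) / 2
    + p $ 1 * p $ 2 * c 1 2 + p $ 1 * p $ 3 * c 1 3 + p $ 2 * p $ 3 * c 2 3"
proof -
  \<comment> \<open>Extension by zero to the slope indices, where all second derivatives of a base
    function vanish.\<close>
  define d where "d i j = (if i \<in> {1, 2, 3} \<and> j \<in> {1, 2, 3} then c i j else 0)" for i j :: 5
  have z': "pd i (pd j f) p = 0" if "i = 4 \<or> i = 5 \<or> j = 4 \<or> j = 5" for i j p
    using that base_functionD[OF f] by (auto simp: dir_deriv_const)
  have "pd i (pd j f) p = d i j" for i j p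
    using hess[of i j p] z'[of i j p] exhaust_5[of i] exhaust_5[of j] by (auto simp: d_def)
  from quadratic_of_constant_hessian[OF base_functionD(1)[OF f], of d, OF this]
  have "f p = f 0 + (\<Sum>i\<in>UNIV. p $ i * pd i f 0) + (\<Sum>i\<in>UNIV. \<Sum>j\<in>UNIV. p $ i * p $ j * d i j) / 2" .
  moreover have "c 2 1 = c 1 2" "c 3 1 = c 1 3" "c 3 2 = c 2 3"
    using hess[of 2 1 0] hess[of 3 1 0] hess[of 3 2 0] hess[of 1 2 0] hess[of 1 3 0] hess[of 2 3 0]
      pd_sort[OF base_functionD(1)[OF f]] by simp_all
  ultimately show ?thesis
    using base_functionD(2,3)[OF f] by (simp add: sum_5 d_def power2_eq_square field_simps)
qed

lemma potentials_eq_pot: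
  assumes base: "base_function A" "base_function B" "base_function C" "base_function E"
    and conf: "conformal_potential A B C"
    and rel: "pd 1 (pd 2 E) = (\<lambda>p. 0)" "pd 1 (pd 3 E) = (\<lambda>p. 0)" "pd 2 (pd 3 E) = (\<lambda>p. 0)"
    "pd 1 (pd 1 E) = pd 3 (pd 3 E)" "pd 2 (pd 2 E) = pd 3 (pd 3 E)"
  shows "\<exists>c. A = potA c \<and> B = potB c \<and> C = potC c \<and> E = potE c"
proof -
  have const: "f = (\<lambda>p. f 0)" if "base_function f" "\<And>i p. pd i f p = 0" for f :: "real^5 \<Rightarrow> real"
    using eq_const_if_pd_zero[OF base_functionD(1)[OF that(1)] that(2), of _ 0] by (simp add: fun_eq_iff)
  obtain s1 s2 s3 where s: "pd 1 (pd 3 A) = (\<lambda>p. s1)" "pd 2 (pd 3 A) = (\<lambda>p. s2)"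
    "pd 3 (pd 3 A) = (\<lambda>p. s3)"
    using const[of "pd i (pd 3 A)" for i] conformal_factor_affine[OF base(1-3) conf]
      base_function_pd[OF base_function_pd[OF base(1)]] by (metis (no_types, lifting))
  obtain t where t: "pd 3 (pd 3 E) = (\<lambda>p. t)"
    using const[of "pd 3 (pd 3 E)"] second_order_affine[OF base(4) rel]
      base_function_pd[OF base_function_pd[OF base(4)]] by (metis (no_types, lifting))
  note sort = pd_sort[OF base_functionD(1)[OF base(1)]] pd_sort[OF base_functionD(1)[OF base(2)]]
    pd_sort[OF base_functionD(1)[OF base(3)]] pd_sort[OF base_functionD(1)[OF base(4)]]
  note H = conformal_potential_hessian[OF base(1-3) conf] s rel t sort
  have first: "pd 1 B p = - pd 3 A p" "pd 2 C p = - pd 3 A p"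
    "pd 1 A p = pd 3 B p" "pd 2 A p = pd 3 C p" "pd 2 B p = - pd 1 C p" for p
    using conf by (auto simp: conformal_potential_def)
  \<comment> \<open>Read off by inverting \<open>pd_pot\<close>: the first four entries from the
    constant second derivatives, the others from values and gradients at the origin.\<close>
  define c :: "real^15" where "c = vector [- s3, - s1, s2, t, pd 3 B 0, pd 3 C 0, pd 1 C 0,
    pd 1 E 0, pd 3 E 0, pd 2 E 0, E 0, pd 3 A 0, - B 0, - C 0, A 0]"
  have "A p = potA c p" for p
    by (subst base_function_quadratic[OF base(1), of "\<lambda>i j. pd i (pd j A) 0"])
      (auto simp: H first potA_def c_def vector_15 field_simps)
  moreover have "B p = potB c p" for p
    by (subst base_function_quadratic[OF base(2), of "\<lambda>i j. pd i (pd j B) 0"])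
      (auto simp: H first potB_def c_def vector_15 field_simps)
  moreover have "C p = potC c p" for p
    by (subst base_function_quadratic[OF base(3), of "\<lambda>i j. pd i (pd j C) 0"])
      (auto simp: H first potC_def c_def vector_15 field_simps)
  moreover have "E p = potE c p" for p
    by (subst base_function_quadratic[OF base(4), of "\<lambda>i j. pd i (pd j E) 0"])
      (auto simp: H potE_def c_def vector_15 field_simps)
  ultimately show ?thesis by (auto simp: fun_eq_iff)
qed

lemma symmetry_imp_symmetry_field:
  assumes "X \<in> infinitesimal_symmetries omega0 g0"
  shows "\<exists>c. X = symmetry_field c"
proof -
  obtain F h where F: "smooth F" and X: "X = contact_field F"
    and cr: "\<And>p. cr_system (p $ 4) (p $ 5) (h p) (X p $ 4) (X p $ 5)
        (\<lambda>i j. dir_deriv (horizontal_frame p i) X p $ j)"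
    using assms unfolding infinitesimal_symmetries_iff by blast
  have T: "dir_deriv (horizontal_frame p 4) X p $ 1 = - pd 4 (pd 4 F) p"
    "dir_deriv (horizontal_frame p 4) X p $ 2 = - pd 5 (pd 4 F) p"
    "dir_deriv (horizontal_frame p 5) X p $ 1 = - pd 5 (pd 4 F) p"
    "dir_deriv (horizontal_frame p 5) X p $ 2 = - pd 5 (pd 5 F) p" for p
    using dir_deriv_commute[OF F, of "axis 4 1" "axis 5 1" p]
    by (simp_all add: X frame_deriv_nth[OF smooth_contact_field[OF F]] contact_field_nth
        dir_deriv_fun_rules smooth_intros F)
  have V: "p $ 4 * p $ 5 * pd 4 (pd 4 F) p + (1 + (p $ 5)\<^sup>2) * pd 5 (pd 4 F) p = 0"
    "(1 + (p $ 4)\<^sup>2) * pd 5 (pd 4 F) p + p $ 4 * p $ 5 * pd 5 (pd 5 F) p = 0"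
    "(1 + (p $ 4)\<^sup>2) * pd 4 (pd 4 F) p = (1 + (p $ 5)\<^sup>2) * pd 5 (pd 5 F) p" for p
    using cr[of p] unfolding cr_system_def T by (auto simp: algebra_simps)
  obtain A B C E where base: "base_function A" "base_function B" "base_function C" "base_function E"
    and F_eq: "F = contact_potential A B C E"
    using potential_of_vertical_equations[OF F V] by metis
  have cr': "\<exists>h. cr_system (p $ 4) (p $ 5) h (contact_field (contact_potential A B C E) p $ 4)
      (contact_field (contact_potential A B C E) p $ 5)
      (\<lambda>i j. dir_deriv (horizontal_frame p i) (contact_field (contact_potential A B C E)) p $ j)" for p
    using cr[of p] unfolding X F_eq by blast
  have conf: "conformal_potential A B C" by (rule first_order_relations[OF base cr'])
  show ?thesis
    using potentials_eq_pot[OF base conf second_order_relations[OF base conf cr']]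
    by (auto simp: X F_eq symmetry_field_def)
qed

lemma infinitesimal_symmetries_eq:
  "infinitesimal_symmetries omega0 g0 = range symmetry_field"
  using symmetry_field_mem symmetry_imp_symmetry_field by (auto simp: image_def)

section \<open>Twistors and \<open>su(2,2)\<close>\<close>

lemma lie_bracket_eq: "lie_bracket X Y p = dir_deriv (X p) Y p - dir_deriv (Y p) X p"
  by (simp add: lie_bracket_def dir_deriv_def)

lemma dir_deriv_sum:
  "(\<And>i. i \<in> I \<Longrightarrow> smooth (f i)) \<Longrightarrow> dir_deriv v (\<lambda>p. \<Sum>i\<in>I. f i p) p = (\<Sum>i\<in>I. dir_deriv v (f i) p)"
  by (induction I rule: infinite_finite_induct) (simp_all add: dir_deriv_const dir_deriv_add smooth_sum)

text \<open>Splits off the variation of \<open>Y\<close>. The other term is symmetric in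
  \<open>w\<close> and \<open>Y p\<close>, so it drops out of the bracket formula that
  follows.\<close>

lemma dir_deriv_along_field:
  fixes f :: "real^'n \<Rightarrow> 'b::real_normed_vector"
  assumes f: "smooth f" and Y: "smooth Y"
  shows "dir_deriv w (\<lambda>q. dir_deriv (Y q) f q) p
    = dir_deriv w (dir_deriv (Y p) f) p + dir_deriv (dir_deriv w Y p) f p"
proof -
  note s = smooth_nth[OF Y] smooth_dir_deriv[OF f] smooth_const
  have "(\<lambda>q. dir_deriv (Y q) f q) = (\<lambda>q. \<Sum>i\<in>UNIV. Y q $ i *\<^sub>R pd i f q)"
    by (rule ext) (rule dir_deriv_eq_sum[OF f])
  then have "dir_deriv w (\<lambda>q. dir_deriv (Y q) f q) p
      = (\<Sum>i\<in>UNIV. Y p $ i *\<^sub>R dir_deriv w (pd i f) p + dir_deriv w Y p $ i *\<^sub>R pd i f p)"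
    by (simp add: dir_deriv_sum smooth_scaleR s dir_deriv_scaleR dir_deriv_nth[OF Y])
  moreover have "dir_deriv (Y p) f = (\<lambda>q. \<Sum>i\<in>UNIV. Y p $ i *\<^sub>R pd i f q)"
    by (rule ext) (rule dir_deriv_eq_sum[OF f])
  then have "dir_deriv w (dir_deriv (Y p) f) p = (\<Sum>i\<in>UNIV. Y p $ i *\<^sub>R dir_deriv w (pd i f) p)"
    by (simp add: dir_deriv_sum smooth_scaleR s dir_deriv_scaleR dir_deriv_const)
  ultimately show ?thesis
    by (simp add: sum.distrib dir_deriv_eq_sum[OF f, of "dir_deriv w Y p"])
qed

lemma dir_deriv_lie_bracket:
  fixes f :: "real^'n \<Rightarrow> 'b::euclidean_space"
  assumes f: "smooth f" and X: "smooth X" and Y: "smooth Y"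
  shows "dir_deriv (lie_bracket X Y p) f p
    = dir_deriv (X p) (\<lambda>q. dir_deriv (Y q) f q) p - dir_deriv (Y p) (\<lambda>q. dir_deriv (X q) f q) p"
  by (simp add: lie_bracket_eq linear_diff[OF linear_dir_deriv[OF f]] dir_deriv_along_field[OF f X]
      dir_deriv_along_field[OF f Y] dir_deriv_commute[OF f, of "X p"])

text \<open>In the coordinates Z used for \<open>twistor\<close> below this is the third one,
  normalised there to 1.\<close>

definition height :: "complex^4 \<Rightarrow> complex" where
  "height w = (w $ 1 - w $ 3) / 2"

text \<open>The linear vector field \<open>A\<close>, corrected by a multiple of the radial field so as to be tangent
  to the slice \<open>height = 1\<close>, which is an affine chart of projective 3-space.\<close>

definition slice_field :: "complex^4^4 \<Rightarrow> complex^4 \<Rightarrow> complex^4" where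
  "slice_field A w = A *v w - height (A *v w) *s w"

definition intertwines ::
  "(real^5 \<Rightarrow> complex^4) \<Rightarrow> (real^5) vector_field \<Rightarrow> complex^4^4 \<Rightarrow> bool" where
  "intertwines T X A \<longleftrightarrow> (\<forall>p. dir_deriv (X p) T p = slice_field A (T p))"

lemma bounded_linear_height: "bounded_linear height"
  unfolding height_def[abs_def]
  by (intro bounded_linear_divide[THEN bounded_linear_compose] bounded_linear_sub
      bounded_linear_vec_nth)

lemma matrix_vector_mult_scale: "A *v (c *s w) = c *s (A *v (w :: complex^'n))"
  by (simp add: vec_eq_iff matrix_vector_mult_def sum_distrib_left ac_simps)

text \<open>Apart from the two terms in \<open>B ** A\<close>, the right side is symmetric in
  \<open>A\<close> and \<open>B\<close>; hence only the commutator survives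
  antisymmetrisation.\<close>

lemma dir_deriv_slice_field:
  assumes T: "smooth T" and p: "dir_deriv v T p = slice_field A (T p)"
  shows "dir_deriv v (\<lambda>q. slice_field B (T q)) p
    = (B ** A) *v T p - height ((B ** A) *v T p) *s T p - height (A *v T p) *s (B *v T p)
      - height (B *v T p) *s (A *v T p) + (2 * height (A *v T p) * height (B *v T p)) *s T p"
proof -
  note BT = smooth_linear[OF matrix_vector_mul_bounded_linear T, of B]
  note hBT = smooth_linear[OF bounded_linear_height BT]
  have h: "height (x - y) = height x - height y" "height (c *s x) = c * height x" for x y c
    by (simp_all add: height_def field_simps)
  have DB: "dir_deriv v (\<lambda>q. B *v T q) p = (B ** A) *v T p - height (A *v T p) *s (B *v T p)"
    by (simp add: dir_deriv_linear[OF matrix_vector_mul_bounded_linear T] p slice_field_def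
        matrix_vector_mult_diff_distrib matrix_vector_mult_scale matrix_vector_mul_assoc)
  have Dh: "dir_deriv v (\<lambda>q. height (B *v T q)) p
      = height ((B ** A) *v T p) - height (A *v T p) * height (B *v T p)"
    by (simp add: dir_deriv_linear[OF bounded_linear_height BT] DB h)
  have smooth: "smooth (\<lambda>q. slice_field B (T q))"
    unfolding smooth_vec_iff by (simp add: slice_field_def smooth_intros BT hBT T)
  have "dir_deriv v (\<lambda>q. slice_field B (T q)) p $ i = dir_deriv v (\<lambda>q. B *v T q) p $ i
      - (height (B *v T p) * dir_deriv v T p $ i
        + dir_deriv v (\<lambda>q. height (B *v T q)) p * T p $ i)" for i
  proof -
    have "dir_deriv v (\<lambda>q. slice_field B (T q)) p $ i
        = dir_deriv v (\<lambda>q. (B *v T q) $ i - height (B *v T q) * T q $ i) p"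
      by (subst dir_deriv_nth[OF smooth, symmetric]) (simp add: slice_field_def)
    also have "\<dots> = dir_deriv v (\<lambda>q. B *v T q) p $ i
      - (height (B *v T p) * dir_deriv v T p $ i
        + dir_deriv v (\<lambda>q. height (B *v T q)) p * T p $ i)"
      by (simp add: dir_deriv_diff dir_deriv_mult smooth_intros BT hBT T dir_deriv_nth)
    finally show ?thesis .
  qed
  then show ?thesis
    by (simp add: vec_eq_iff DB Dh p slice_field_def algebra_simps)
qed

text \<open>Differentiating the field of \<open>B\<close> along that of \<open>A\<close> puts
  \<open>A\<close> on the right, whence the reversed order in the commutator.\<close>

lemma intertwines_lie_bracket:
  assumes T: "smooth T" and X: "smooth X" and Y: "smooth Y"
    and A: "intertwines T X A" and B: "intertwines T Y B"
  shows "intertwines T (lie_bracket X Y) (commutator B A)"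
proof -
  have "dir_deriv (lie_bracket X Y p) T p = slice_field (commutator B A) (T p)" for p
  proof -
    have DX: "(\<lambda>q. dir_deriv (X q) T q) = (\<lambda>q. slice_field A (T q))"
      and DY: "(\<lambda>q. dir_deriv (Y q) T q) = (\<lambda>q. slice_field B (T q))"
      using A B by (auto simp: intertwines_def)
    have h: "height (x - y) = height x - height y" for x y by (simp add: height_def field_simps)
    have "slice_field (commutator B A) (T p) = (B ** A) *v T p - height ((B ** A) *v T p) *s T p
        - ((A ** B) *v T p - height ((A ** B) *v T p) *s T p)"
      by (simp add: slice_field_def commutator_def matrix_vector_mult_diff_rdistrib h vec_eq_iff
          algebra_simps)
    moreover have XY: "dir_deriv (X p) T p = slice_field A (T p)" "dir_deriv (Y p) T p = slice_field B (T p)"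
      using A B by (auto simp: intertwines_def)
    ultimately show ?thesis
      unfolding dir_deriv_lie_bracket[OF T X Y] DX DY
      by (simp add: dir_deriv_slice_field[OF T XY(1)] dir_deriv_slice_field[OF T XY(2)] vec_eq_iff algebra_simps)
  qed
  then show ?thesis by (simp add: intertwines_def)
qed

lemma intertwines_linear:
  assumes T: "smooth T" and "intertwines T X A" "intertwines T Y B"
  shows "intertwines T (\<lambda>p. r *\<^sub>R X p + s *\<^sub>R Y p) (r *\<^sub>R A + s *\<^sub>R B)"
  using assms(2,3) unfolding intertwines_def
  by (simp add: linear_add[OF linear_dir_deriv[OF T]] linear_scale[OF linear_dir_deriv[OF T]])
    (simp add: slice_field_def height_def vec_eq_iff matrix_vector_mult_def sum_4
      scaleR_conv_of_real[where 'a = complex]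
      field_simps)

section \<open>The embedding by twistors\<close>

definition stereo_factor :: "real^5 \<Rightarrow> real" where "stereo_factor p = inverse (1 + normal_length p)"

text \<open>Half-angle coordinates of the unit normal, up to sign. They make r rational: twice
  \<open>stereo_factor\<close> is 1 minus the squares of \<open>stereo_a\<close> and
  \<open>stereo_b\<close>.\<close>

definition stereo_a :: "real^5 \<Rightarrow> real" where "stereo_a p = p $ 4 * stereo_factor p"

definition stereo_b :: "real^5 \<Rightarrow> real" where "stereo_b p = p $ 5 * stereo_factor p"

lemma stereo_factor_normal_length: "stereo_factor p * (1 + normal_length p) = 1"
  using normal_length_pos[of p] by (simp add: stereo_factor_def)

lemma smooth_stereo_factor [smooth_intros]: "smooth stereo_factor"
proof -
  have "1 + normal_length p \<noteq> 0" for p using normal_length_pos[of p] by simp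
  then show ?thesis unfolding stereo_factor_def[abs_def] by (simp add: smooth_intros)
qed

lemma smooth_stereo_a [smooth_intros]: "smooth stereo_a" and smooth_stereo_b [smooth_intros]: "smooth stereo_b"
  unfolding stereo_a_def[abs_def] stereo_b_def[abs_def] by (simp_all add: smooth_intros)

lemma dir_deriv_normal_length: "dir_deriv v normal_length p = (p $ 4 * v $ 4 + p $ 5 * v $ 5) * inv_normal_length p"
  by (simp add: dir_deriv_eq_sum[OF smooth_normal_length, of v] sum_5 pd_normal_length algebra_simps)

lemma dir_deriv_stereo_factor: "dir_deriv v stereo_factor p = - (stereo_factor p)\<^sup>2 * ((p $ 4 * v $ 4 + p $ 5 * v $ 5) * inv_normal_length p)"
proof -
  have "dir_deriv v (\<lambda>q. stereo_factor q * (1 + normal_length q)) p = 0" by (simp add: stereo_factor_normal_length dir_deriv_const)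
  then have "stereo_factor p * dir_deriv v normal_length p + dir_deriv v stereo_factor p * (1 + normal_length p) = 0"
    by (simp add: dir_deriv_fun_rules smooth_intros)
  then show ?thesis unfolding dir_deriv_normal_length using stereo_factor_normal_length[of p] by algebra
qed

lemma dir_deriv_stereo_a: "dir_deriv v stereo_a p
    = v $ 4 * stereo_factor p - p $ 4 * (stereo_factor p)\<^sup>2 * ((p $ 4 * v $ 4 + p $ 5 * v $ 5) * inv_normal_length p)"
  and dir_deriv_stereo_b: "dir_deriv v stereo_b p
    = v $ 5 * stereo_factor p - p $ 5 * (stereo_factor p)\<^sup>2 * ((p $ 4 * v $ 4 + p $ 5 * v $ 5) * inv_normal_length p)"
  unfolding stereo_a_def[abs_def] stereo_b_def[abs_def]
  by (simp_all add: dir_deriv_fun_rules smooth_intros dir_deriv_stereo_factor dir_deriv_coordinate)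

text \<open>With \<open>\<zeta> = - (stereo_a + \<i> stereo_b)\<close>, the stereographic image of the unit normal, the vectors
  \<open>Z = (\<i> (z + (x - \<i> y) \<zeta>), \<i> (x + \<i> y - z \<zeta>), 1, \<zeta>)\<close> are isotropic for the Hermitian form
  \<open>Re (Z\<^sub>1 cnj Z\<^sub>3 + Z\<^sub>2 cnj Z\<^sub>4)\<close>. The components below are \<open>Z\<^sub>1 \<plusminus> Z\<^sub>3\<close> and \<open>Z\<^sub>2 \<plusminus> Z\<^sub>4\<close>, which
  brings the form to \<open>I22\<close>.\<close>

definition twistor :: "real^5 \<Rightarrow> complex^4" where
  "twistor p = vector
    [Complex (p $ 1 * stereo_b p - p $ 2 * stereo_a p + 1) (p $ 3 - p $ 1 * stereo_a p - p $ 2 * stereo_b p),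
     Complex (- p $ 2 - p $ 3 * stereo_b p - stereo_a p) (p $ 1 + p $ 3 * stereo_a p - stereo_b p),
     Complex (p $ 1 * stereo_b p - p $ 2 * stereo_a p - 1) (p $ 3 - p $ 1 * stereo_a p - p $ 2 * stereo_b p),
     Complex (- p $ 2 - p $ 3 * stereo_b p + stereo_a p) (p $ 1 + p $ 3 * stereo_a p + stereo_b p)]"

lemma vector_4:
  "(vector [x1, x2, x3, x4] :: 'a::zero^4) $ 1 = x1" "(vector [x1, x2, x3, x4] :: 'a::zero^4) $ 2 = x2"
  "(vector [x1, x2, x3, x4] :: 'a::zero^4) $ 3 = x3" "(vector [x1, x2, x3, x4] :: 'a::zero^4) $ 4 = x4"
  unfolding vector_def by simp_all

lemma smooth_Complex [smooth_intros]: "smooth f \<Longrightarrow> smooth g \<Longrightarrow> smooth (\<lambda>p. Complex (f p) (g p))"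
  by (simp add: Complex_eq smooth_intros)

lemma smooth_twistor [smooth_intros]: "smooth twistor"
  by (simp add: smooth_vec_iff forall_4 twistor_def vector_4 smooth_intros)

lemma dir_deriv_Complex:
  assumes "smooth f" "smooth g"
  shows "dir_deriv v (\<lambda>p. Complex (f p) (g p)) p = Complex (dir_deriv v f p) (dir_deriv v g p)"
  by (rule complex_eqI)
    (simp_all flip: dir_deriv_linear[OF bounded_linear_Re smooth_Complex[OF assms]]
      dir_deriv_linear[OF bounded_linear_Im smooth_Complex[OF assms]])

lemma dir_deriv_twistor:
  defines "D v p f \<equiv> dir_deriv v f p"
  shows "dir_deriv v twistor p = vector
    [Complex (v $ 1 * stereo_b p - v $ 2 * stereo_a p + p $ 1 * D v p stereo_b - p $ 2 * D v p stereo_a)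
       (v $ 3 - v $ 1 * stereo_a p - v $ 2 * stereo_b p - p $ 1 * D v p stereo_a - p $ 2 * D v p stereo_b),
     Complex (- v $ 2 - v $ 3 * stereo_b p - p $ 3 * D v p stereo_b - D v p stereo_a)
       (v $ 1 + v $ 3 * stereo_a p + p $ 3 * D v p stereo_a - D v p stereo_b),
     Complex (v $ 1 * stereo_b p - v $ 2 * stereo_a p + p $ 1 * D v p stereo_b - p $ 2 * D v p stereo_a)
       (v $ 3 - v $ 1 * stereo_a p - v $ 2 * stereo_b p - p $ 1 * D v p stereo_a - p $ 2 * D v p stereo_b),
     Complex (- v $ 2 - v $ 3 * stereo_b p - p $ 3 * D v p stereo_b + D v p stereo_a)
       (v $ 1 + v $ 3 * stereo_a p + p $ 3 * D v p stereo_a + D v p stereo_b)]"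
proof -
  have "dir_deriv v twistor p $ i = dir_deriv v (\<lambda>q. twistor q $ i) p" for i
    by (rule dir_deriv_nth[OF smooth_twistor, symmetric])
  then show ?thesis
    unfolding vec_eq_iff forall_4 D_def
    by (simp add: twistor_def vector_4 dir_deriv_Complex dir_deriv_fun_rules smooth_intros
        dir_deriv_coordinate)
qed

text \<open>Components 2 and 4 differ by the stereographic coordinates, so the derivatives of these
  vanish. What remains is a linear system for the base part of \<open>v\<close> with determinant 1 +
  u^2 + w^2, u and w being \<open>stereo_a\<close> and \<open>stereo_b\<close>, and then one for the
  slope part.\<close>

lemma twistor_immersion:
  assumes "dir_deriv v twistor p = 0"
  shows "v = 0"
proof -
  let ?a = "dir_deriv v stereo_a p" and ?b = "dir_deriv v stereo_b p"
  let ?k = "p $ 4 * v $ 4 + p $ 5 * v $ 5"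
  note 0 = assms[unfolded dir_deriv_twistor vec_eq_iff forall_4 vector_4 complex_eq_iff, simplified]
  have ab: "?a = 0" "?b = 0" using 0 by auto
  have v: "v $ 3 - v $ 1 * stereo_a p - v $ 2 * stereo_b p = 0" "- v $ 2 - v $ 3 * stereo_b p = 0"
    "v $ 1 + v $ 3 * stereo_a p = 0"
    using 0 ab by auto
  then have "v $ 3 * (1 + (stereo_a p)\<^sup>2 + (stereo_b p)\<^sup>2) = 0" by algebra
  moreover have "1 + (stereo_a p)\<^sup>2 + (stereo_b p)\<^sup>2 > 0" by (intro add_pos_nonneg) auto
  ultimately have v3: "v $ 3 = 0" by simp
  \<comment> \<open>The two derivatives are combined with weights a and b. Cancelling the
    stereographic factor leaves k = k - k / r, hence k = 0.\<close>
  have "stereo_factor p * ?k = (stereo_factor p)\<^sup>2 * ((normal_length p)\<^sup>2 - 1) * (?k * inv_normal_length p)"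
    using ab[unfolded dir_deriv_stereo_a dir_deriv_stereo_b] normal_length_power2[of p] by algebra
  then have "?k = 0" using stereo_factor_normal_length[of p] normal_length_inv_normal_length[of p] by algebra
  moreover have "stereo_factor p \<noteq> 0" using stereo_factor_normal_length[of p] by auto
  ultimately have "v $ 4 = 0" "v $ 5 = 0" using ab[unfolded dir_deriv_stereo_a dir_deriv_stereo_b] by auto
  with v v3 show ?thesis by (simp add: vec_eq_iff forall_5)
qed

text \<open>In the coordinates Z of \<open>twistor\<close>, the fields \<open>X11\<close>,
  \<open>X13\<close>, \<open>X14\<close>, \<open>X15\<close> map the plane of (Z3, Z4) to that of
  (Z1, Z2), \<open>X1\<close> to \<open>X4\<close> map it back, and the other seven preserve both
  planes. Passing to Z1 + Z3, Z1 - Z3 and Z2 + Z4, Z2 - Z4 spreads each block over the whole matrix;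
  the quarters arise from this change of basis and the 1/2 in the quadratic fields.\<close>

definition symmetry_matrix :: "real^15 \<Rightarrow> complex^4^4" where
  "symmetry_matrix c = vector [
    vector [Complex 0 (- c $ 1 / 4 + c $ 4 / 4 + c $ 7 / 2 + c $ 11 / 2 + c $ 15 / 2),
      Complex (c $ 3 / 4 + c $ 5 / 2 + c $ 14 / 2) (- c $ 2 / 4 - c $ 6 / 2 + c $ 13 / 2),
      Complex (c $ 9 / 2 + c $ 12 / 2) (- c $ 1 / 4 + c $ 4 / 4 - c $ 11 / 2 - c $ 15 / 2),
      Complex (c $ 3 / 4 + c $ 8 / 2 - c $ 14 / 2) (- c $ 2 / 4 - c $ 10 / 2 - c $ 13 / 2)],
    vector [Complex (- c $ 3 / 4 - c $ 5 / 2 - c $ 14 / 2) (- c $ 2 / 4 - c $ 6 / 2 + c $ 13 / 2),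
      Complex 0 (c $ 1 / 4 + c $ 4 / 4 - c $ 7 / 2 + c $ 11 / 2 - c $ 15 / 2),
      Complex (- c $ 3 / 4 + c $ 8 / 2 + c $ 14 / 2) (- c $ 2 / 4 + c $ 10 / 2 - c $ 13 / 2),
      Complex (- c $ 9 / 2 + c $ 12 / 2) (c $ 1 / 4 + c $ 4 / 4 - c $ 11 / 2 + c $ 15 / 2)],
    vector [Complex (c $ 9 / 2 + c $ 12 / 2) (c $ 1 / 4 - c $ 4 / 4 + c $ 11 / 2 + c $ 15 / 2),
      Complex (- c $ 3 / 4 + c $ 8 / 2 + c $ 14 / 2) (c $ 2 / 4 - c $ 10 / 2 + c $ 13 / 2),
      Complex 0 (c $ 1 / 4 - c $ 4 / 4 + c $ 7 / 2 - c $ 11 / 2 - c $ 15 / 2),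
      Complex (- c $ 3 / 4 + c $ 5 / 2 - c $ 14 / 2) (c $ 2 / 4 - c $ 6 / 2 - c $ 13 / 2)],
    vector [Complex (c $ 3 / 4 + c $ 8 / 2 - c $ 14 / 2) (c $ 2 / 4 + c $ 10 / 2 + c $ 13 / 2),
      Complex (- c $ 9 / 2 + c $ 12 / 2) (- c $ 1 / 4 - c $ 4 / 4 + c $ 11 / 2 - c $ 15 / 2),
      Complex (c $ 3 / 4 - c $ 5 / 2 + c $ 14 / 2) (c $ 2 / 4 - c $ 6 / 2 - c $ 13 / 2),
      Complex 0 (- c $ 1 / 4 - c $ 4 / 4 - c $ 7 / 2 - c $ 11 / 2 + c $ 15 / 2)]]"

lemma Re_Im_slice_field:
  fixes A :: "complex^4^4" and w :: "complex^4"
  defines "P k \<equiv> Re (A $ k $ 1) * Re (w $ 1) - Im (A $ k $ 1) * Im (w $ 1)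
      + Re (A $ k $ 2) * Re (w $ 2) - Im (A $ k $ 2) * Im (w $ 2)
      + Re (A $ k $ 3) * Re (w $ 3) - Im (A $ k $ 3) * Im (w $ 3)
      + Re (A $ k $ 4) * Re (w $ 4) - Im (A $ k $ 4) * Im (w $ 4)"
    and "Q k \<equiv> Re (A $ k $ 1) * Im (w $ 1) + Im (A $ k $ 1) * Re (w $ 1)
      + Re (A $ k $ 2) * Im (w $ 2) + Im (A $ k $ 2) * Re (w $ 2)
      + Re (A $ k $ 3) * Im (w $ 3) + Im (A $ k $ 3) * Re (w $ 3)
      + Re (A $ k $ 4) * Im (w $ 4) + Im (A $ k $ 4) * Re (w $ 4)"
  shows "Re (slice_field A w $ k)
      = P k - ((P 1 - P 3) / 2 * Re (w $ k) - (Q 1 - Q 3) / 2 * Im (w $ k))"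
    and "Im (slice_field A w $ k)
      = Q k - ((P 1 - P 3) / 2 * Im (w $ k) + (Q 1 - Q 3) / 2 * Re (w $ k))"
proof -
  have "(A *v w) $ k = Complex (P k) (Q k)" for k
    by (simp add: complex_eq_iff matrix_vector_mult_def sum_4 P_def Q_def)
  then show "Re (slice_field A w $ k)
      = P k - ((P 1 - P 3) / 2 * Re (w $ k) - (Q 1 - Q 3) / 2 * Im (w $ k))"
    and "Im (slice_field A w $ k)
      = Q k - ((P 1 - P 3) / 2 * Im (w $ k) + (Q 1 - Q 3) / 2 * Re (w $ k))"
    by (simp_all add: slice_field_def height_def add_divide_distrib diff_divide_distrib left_diff_distrib)
qed

lemma exhaust_15:
  fixes k :: 15
  shows "k = 1 \<or> k = 2 \<or> k = 3 \<or> k = 4 \<or> k = 5 \<or> k = 6 \<or> k = 7 \<or> k = 8 \<or> k = 9 \<or> k = 10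
    \<or> k = 11 \<or> k = 12 \<or> k = 13 \<or> k = 14 \<or> k = 15"
proof (induct k)
  case (of_int z)
  then have "z = 0 \<or> z = 1 \<or> z = 2 \<or> z = 3 \<or> z = 4 \<or> z = 5 \<or> z = 6 \<or> z = 7 \<or> z = 8 \<or> z = 9
    \<or> z = 10 \<or> z = 11 \<or> z = 12 \<or> z = 13 \<or> z = 14" by simp arith
  then show ?case by (elim disjE) simp_all
qed

text \<open>Both sides are linear in the coefficient vector; treating the unit vectors separately keeps the
  polynomial identities small.\<close>

lemma intertwines_symmetry_field_axis:
  "intertwines twistor (symmetry_field (axis k 1)) (symmetry_matrix (axis k 1))"
proof -
  define c :: "real^15" where "c = axis k 1"
  have "dir_deriv (symmetry_field c p) twistor p = slice_field (symmetry_matrix c) (twistor p)" for p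
  proof -
    let ?v = "symmetry_field c p"
    define x y z a b s t A B C E u w where "x = p $ 1" and "y = p $ 2" and "z = p $ 3"
      and "a = p $ 4" and "b = p $ 5" and "s = inv_normal_length p" and "t = stereo_factor p"
      and "A = potA c p" and "B = potB c p" and "C = potC c p" and "E = potE c p"
      and "u = stereo_a p" and "w = stereo_b p"
    note pd = frame_table(1-5)[OF base_function_pot[of c], of p, folded symmetry_field_def]
    have r: "normal_length p * s = 1" "(normal_length p)\<^sup>2 = a\<^sup>2 + b\<^sup>2 + 1" "t * (1 + normal_length p) = 1" "u = a * t" "w = b * t"
      using normal_length_inv_normal_length[of p] normal_length_power2[of p] stereo_factor_normal_length[of p] by (simp_all add: s_def a_def b_def t_def u_def w_def stereo_a_def stereo_b_def)
    have v: "?v $ 1 = - B - E * a * s" "?v $ 2 = - C - E * b * s" "?v $ 3 = A + E * s"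
      by (simp_all add: pd A_def B_def C_def E_def a_def b_def s_def)
    \<comment> \<open>These are the combinations of base components that enter the derivative of
      \<open>twistor\<close>; in them the root cancels.\<close>
    have h: "?v $ 1 * w - ?v $ 2 * u = C * u - B * w"
      "?v $ 3 - ?v $ 1 * u - ?v $ 2 * w = A + B * u + C * w + E"
      "- ?v $ 2 - ?v $ 3 * w = C - A * w + E * w"
      "?v $ 1 + ?v $ 3 * u = A * u - B - E * u"
      unfolding v using r by algebra+
    define B2 B3 C3 E1 E2 E3 where "B2 = pd 2 (potB c) p" and "B3 = pd 3 (potB c) p"
      and "C3 = pd 3 (potC c) p" and "E1 = pd 1 (potE c) p" and "E2 = pd 2 (potE c) p"
      and "E3 = pd 3 (potE c) p"
    define A3 where "A3 = pd 3 (potA c) p"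
    have rel: "pd 1 (potA c) p = B3" "pd 2 (potA c) p = C3" "pd 1 (potB c) p = - A3"
      "pd 2 (potC c) p = - A3" "pd 1 (potC c) p = - B2"
      by (simp_all add: pd_pot A3_def B3_def C3_def B2_def)
    have v45: "?v $ 4 = (1 + a\<^sup>2) * B3 + a * b * C3 - b * B2 + normal_length p * E1 + a * normal_length p * E3"
      "?v $ 5 = (1 + b\<^sup>2) * C3 + a * b * B3 + a * B2 + normal_length p * E2 + b * normal_length p * E3"
      unfolding pd contact_potential_def rel a_def[symmetric] b_def[symmetric]
        A3_def[symmetric] B3_def[symmetric] C3_def[symmetric] B2_def[symmetric]
        E1_def[symmetric] E2_def[symmetric] E3_def[symmetric]
      by algebra+
    have k: "(a * ?v $ 4 + b * ?v $ 5) * s = normal_length p * (a * B3 + b * C3)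
        + (a * E1 + b * E2 + ((normal_length p)\<^sup>2 - 1) * E3)"
      unfolding v45 using r(1,2) by algebra
    have d: "dir_deriv ?v stereo_a p = (1 + u\<^sup>2 - w\<^sup>2) / 2 * B3 + u * w * C3 - w * B2
        + (1 - u\<^sup>2 + w\<^sup>2) / 2 * E1 - u * w * E2 + u * E3"
      "dir_deriv ?v stereo_b p = (1 - u\<^sup>2 + w\<^sup>2) / 2 * C3 + u * w * B3 + u * B2
        + (1 + u\<^sup>2 - w\<^sup>2) / 2 * E2 - u * w * E1 + w * E3"
    proof -
      \<comment> \<open>Eliminates the remaining factor \<open>t\<close>, so that the slope
        components too become polynomial in \<open>u\<close> and \<open>w\<close>.\<close>
      have t2: "2 * t = 1 - u\<^sup>2 - w\<^sup>2" using r by algebra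
      have "2 * dir_deriv ?v stereo_a p = (1 + u\<^sup>2 - w\<^sup>2) * B3 + 2 * u * w * C3 - 2 * w * B2
          + (1 - u\<^sup>2 + w\<^sup>2) * E1 - 2 * u * w * E2 + 2 * u * E3"
        unfolding dir_deriv_stereo_a a_def[symmetric] b_def[symmetric] s_def[symmetric] t_def[symmetric]
          k unfolding v45 using r(2-5) t2 by algebra
      moreover have "2 * dir_deriv ?v stereo_b p = (1 - u\<^sup>2 + w\<^sup>2) * C3 + 2 * u * w * B3 + 2 * u * B2
          + (1 + u\<^sup>2 - w\<^sup>2) * E2 - 2 * u * w * E1 + 2 * w * E3"
        unfolding dir_deriv_stereo_b a_def[symmetric] b_def[symmetric] s_def[symmetric] t_def[symmetric]
          k unfolding v45 using r(2-5) t2 by algebra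
      ultimately show "dir_deriv ?v stereo_a p = (1 + u\<^sup>2 - w\<^sup>2) / 2 * B3 + u * w * C3 - w * B2
        + (1 - u\<^sup>2 + w\<^sup>2) / 2 * E1 - u * w * E2 + u * E3"
        "dir_deriv ?v stereo_b p = (1 - u\<^sup>2 + w\<^sup>2) / 2 * C3 + u * w * B3 + u * B2
        + (1 + u\<^sup>2 - w\<^sup>2) / 2 * E2 - u * w * E1 + w * E3"
        by (simp_all add: field_simps)
    qed
    have D: "dir_deriv ?v twistor p = vector
      [Complex (C * u - B * w + x * dir_deriv ?v stereo_b p - y * dir_deriv ?v stereo_a p)
         (A + B * u + C * w + E - x * dir_deriv ?v stereo_a p - y * dir_deriv ?v stereo_b p),
       Complex (C - A * w + E * w - z * dir_deriv ?v stereo_b p - dir_deriv ?v stereo_a p)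
         (A * u - B - E * u + z * dir_deriv ?v stereo_a p - dir_deriv ?v stereo_b p),
       Complex (C * u - B * w + x * dir_deriv ?v stereo_b p - y * dir_deriv ?v stereo_a p)
         (A + B * u + C * w + E - x * dir_deriv ?v stereo_a p - y * dir_deriv ?v stereo_b p),
       Complex (C - A * w + E * w - z * dir_deriv ?v stereo_b p + dir_deriv ?v stereo_a p)
         (A * u - B - E * u + z * dir_deriv ?v stereo_a p + dir_deriv ?v stereo_b p)]"
      unfolding dir_deriv_twistor h[symmetric] by (simp add: x_def y_def z_def u_def w_def)
    have pot: "A = c $ 1 * (x\<^sup>2 + y\<^sup>2 - z\<^sup>2) / 2 - c $ 2 * (x * z) + c $ 3 * (y * z)
        + c $ 5 * x + c $ 6 * y + c $ 12 * z + c $ 15"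
      "B = c $ 1 * (x * z) - c $ 2 * (y\<^sup>2 + z\<^sup>2 - x\<^sup>2) / 2 - c $ 3 * (x * y) + c $ 5 * z
        - c $ 7 * y - c $ 12 * x - c $ 13"
      "C = c $ 1 * (y * z) + c $ 2 * (x * y) - c $ 3 * (y\<^sup>2 - x\<^sup>2 - z\<^sup>2) / 2 + c $ 6 * z
        + c $ 7 * x - c $ 12 * y - c $ 14"
      "E = c $ 4 * (x\<^sup>2 + y\<^sup>2 + z\<^sup>2) / 2 + c $ 8 * x + c $ 9 * z + c $ 10 * y + c $ 11"
      by (simp_all add: A_def B_def C_def E_def pot_defs x_def y_def z_def)
    have pd_pot': "B2 = - c $ 2 * y - c $ 3 * x - c $ 7" "B3 = c $ 1 * x - c $ 2 * z + c $ 5"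
      "C3 = c $ 1 * y + c $ 3 * z + c $ 6" "E1 = c $ 4 * x + c $ 8" "E2 = c $ 4 * y + c $ 10"
      "E3 = c $ 4 * z + c $ 9"
      by (simp_all add: B2_def B3_def C3_def E1_def E2_def E3_def pd_pot x_def y_def z_def)
    have T: "twistor p = vector [Complex (x * w - y * u + 1) (z - x * u - y * w),
       Complex (- y - z * w - u) (x + z * u - w), Complex (x * w - y * u - 1) (z - x * u - y * w),
       Complex (- y - z * w + u) (x + z * u + w)]"
      by (simp add: twistor_def x_def y_def z_def u_def w_def)
    show ?thesis
      unfolding vec_eq_iff forall_4 complex_eq_iff Re_Im_slice_field D d pot pd_pot' T
        symmetry_matrix_def vector_4 complex.sel
      using exhaust_15[of k]
      by (elim disjE; simp add: c_def nth_axis; simp add: field_simps power2_eq_square)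
  qed
  then show ?thesis by (simp add: intertwines_def c_def)
qed

lemma linear_symmetry_field: "linear symmetry_field"
  by (rule linearI) (simp_all add: symmetry_field_eq_sum scaleR_add_left scaleR_add_right add_ac)

lemma linear_symmetry_matrix: "linear symmetry_matrix"
  by (rule linearI)
    (simp_all add: symmetry_matrix_def vec_eq_iff forall_4 vector_4 complex_eq_iff field_simps)

lemma intertwines_symmetry_field: "intertwines twistor (symmetry_field c) (symmetry_matrix c)"
proof -
  have *: "intertwines twistor (symmetry_field (r *\<^sub>R c + s *\<^sub>R d)) (symmetry_matrix (r *\<^sub>R c + s *\<^sub>R d))"
    if "intertwines twistor (symmetry_field c) (symmetry_matrix c)"
      "intertwines twistor (symmetry_field d) (symmetry_matrix d)" for r s c d
  proof -
    have "symmetry_field (r *\<^sub>R c + s *\<^sub>R d) = (\<lambda>p. r *\<^sub>R symmetry_field c p + s *\<^sub>R symmetry_field d p)"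
      by (simp add: linear_add[OF linear_symmetry_field] linear_scale[OF linear_symmetry_field]
          plus_fun_def scaleR_fun_def)
    then show ?thesis
      using intertwines_linear[OF smooth_twistor that]
      by (simp add: linear_add[OF linear_symmetry_matrix] linear_scale[OF linear_symmetry_matrix])
  qed
  note axis = intertwines_symmetry_field_axis
  have "subspace {c. intertwines twistor (symmetry_field c) (symmetry_matrix c)}" (is "subspace ?V")
  proof (rule subspaceI)
    show "0 \<in> ?V" using *[OF axis[of 1] axis[of 1], of 0 0] by simp
    show "x + y \<in> ?V" if "x \<in> ?V" "y \<in> ?V" for x y using *[of x y 1 1] that by simp
    show "r *\<^sub>R x \<in> ?V" if "x \<in> ?V" for x r using *[of x x r 0] that by simp
  qed
  moreover have "Basis \<subseteq> ?V" using axis by (auto simp: Basis_vec_def)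
  ultimately have "span Basis \<subseteq> ?V" by (rule span_minimal[rotated])
  then show ?thesis by auto
qed

lemma eq_0_if_intertwines_0:
  assumes "intertwines twistor X 0"
  shows "X = 0"
proof -
  have "slice_field 0 w = 0" for w
    by (simp add: slice_field_def height_def)
  then have "X p = 0" for p
    using assms twistor_immersion[of "X p" p] by (simp add: intertwines_def)
  then show ?thesis by (simp add: fun_eq_iff)
qed

lemma symmetry_field_eq_0_iff: "symmetry_field c = 0 \<longleftrightarrow> c = 0"
proof
  assume S: "symmetry_field c = 0"
  have pot: "potA c p = 0 \<and> potB c p = 0 \<and> potC c p = 0 \<and> potE c p = 0" for p
  proof -
    have eqs: "potA c p + potE c p * inv_normal_length (with_slopes p a b) = 0"
      "- potB c p - potE c p * a * inv_normal_length (with_slopes p a b) = 0"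
      "- potC c p - potE c p * b * inv_normal_length (with_slopes p a b) = 0" for a b
      using frame_table(1-3)[OF base_function_pot[of c], of "with_slopes p a b", folded symmetry_field_def] S
      by (simp_all add: with_slopes_nth base_function_pot[THEN base_function_with_slopes])
    \<comment> \<open>At slopes (0, 0) the second component is - B alone; at (1, 0) it also contains
      E with a nonzero factor.\<close>
    have "potE c p = 0" using eqs(2)[of 0 0] eqs(2)[of 1 0] by simp
    then show ?thesis using eqs[of 0 0] by simp
  qed
  \<comment> \<open>The origin and the points at distance 1 on the axes suffice: the coefficient of
    every mixed monomial is also that of a square in another potential.\<close>
  let ?q = "\<lambda>x y z. vector [x, y, z, 0, 0] :: real^5"
  note E = pot[of "?q 0 0 0"] pot[of "?q 1 0 0"] pot[of "?q (- 1) 0 0"] pot[of "?q 0 1 0"]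
    pot[of "?q 0 (- 1) 0"] pot[of "?q 0 0 1"] pot[of "?q 0 0 (- 1)"]
  have "c $ 1 = 0 \<and> c $ 2 = 0 \<and> c $ 3 = 0 \<and> c $ 4 = 0 \<and> c $ 5 = 0 \<and> c $ 6 = 0 \<and> c $ 7 = 0 \<and> c $ 8 = 0
    \<and> c $ 9 = 0 \<and> c $ 10 = 0 \<and> c $ 11 = 0 \<and> c $ 12 = 0 \<and> c $ 13 = 0 \<and> c $ 14 = 0 \<and> c $ 15 = 0"
    using E by (simp add: pot_defs vector_5)
  then have "c $ k = 0" for k using exhaust_15[of k] by (elim disjE) simp_all
  then show "c = 0" by (simp add: vec_eq_iff)
qed (simp add: linear_0[OF linear_symmetry_field])

section \<open>The matrix algebra su(2,2)\<close>

lemma su22_iff: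
  "A \<in> su22 \<longleftrightarrow> (\<forall>i j. cnj (A $ j $ i) * I22 $ j $ j + I22 $ i $ i * A $ i $ j = 0) \<and>
    A $ 1 $ 1 + A $ 2 $ 2 + A $ 3 $ 3 + A $ 4 $ 4 = 0"
  by (simp add: su22_def vec_eq_iff forall_4 matrix_matrix_mult_def sum_4 conj_transpose_def I22_def
      trace_def)

lemma range_symmetry_matrix: "range symmetry_matrix = su22"
proof (intro equalityI subsetI)
  fix A assume "A \<in> range symmetry_matrix"
  then show "A \<in> su22"
    by (auto simp: su22_iff forall_4 symmetry_matrix_def vector_4 I22_def complex_eq_iff)
next
  fix A assume "A \<in> su22"
  define e :: "4 \<Rightarrow> real" where "e i = (if i = 1 \<or> i = 2 then 1 else - 1)" for i
  have I: "I22 $ i $ i = complex_of_real (e i)" for i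
    by (simp add: I22_def e_def)
  have H: "cnj (A $ j $ i) * I22 $ j $ j + I22 $ i $ i * A $ i $ j = 0" for i j
    using \<open>A \<in> su22\<close> unfolding su22_iff by blast
  have Re: "Re (A $ j $ i) * e j = - e i * Re (A $ i $ j)"
    and Im: "Im (A $ j $ i) * e j = e i * Im (A $ i $ j)" for i j
    using arg_cong[OF H, of Re] arg_cong[OF H, of Im] by (simp_all add: I eq_neg_iff_add_eq_0)
  have tr: "A $ 1 $ 1 + A $ 2 $ 2 + A $ 3 $ 3 + A $ 4 $ 4 = 0"
    using \<open>A \<in> su22\<close> unfolding su22_iff by blast
  have A: "Re (A $ 1 $ 1) = 0" "Re (A $ 2 $ 2) = 0" "Re (A $ 3 $ 3) = 0" "Re (A $ 4 $ 4) = 0"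
    "Re (A $ 2 $ 1) = - Re (A $ 1 $ 2)" "Im (A $ 2 $ 1) = Im (A $ 1 $ 2)"
    "Re (A $ 3 $ 1) = Re (A $ 1 $ 3)" "Im (A $ 3 $ 1) = - Im (A $ 1 $ 3)"
    "Re (A $ 4 $ 1) = Re (A $ 1 $ 4)" "Im (A $ 4 $ 1) = - Im (A $ 1 $ 4)"
    "Re (A $ 3 $ 2) = Re (A $ 2 $ 3)" "Im (A $ 3 $ 2) = - Im (A $ 2 $ 3)"
    "Re (A $ 4 $ 2) = Re (A $ 2 $ 4)" "Im (A $ 4 $ 2) = - Im (A $ 2 $ 4)"
    "Re (A $ 4 $ 3) = - Re (A $ 3 $ 4)" "Im (A $ 4 $ 3) = Im (A $ 3 $ 4)"
    "Im (A $ 4 $ 4) = - Im (A $ 1 $ 1) - Im (A $ 2 $ 2) - Im (A $ 3 $ 3)"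
    using Re[of 1 1] Re[of 2 2] Re[of 3 3] Re[of 4 4] Re[of 2 1] Im[of 2 1] Re[of 3 1] Im[of 3 1]
      Re[of 4 1] Im[of 4 1] Re[of 3 2] Im[of 3 2] Re[of 4 2] Im[of 4 2] Re[of 4 3] Im[of 4 3]
      arg_cong[OF tr, of Im]
    by (simp_all add: e_def)
  let ?r = "\<lambda>i j. Re (A $ i $ j)" and ?i = "\<lambda>i j. Im (A $ i $ j)"
  \<comment> \<open>Solves the entries of \<open>symmetry_matrix\<close> for the coefficients; for
    instance the real parts of the entries (1,2) and (3,4) add up to \<open>c $ 5\<close>.\<close>
  define c :: "real^15" where "c = vector [
    - (?i 1 1 + ?i 4 4 + ?i 1 3 - ?i 2 4),
    - (?i 1 2 - ?i 3 4 + ?i 1 4 + ?i 2 3),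
    ?r 1 2 - ?r 3 4 + ?r 1 4 - ?r 2 3,
    ?i 1 1 + ?i 2 2 + ?i 1 3 + ?i 2 4,
    ?r 1 2 + ?r 3 4,
    - (?i 1 2 + ?i 3 4),
    ?i 1 1 + ?i 3 3,
    ?r 1 4 + ?r 2 3,
    ?r 1 3 - ?r 2 4,
    ?i 2 3 - ?i 1 4,
    (?i 1 1 + ?i 2 2 - ?i 1 3 - ?i 2 4) / 2,
    ?r 1 3 + ?r 2 4,
    (?i 1 2 - ?i 3 4 - ?i 1 4 - ?i 2 3) / 2,
    (?r 1 2 - ?r 3 4 - ?r 1 4 + ?r 2 3) / 2,
    (?i 1 1 + ?i 4 4 - ?i 1 3 + ?i 2 4) / 2]"
  have "A = symmetry_matrix c"
    unfolding vec_eq_iff forall_4 symmetry_matrix_def vector_4 complex_eq_iff c_def vector_15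
      complex.sel
    unfolding A by (intro conjI; simp add: field_simps)
  then show "A \<in> range symmetry_matrix" by blast
qed

lemma matrix_mult_linear:
  fixes A B C :: "complex^'n^'n"
  shows "(A + B) ** C = A ** C + B ** C" "A ** (B + C) = A ** B + A ** C"
    "(A - B) ** C = A ** C - B ** C" "A ** (B - C) = A ** B - A ** C"
    "(r *\<^sub>R A) ** B = r *\<^sub>R (A ** B)" "A ** (r *\<^sub>R B) = r *\<^sub>R (A ** B)" "(- A) ** B = - (A ** B)"
    "A ** (- B) = - (A ** B)"
  by (simp_all add: vec_eq_iff matrix_matrix_mult_def sum.distrib sum_subtractf sum_negf
      scaleR_sum_right algebra_simps)

lemma conj_transpose_simps:
  fixes A B :: "complex^'n^'n"
  shows "conj_transpose (A + B) = conj_transpose A + conj_transpose B"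
    "conj_transpose (A - B) = conj_transpose A - conj_transpose B"
    "conj_transpose (r *\<^sub>R A) = r *\<^sub>R conj_transpose A"
    "conj_transpose (A ** B) = conj_transpose B ** conj_transpose A"
  by (simp_all add: vec_eq_iff conj_transpose_def matrix_matrix_mult_def mult.commute
      scaleR_conv_of_real[where 'a = complex])

lemma commutator_su22:
  assumes "A \<in> su22" "B \<in> su22"
  shows "commutator A B \<in> su22"
proof -
  have h: "conj_transpose A ** I22 = - (I22 ** A)" "conj_transpose B ** I22 = - (I22 ** B)"
    using assms by (auto simp: su22_def eq_neg_iff_add_eq_0)
  \<comment> \<open>Each adjoint passes \<open>I22\<close> at the cost of a sign, and the two signs
    cancel.\<close>
  have "(conj_transpose B ** conj_transpose A) ** I22 = I22 ** (B ** A)"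
    "(conj_transpose A ** conj_transpose B) ** I22 = I22 ** (A ** B)"
    by (simp_all add: h matrix_mult_linear flip: matrix_mul_assoc)
      (simp_all add: h matrix_mult_linear matrix_mul_assoc)
  moreover have "trace (A ** B) = trace (B ** A)"
    by (simp add: trace_def sum_4 matrix_matrix_mult_def algebra_simps)
  then have "trace (A ** B - B ** A) = 0"
    by (simp add: trace_def sum_4 algebra_simps)
  ultimately show ?thesis
    by (simp add: su22_def commutator_def conj_transpose_simps matrix_mult_linear)
qed

lemma real_lie_algebra_su22: "real_lie_algebra su22 commutator"
proof -
  have "subspace su22"
    using linear_subspace_image[OF linear_symmetry_matrix subspace_UNIV] by (simp add: range_symmetry_matrix)
  then show ?thesis
    by (simp add: real_lie_algebra_def commutator_su22)
      (simp add: commutator_def matrix_mult_linear matrix_mul_assoc algebra_simps)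
qed

text \<open>An injective linear map that respects brackets reflects every identity, so the Lie
  algebra axioms need only be known in \<open>M\<close>.\<close>

lemma isomorphic_lie_algebras_pullback:
  assumes L: "subspace L" and M: "real_lie_algebra M br'"
    and \<phi>: "bij_betw \<phi> L M"
    and lin: "\<And>x y r s. x \<in> L \<Longrightarrow> y \<in> L \<Longrightarrow> \<phi> (r *\<^sub>R x + s *\<^sub>R y) = r *\<^sub>R \<phi> x + s *\<^sub>R \<phi> y"
    and closed: "\<And>x y. x \<in> L \<Longrightarrow> y \<in> L \<Longrightarrow> br x y \<in> L"
    and hom: "\<And>x y. x \<in> L \<Longrightarrow> y \<in> L \<Longrightarrow> \<phi> (br x y) = br' (\<phi> x) (\<phi> y)"
  shows "isomorphic_lie_algebras L br M br'"
proof -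
  note sub = subspace_add[OF L] subspace_scale[OF L] subspace_0[OF L]
  have mem: "\<phi> x \<in> M" if "x \<in> L" for x using \<phi> that by (auto simp: bij_betw_def)
  have inj: "x = y" if "\<phi> x = \<phi> y" "x \<in> L" "y \<in> L" for x y
    using \<phi> that by (auto simp: bij_betw_def inj_on_def)
  have 0: "\<phi> 0 = 0" using lin[of 0 0 0 0] sub by simp
  have add: "\<phi> (x + y) = \<phi> x + \<phi> y" if "x \<in> L" "y \<in> L" for x y using lin[of x y 1 1] that by simp
  note alg = M[unfolded real_lie_algebra_def]
  have bil: "br' (r *\<^sub>R x + s *\<^sub>R y) z = r *\<^sub>R br' x z + s *\<^sub>R br' y z"
    "br' z (r *\<^sub>R x + s *\<^sub>R y) = r *\<^sub>R br' z x + s *\<^sub>R br' z y"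
    if "x \<in> M" "y \<in> M" "z \<in> M" for x y z r s using alg that by blast+
  have alt: "br' x x = 0" if "x \<in> M" for x using alg that by blast
  have jac: "br' x (br' y z) + br' y (br' z x) + br' z (br' x y) = 0"
    if "x \<in> M" "y \<in> M" "z \<in> M" for x y z using alg that by blast
  have "real_lie_algebra L br"
    unfolding real_lie_algebra_def
  proof (intro conjI ballI allI)
    fix x y z :: 'a and r s :: real
    assume "x \<in> L" "y \<in> L" "z \<in> L"
    note in_L = this sub closed
    show "br (r *\<^sub>R x + s *\<^sub>R y) z = r *\<^sub>R br x z + s *\<^sub>R br y z"
      by (rule inj) (simp_all add: in_L hom lin bil mem)
    show "br z (r *\<^sub>R x + s *\<^sub>R y) = r *\<^sub>R br z x + s *\<^sub>R br z y"
      by (rule inj) (simp_all add: in_L hom lin bil mem)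
    show "br x (br y z) + br y (br z x) + br z (br x y) = 0"
      by (rule inj) (simp_all add: in_L hom add jac mem 0)
  next
    fix x assume "x \<in> L"
    then show "br x x = 0"
      by (intro inj) (simp_all add: sub closed hom alt mem 0)
  qed (use L closed in auto)
  then show ?thesis
    unfolding isomorphic_lie_algebras_def using M \<phi> lin hom by blast
qed

section \<open>The isomorphism, the span and the dimension\<close>

lemma inj_symmetry_field: "inj symmetry_field"
  unfolding linear_injective_0[OF linear_symmetry_field] by (simp add: symmetry_field_eq_0_iff)

lemma inj_symmetry_matrix: "inj symmetry_matrix"
  unfolding linear_injective_0[OF linear_symmetry_matrix]
proof (intro allI impI)
  fix c assume "symmetry_matrix c = 0"
  then have "c $ 1 = 0 \<and> c $ 2 = 0 \<and> c $ 3 = 0 \<and> c $ 4 = 0 \<and> c $ 5 = 0 \<and> c $ 6 = 0 \<and> c $ 7 = 0 \<and> c $ 8 = 0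
    \<and> c $ 9 = 0 \<and> c $ 10 = 0 \<and> c $ 11 = 0 \<and> c $ 12 = 0 \<and> c $ 13 = 0 \<and> c $ 14 = 0 \<and> c $ 15 = 0"
    unfolding vec_eq_iff forall_4 symmetry_matrix_def vector_4 complex_eq_iff complex.sel
      zero_index zero_complex.sel
    by linarith
  then have "c $ k = 0" for k using exhaust_15[of k] by (elim disjE) simp_all
  then show "c = 0" by (simp add: vec_eq_iff)
qed

lemma smooth_symmetry_field: "smooth (symmetry_field c)"
  unfolding symmetry_field_def
  by (intro smooth_contact_field smooth_contact_potential base_function_pot)

text \<open>The commutator lies in \<open>su22\<close>, hence is the matrix of some symmetry field;
  its difference from the bracket intertwines with 0 and so vanishes.\<close>

lemma lie_bracket_symmetry_field:
  obtains e where "lie_bracket (symmetry_field c) (symmetry_field d) = symmetry_field e"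
    "symmetry_matrix e = commutator (symmetry_matrix d) (symmetry_matrix c)"
proof -
  let ?X = "lie_bracket (symmetry_field c) (symmetry_field d)"
  let ?A = "commutator (symmetry_matrix d) (symmetry_matrix c)"
  have "?A \<in> su22" by (intro commutator_su22) (auto simp flip: range_symmetry_matrix)
  then obtain e where e: "symmetry_matrix e = ?A" using range_symmetry_matrix by (metis imageE)
  have "intertwines twistor ?X ?A"
    by (intro intertwines_lie_bracket smooth_twistor smooth_symmetry_field intertwines_symmetry_field)
  from intertwines_linear[OF smooth_twistor this intertwines_symmetry_field[of e], of 1 "- 1"]
  have "intertwines twistor (\<lambda>p. ?X p - symmetry_field e p) 0" by (simp add: e)
  from eq_0_if_intertwines_0[OF this] have "?X = symmetry_field e" by (simp add: fun_eq_iff)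
  with e that show thesis by blast
qed

lemma isomorphic_symmetries_su22:
  "isomorphic_lie_algebras (range symmetry_field) lie_bracket su22 commutator"
proof -
  \<comment> \<open>The sign is needed because linear vector fields bracket to the opposite of the commutator.\<close>
  define \<phi> where "\<phi> X = - symmetry_matrix (inv symmetry_field X)" for X
  have \<phi>: "\<phi> (symmetry_field c) = - symmetry_matrix c" for c
    by (simp add: \<phi>_def inv_f_f[OF inj_symmetry_field])
  note linS = linear_add[OF linear_symmetry_field] linear_scale[OF linear_symmetry_field]
  note linM = linear_add[OF linear_symmetry_matrix] linear_scale[OF linear_symmetry_matrix]
    linear_neg[OF linear_symmetry_matrix]
  show ?thesis
  proof (rule isomorphic_lie_algebras_pullback[OF _ real_lie_algebra_su22, of _ \<phi>])
    show "subspace (range symmetry_field)"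
      by (rule linear_subspace_image[OF linear_symmetry_field subspace_UNIV])
    show "bij_betw \<phi> (range symmetry_field) su22"
      unfolding bij_betw_def
    proof
      show "inj_on \<phi> (range symmetry_field)"
        by (rule inj_onI) (auto simp: \<phi> dest: injD[OF inj_symmetry_matrix])
      have "\<phi> ` range symmetry_field = range (\<lambda>c. symmetry_matrix (- c))"
        by (simp add: image_image \<phi> linM)
      also have "symmetry_matrix c \<in> \<dots>" for c
        using rangeI[of "\<lambda>c. symmetry_matrix (- c)" "- c"] by simp
      then have "range (\<lambda>c. symmetry_matrix (- c)) = range symmetry_matrix" by auto
      finally show "\<phi> ` range symmetry_field = su22" by (simp add: range_symmetry_matrix)
    qed
  next
    fix X Y assume "X \<in> range symmetry_field" "Y \<in> range symmetry_field"
    then obtain c d where [simp]: "X = symmetry_field c" "Y = symmetry_field d" by auto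
    show "\<phi> (r *\<^sub>R X + s *\<^sub>R Y) = r *\<^sub>R \<phi> X + s *\<^sub>R \<phi> Y" for r s
      by (simp add: \<phi> linM flip: linS)
    obtain e where e: "lie_bracket (symmetry_field c) (symmetry_field d) = symmetry_field e"
      "symmetry_matrix e = commutator (symmetry_matrix d) (symmetry_matrix c)"
      by (rule lie_bracket_symmetry_field)
    show "lie_bracket X Y \<in> range symmetry_field" by (simp add: e)
    show "\<phi> (lie_bracket X Y) = commutator (\<phi> X) (\<phi> Y)"
      by (simp add: \<phi> e) (simp add: commutator_def matrix_mult_linear)
  qed
qed

lemma range_symmetry_field:
  "range symmetry_field = span {X1, X2, X3, X4, X5, X6, X7, X8, X9, X10, X11, X12, X13, X14, X15}"
    (is "_ = span ?B")
proof
  show "range symmetry_field \<subseteq> span ?B"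
    unfolding symmetry_field_eq_sum
    by (auto intro!: span_add span_scale intro: span_base)
  have axis: "symmetry_field (axis 1 1) = X1" "symmetry_field (axis 2 1) = X2"
    "symmetry_field (axis 3 1) = X3" "symmetry_field (axis 4 1) = X4"
    "symmetry_field (axis 5 1) = X5" "symmetry_field (axis 6 1) = X6"
    "symmetry_field (axis 7 1) = X7" "symmetry_field (axis 8 1) = X8"
    "symmetry_field (axis 9 1) = X9" "symmetry_field (axis 10 1) = X10"
    "symmetry_field (axis 11 1) = X11" "symmetry_field (axis 12 1) = X12"
    "symmetry_field (axis 13 1) = X13" "symmetry_field (axis 14 1) = X14"
    "symmetry_field (axis 15 1) = X15"
    unfolding symmetry_field_eq_sum nth_axis by simp_all
  then have "?B \<subseteq> range symmetry_field" by (auto simp flip: axis)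
  then show "span ?B \<subseteq> range symmetry_field"
    by (rule span_minimal) (rule linear_subspace_image[OF linear_symmetry_field subspace_UNIV])
qed

lemma dim_range_symmetry_field: "dim (range symmetry_field) = 15"
proof -
  have inj: "inj_on symmetry_field (span Basis)"
    using inj_symmetry_field by simp
  have "span (symmetry_field ` Basis) = range symmetry_field"
    by (simp add: span_linear_image[OF linear_symmetry_field])
  moreover have "independent (symmetry_field ` Basis)"
    by (rule linear_independent_injective_image[OF linear_symmetry_field independent_Basis inj])
  ultimately have "dim (range symmetry_field) = card (symmetry_field ` Basis)"
    by (metis dim_span_eq_card_independent)
  also have "\<dots> = DIM(real^15)"
    by (rule card_image) (rule inj_on_subset[OF inj_symmetry_field subset_UNIV])
  finally show ?thesis by simp
qed

theorem proposition3p1: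
  shows "isomorphic_lie_algebras (infinitesimal_symmetries omega0 g0) lie_bracket su22 commutator \<and>
    dim (infinitesimal_symmetries omega0 g0) = 15 \<and>
    infinitesimal_symmetries omega0 g0 =
      span {X1, X2, X3, X4, X5, X6, X7, X8, X9, X10, X11, X12, X13, X14, X15}"
  using isomorphic_symmetries_su22 dim_range_symmetry_field
  by (simp add: infinitesimal_symmetries_eq range_symmetry_field)

end
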